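(* Let $\Lambda$ be a finite measure on $[0,1]$ with $\Lambda(\{1\})=0$, and let $(\Pi_t)_{t\geq 0}$ be the $\Lambda$-coalescent. For $n\in\mathbb{Z}$ let $\mu^n=\int_0^1 x^n\Lambda(dx)$ (with the convention $1/0=\infty$). For $t>0$ let $N^a_t=|\{b\in\Pi_t : \mathrm{freq}(b)>0\}|$ be the number of atomic blocks of $\Pi_t$. Suppose that $\mu^{-1}<\infty$. If $\mu^{-2}=\infty$ then $\mathbb{P}[\forall t>0,\ N^a_t=\infty]=1$, whereas if $\mu^{-2}<\infty$ then $\mathbb{P}[\forall t>0,\ N^a_t<\infty]=1$.
   Context: For $n\in\mathbb{N}$, let $\iota_n$ be the restriction map from partitions of $\mathbb{N}$ to partitions of $\{1,\dots,n\}$. The $\Lambda$-coalescent is the Markov process $(\Pi_t)_{t\ge 0}$ with values in partitions of $\mathbb{N}$, started from the partition of $\mathbb{N}$ into singletons, such that for every $n$, $\iota_n(\Pi_t)$ is a Markov chain in which, whenever it has $i$ blocks, each particular $k$-tuple of blocks ($2\le k\le i$) merges into one block at rate $\lambda_{i,k}=\int_0^1x^{k-2}(1-x)^{i-k}\Lambda(dx)$, independently of all other $k$-tuples. For each $t>0$, $\Pi_t$ is an exchangeable partition, so almost surely every block $b$ has an asymptotic frequency $\mathrm{freq}(b)=\lim_{k\to\infty}|b\cap\{1,\dots,k\}|/k$. A block with $\mathrm{freq}(b)>0$ is called atomic. *)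

theory Defs
  imports "HOL-Probability.Probability" "HOL-Library.Disjoint_Sets"
begin

text \<open>Partitions of the label set are represented as sets of blocks (nat set set).
  The label set N is represented by UNIV :: nat set (labels 0,1,2,...), and
  the restriction to the first n labels is the restriction to {..<n}.\<close>

definition restr :: "nat \<Rightarrow> nat set set \<Rightarrow> nat set set" where
  "restr n P = ((\<lambda>b. b \<inter> {..<n}) ` P) - {{}}"

definition parts :: "nat \<Rightarrow> nat set set set" where
  "parts n = {P. partition_on {..<n} P}"

definition singletons :: "nat \<Rightarrow> nat set set" where
  "singletons n = (\<lambda>i. {i}) ` {..<n}"

definition merge :: "nat set set \<Rightarrow> nat set set \<Rightarrow> nat set set" where
  "merge P K = insert (\<Union>K) (P - K)"

definition lam :: "real measure \<Rightarrow> nat \<Rightarrow> nat \<Rightarrow> real" where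
  "lam \<Lambda> i k = integral\<^sup>L \<Lambda> (\<lambda>x. x ^ (k - 2) * (1 - x) ^ (i - k))"

definition Qgen :: "real measure \<Rightarrow> nat \<Rightarrow> nat set set \<Rightarrow> nat set set \<Rightarrow> real" where
  "Qgen \<Lambda> n p q =
     (if p \<in> parts n \<and> q \<in> parts n then
        (\<Sum>K\<in>{K. K \<subseteq> p \<and> 2 \<le> card K \<and> merge p K = q}. lam \<Lambda> (card p) (card K))
        - (if p = q then (\<Sum>K\<in>{K. K \<subseteq> p \<and> 2 \<le> card K}. lam \<Lambda> (card p) (card K)) else 0)
      else 0)"

fun Qpow :: "real measure \<Rightarrow> nat \<Rightarrow> nat \<Rightarrow> nat set set \<Rightarrow> nat set set \<Rightarrow> real" where
  "Qpow \<Lambda> n 0 p q = (if p = q then 1 else 0)"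
| "Qpow \<Lambda> n (Suc m) p q = (\<Sum>r\<in>parts n. Qpow \<Lambda> n m p r * Qgen \<Lambda> n r q)"

definition trans :: "real measure \<Rightarrow> nat \<Rightarrow> real \<Rightarrow> nat set set \<Rightarrow> nat set set \<Rightarrow> real" where
  "trans \<Lambda> n t p q = (\<Sum>m. t ^ m / fact m * Qpow \<Lambda> n m p q)"

fun path_prob :: "(real \<Rightarrow> nat set set \<Rightarrow> nat set set \<Rightarrow> real) \<Rightarrow> real \<Rightarrow> nat set set
    \<Rightarrow> (real \<times> nat set set) list \<Rightarrow> real" where
  "path_prob P t q [] = 1"
| "path_prob P t q ((t', q') # rest) = P (t' - t) q q' * path_prob P t' q' rest"

text \<open>(M, Coal) is a (cadlag version of the) Lambda-coalescent started from singletons.\<close>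
definition lambda_coalescent :: "real measure \<Rightarrow> 'w measure \<Rightarrow> (real \<Rightarrow> 'w \<Rightarrow> nat set set) \<Rightarrow> bool" where
  "lambda_coalescent \<Lambda> M Coal \<longleftrightarrow>
     prob_space M \<and>
     (\<forall>\<omega>\<in>space M.
        Coal 0 \<omega> = range (\<lambda>i. {i}) \<and>
        (\<forall>t\<ge>0. partition_on UNIV (Coal t \<omega>)) \<and>
        (\<forall>n. \<forall>t\<ge>0. \<exists>e>0. \<forall>s. t \<le> s \<and> s < t + e \<longrightarrow> restr n (Coal s \<omega>) = restr n (Coal t \<omega>)) \<and>
        (\<forall>n. \<forall>t>0. \<exists>e>0. \<forall>s s'. t - e < s \<and> s < t \<and> t - e < s' \<and> s' < t \<longrightarrow>
              restr n (Coal s \<omega>) = restr n (Coal s' \<omega>))) \<and>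
     (\<forall>n t q. t \<ge> 0 \<longrightarrow> {\<omega>\<in>space M. restr n (Coal t \<omega>) = q} \<in> sets M) \<and>
     (\<forall>n tqs. sorted_wrt (<) (0 # map fst tqs) \<longrightarrow>
        measure M {\<omega>\<in>space M. \<forall>(t, q)\<in>set tqs. restr n (Coal t \<omega>) = q}
          = path_prob (trans \<Lambda> n) 0 (singletons n) tqs)"

definition atomic :: "nat set \<Rightarrow> bool" where
  "atomic b \<longleftrightarrow> (\<exists>f>0. (\<lambda>k. real (card (b \<inter> {..<k})) / real k) \<longlonglongrightarrow> f)"

definition mu_neg :: "real measure \<Rightarrow> nat \<Rightarrow> ennreal" where
  "mu_neg \<Lambda> m = (\<integral>\<^sup>+ x. (if x = 0 then \<infinity> else ennreal (1 / x ^ m)) \<partial>\<Lambda>)"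

end

theory Submission
  imports Defs
begin

text \<open>
  Put \<nu>(dx) = x^(-2) \<Lambda>(dx), so that a merger event of strength x happens at rate \<nu>(dx), each block
  taking part with probability x. The hypothesis says that \<nu> integrates x, and \<mu>^(-2) is the total
  mass of \<nu>. Only the finite restrictions of the coalescent are used, through Dynkin's formula for
  functions F with generator bounded above.

  If \<nu> is finite, a merger creates at most one new non-singleton block, so along a time grid the
  expected total increase of their number up to T is at most T \<nu>(0,1), uniformly in the grid and in
  the number of labels. Atomic blocks are non-singleton, hence Markov's inequality and Fatou's lemma
  bound their number at all times simultaneously.

  If \<nu> is infinite, consider the Lyapunov function g \<mapsto> (1 - ln (1 + g) / ln A)^+ of the number g of
  blocks of a given family that have not yet taken part in a merger. By Jensen's inequality its drift
  is at most the integral of min 1 (- ln (1 - x) / ln A) against \<nu>, which vanishes as A tends to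
  infinity. Hence a large family has many members left after any fixed time. Applied to the
  singletons, this keeps plenty of dust, from which new blocks are born at a rate exceeding any bound;
  so at some arbitrarily early time there are many non-singleton blocks. Applied to these blocks,
  many of them are still unchanged at time T, hence belong to the partition at all times in between.
  Finally, by exchangeability a non-singleton block at a fixed time is almost surely atomic.
\<close>

section \<open>Random subsets and the logarithmic Lyapunov function\<close>

lemma sum_Pow_card:
  fixes f :: "nat \<Rightarrow> real"
  assumes "finite W"
  shows "(\<Sum>K\<in>Pow W. f (card K)) = (\<Sum>k\<le>card W. real (card W choose k) * f k)"
proof -
  have "(\<Sum>K\<in>Pow W. f (card K)) = (\<Sum>k\<in>{..card W}. \<Sum>K\<in>{K\<in>Pow W. card K = k}. f (card K))"
    by (rule sum.group[symmetric]) (use assms in \<open>auto intro: card_mono\<close>)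
  also have "\<dots> = (\<Sum>k\<le>card W. real (card W choose k) * f k)"
  proof (rule sum.cong)
    fix k
    have "{K\<in>Pow W. card K = k} = {K. K \<subseteq> W \<and> card K = k}" by auto
    then show "(\<Sum>K\<in>{K\<in>Pow W. card K = k}. f (card K)) = real (card W choose k) * f k"
      using n_subsets[OF assms, of k] by simp
  qed simp
  finally show ?thesis .
qed

lemma sum_binomial_weights:
  fixes x :: real
  shows "(\<Sum>k\<le>n. real (n choose k) * (x ^ k * (1 - x) ^ (n - k))) = 1"
  using binomial_ring[of x "1 - x" n] by (simp add: mult.assoc)

lemma sum_Pow_weights:
  fixes x :: real
  assumes "finite W"
  shows "(\<Sum>K\<in>Pow W. x ^ card K * (1 - x) ^ (card W - card K)) = 1"
  using sum_Pow_card[OF assms, of "\<lambda>k. x ^ k * (1 - x) ^ (card W - k)"]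
    sum_binomial_weights[of "card W" x] by simp

lemma sum_Pow_weights_ge_2:
  fixes x :: real
  assumes "finite W"
  shows "(\<Sum>K | K \<subseteq> W \<and> 2 \<le> card K. x ^ card K * (1 - x) ^ (card W - card K))
    = 1 - (1 - x) ^ card W - real (card W) * x * (1 - x) ^ (card W - 1)"
proof -
  let ?f = "\<lambda>k. x ^ k * (1 - x) ^ (card W - k)"
  have "(\<Sum>K | K \<subseteq> W \<and> 2 \<le> card K. ?f (card K))
      = (\<Sum>K\<in>Pow W. if 2 \<le> card K then ?f (card K) else 0)"
    by (subst sum.inter_filter[symmetric]) (use assms in \<open>auto intro!: sum.cong\<close>)
  also have "\<dots> = (\<Sum>k\<le>card W. real (card W choose k) * (if 2 \<le> k then ?f k else 0))"
    by (rule sum_Pow_card[OF assms])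
  also have "\<dots> = (\<Sum>k\<le>card W. real (card W choose k) * ?f k
      - (if k = 0 then ?f 0 else 0) - (if k = 1 then real (card W) * ?f 1 else 0))"
    by (intro sum.cong) auto
  also have "\<dots> = 1 - ?f 0 - real (card W) * ?f 1"
  proof -
    have "(\<Sum>k\<le>card W. if k = 1 then real (card W) * ?f 1 else 0) = real (card W) * ?f 1"
      by (cases "card W = 0") (auto simp: sum.delta)
    then show ?thesis
      by (simp add: sum_subtractf sum_binomial_weights sum.delta)
  qed
  finally show ?thesis by (simp add: mult.assoc)
qed

lemma sum_Pow_weights_inverse:
  fixes x :: real
  assumes "finite W" "0 \<le> x" "x < 1"
  shows "(\<Sum>K\<in>Pow W. x ^ card K * (1 - x) ^ (card W - card K) * (1 / (1 + real (card W - card K))))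
    \<le> 1 / ((1 - x) * (1 + real (card W)))"
proof -
  define g where "g = card W"
  have *: "real (g choose k) * (x ^ k * (1 - x) ^ (g - k) * (1 / (1 + real (g - k))))
      = real (Suc g choose k) * (x ^ k * (1 - x) ^ (Suc g - k)) * (1 / ((1 - x) * (1 + real g)))"
    if "k \<le> g" for k
  proof -
    have "(Suc g - k) * (Suc g choose k) = Suc g * (g choose k)"
      using binomial_absorb_comp[of "Suc g" k] by simp
    then have "real (Suc g - k) * real (Suc g choose k) = real (Suc g) * real (g choose k)"
      by (metis of_nat_mult)
    then have "(1 + real (g - k)) * real (Suc g choose k) = (1 + real g) * real (g choose k)"
      using that by (simp add: Suc_diff_le)
    moreover have "(1 - x) ^ (Suc g - k) = (1 - x) * (1 - x) ^ (g - k)"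
      using that by (simp add: Suc_diff_le)
    ultimately show ?thesis using assms by (simp add: divide_simps) (simp add: algebra_simps)
  qed
  have "(\<Sum>K\<in>Pow W. x ^ card K * (1 - x) ^ (card W - card K) * (1 / (1 + real (card W - card K))))
     = (\<Sum>k\<le>g. real (g choose k) * (x ^ k * (1 - x) ^ (g - k) * (1 / (1 + real (g - k)))))"
    unfolding g_def by (rule sum_Pow_card[OF assms(1), of "\<lambda>k. x ^ k * (1 - x) ^ (card W - k) * (1 / (1 + real (card W - k)))"])
  also have "\<dots> = (\<Sum>k\<le>g. real (Suc g choose k) * (x ^ k * (1 - x) ^ (Suc g - k)) * (1 / ((1 - x) * (1 + real g))))"
    by (intro sum.cong refl *) auto
  also have "\<dots> = (\<Sum>k\<le>g. real (Suc g choose k) * (x ^ k * (1 - x) ^ (Suc g - k))) * (1 / ((1 - x) * (1 + real g)))"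
    by (simp only: sum_distrib_right)
  also have "(\<Sum>k\<le>g. real (Suc g choose k) * (x ^ k * (1 - x) ^ (Suc g - k)))
      \<le> (\<Sum>k\<le>Suc g. real (Suc g choose k) * (x ^ k * (1 - x) ^ (Suc g - k)))"
    using assms by simp
  also have "\<dots> = 1" by (rule sum_binomial_weights)
  finally show ?thesis using assms by (simp add: g_def divide_right_mono)
qed

lemma sum_Pow_weights_restrict:
  fixes x :: real and f :: "nat \<Rightarrow> real"
  assumes "finite p" "W \<subseteq> p"
  shows "(\<Sum>K\<in>Pow p. x ^ card K * (1 - x) ^ (card p - card K) * f (card (W - K)))
    = (\<Sum>J\<in>Pow W. x ^ card J * (1 - x) ^ (card W - card J) * f (card W - card J))"
proof -
  have fW: "finite W" using assms finite_subset by auto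
  let ?h = "\<lambda>(J, L). (x ^ card J * (1 - x) ^ (card W - card J) * f (card W - card J))
      * (x ^ card L * (1 - x) ^ (card (p - W) - card L))"
  have "(\<Sum>K\<in>Pow p. x ^ card K * (1 - x) ^ (card p - card K) * f (card (W - K)))
      = (\<Sum>z\<in>Pow W \<times> Pow (p - W). ?h z)"
  proof (rule sum.reindex_bij_witness[where i = "\<lambda>(J, L). J \<union> L" and j = "\<lambda>K. (K \<inter> W, K - W)"])
    fix K assume K: "K \<in> Pow p"
    then have fK: "finite K" using assms finite_subset by auto
    have 1: "card K = card (K \<inter> W) + card (K - W)"
      using fK by (metis card_Int_Diff)
    have 2: "card p = card W + card (p - W)"
      using assms fW by (metis card_Int_Diff inf.absorb_iff2)
    have 3: "card (K \<inter> W) \<le> card W" "card (K - W) \<le> card (p - W)"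
      using K assms fW by (auto intro!: card_mono)
    have 4: "card (W - K) = card W - card (K \<inter> W)"
      using fW by (simp add: card_Diff_subset_Int Int_commute)
    have 5: "card p - card K = (card W - card (K \<inter> W)) + (card (p - W) - card (K - W))"
      using 1 2 3 by simp
    show "?h (K \<inter> W, K - W) = x ^ card K * (1 - x) ^ (card p - card K) * f (card (W - K))"
      by (simp only: 4 5) (simp add: 1 power_add)
  qed (use assms in auto)
  also have "\<dots> = (\<Sum>J\<in>Pow W. x ^ card J * (1 - x) ^ (card W - card J) * f (card W - card J))
      * (\<Sum>L\<in>Pow (p - W). x ^ card L * (1 - x) ^ (card (p - W) - card L))"
    by (simp add: sum_product sum.cartesian_product case_prod_beta)
  also have "\<dots> = (\<Sum>J\<in>Pow W. x ^ card J * (1 - x) ^ (card W - card J) * f (card W - card J))"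
    using sum_Pow_weights[of "p - W" x] assms by simp
  finally show ?thesis .
qed

definition lyap :: "real \<Rightarrow> nat \<Rightarrow> real" where
  "lyap A g = max 0 (1 - ln (1 + real g) / ln A)"

lemma lyap_range: "0 \<le> lyap A g" "1 < A \<Longrightarrow> lyap A g \<le> 1"
  by (auto simp: lyap_def)

lemma lyap_antimono: "1 < A \<Longrightarrow> g \<le> g' \<Longrightarrow> lyap A g' \<le> lyap A g"
  unfolding lyap_def by (intro max.mono) (auto intro!: divide_right_mono)

lemma lyap_eq_0: "1 < A \<Longrightarrow> A \<le> 1 + real g \<Longrightarrow> lyap A g = 0"
  by (auto simp: lyap_def)

lemma lyap_ge_half:
  assumes "1 < A" "(1 + real g)\<^sup>2 \<le> A"
  shows "1 / 2 \<le> lyap A g"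
proof -
  have "2 * ln (1 + real g) = ln ((1 + real g)\<^sup>2)" by (simp add: ln_realpow)
  also have "\<dots> \<le> ln A" using assms by (subst ln_le_cancel_iff) auto
  finally have "ln (1 + real g) / ln A \<le> 1 / 2" using assms by (simp add: field_simps)
  then show ?thesis unfolding lyap_def by linarith
qed

lemma lyap_Suc_diff:
  assumes "1 < A" "S < m" "1 + real m \<le> A"
  shows "(ln (1 + real m) - ln (real m)) / ln A \<le> lyap A S - lyap A (Suc S)"
proof -
  have pos: "0 < ln A" using assms by simp
  have "ln (1 + real (Suc S)) \<le> ln A" "ln (1 + real S) \<le> ln A" using assms by auto
  then have "lyap A S - lyap A (Suc S) = (ln (1 + real (Suc S)) - ln (1 + real S)) / ln A"
    using pos by (auto simp: lyap_def field_simps max_def)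
  moreover have "ln (1 + real m) - ln (real m) \<le> ln (1 + real (Suc S)) - ln (1 + real S)"
  proof -
    have "ln (1 + real m) - ln (real m) = ln ((1 + real m) / real m)"
      using assms by (subst ln_div) auto
    also have "\<dots> \<le> ln ((2 + real S) / (1 + real S))"
      using assms by (subst ln_le_cancel_iff) (auto simp: field_simps)
    also have "\<dots> = ln (1 + real (Suc S)) - ln (1 + real S)"
      by (subst ln_div) auto
    finally show ?thesis .
  qed
  ultimately show ?thesis using pos by (simp add: divide_right_mono)
qed

lemma sum_weights_lyap_le:
  fixes x A :: real
  assumes "finite p" "W \<subseteq> p" "0 < x" "x < 1" "1 < A"
  shows "(\<Sum>K | K \<subseteq> p \<and> 2 \<le> card K. x ^ card K * (1 - x) ^ (card p - card K)
      * (lyap A (card (W - K)) - lyap A (card W))) \<le> min 1 (- ln (1 - x) / ln A)"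
proof -
  have fW: "finite W" using assms finite_subset by auto
  have pos: "0 < ln A" using assms by simp
  define g where "g = card W"
  let ?w = "\<lambda>J. x ^ card J * (1 - x) ^ (g - card J)"
  have w0: "0 \<le> ?w J" for J using assms by simp
  have w1: "(\<Sum>J\<in>Pow W. ?w J) = 1" unfolding g_def by (rule sum_Pow_weights[OF fW])
  have "(\<Sum>K | K \<subseteq> p \<and> 2 \<le> card K. x ^ card K * (1 - x) ^ (card p - card K)
      * (lyap A (card (W - K)) - lyap A (card W)))
     \<le> (\<Sum>K\<in>Pow p. x ^ card K * (1 - x) ^ (card p - card K)
      * (lyap A (card (W - K)) - lyap A (card W)))"
    using assms fW
    by (intro sum_mono2) (auto intro!: mult_nonneg_nonneg lyap_antimono card_mono)
  also have "\<dots> = (\<Sum>J\<in>Pow W. ?w J * (lyap A (g - card J) - lyap A g))"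
    unfolding g_def
    by (rule sum_Pow_weights_restrict[OF assms(1,2), where f = "\<lambda>k. lyap A k - lyap A (card W)"])
  finally have le: "(\<Sum>K | K \<subseteq> p \<and> 2 \<le> card K. x ^ card K * (1 - x) ^ (card p - card K)
      * (lyap A (card (W - K)) - lyap A (card W))) \<le> (\<Sum>J\<in>Pow W. ?w J * (lyap A (g - card J) - lyap A g))" .
  have "(\<Sum>J\<in>Pow W. ?w J * (lyap A (g - card J) - lyap A g)) \<le> (\<Sum>J\<in>Pow W. ?w J * 1)"
    using lyap_range[of A] assms
    by (intro sum_mono mult_left_mono w0) (smt (verit, best))
  then have b1: "(\<Sum>J\<in>Pow W. ?w J * (lyap A (g - card J) - lyap A g)) \<le> 1"
    using w1 by simp
  have "(\<Sum>J\<in>Pow W. ?w J * (lyap A (g - card J) - lyap A g))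
      \<le> (\<Sum>J\<in>Pow W. ?w J * ((1 / ln A) * (- ln (1 - x) - 1 + (1 - x) * (1 + real g) * (1 / (1 + real (g - card J))))))"
  proof (intro sum_mono mult_left_mono w0)
    fix J assume "J \<in> Pow W"
    define c where "c = (1 - x) * (1 + real g)"
    define y where "y = 1 / (1 + real (g - card J))"
    have c: "0 < c" and y: "0 < y" using assms by (auto simp: c_def y_def)
    \<comment> \<open>Jensen: the tangent line of the logarithm at 1 / c dominates it.\<close>
    have "ln (c * y) \<le> c * y - 1" using c y ln_le_minus_one[of "c * y"] by simp
    then have "ln c + ln y \<le> c * y - 1" using c y by (simp add: ln_mult)
    moreover have "ln c = ln (1 - x) + ln (1 + real g)" using assms by (simp add: c_def ln_mult)
    moreover have "ln y = - ln (1 + real (g - card J))" by (simp add: y_def ln_div)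
    ultimately have "ln (1 + real g) - ln (1 + real (g - card J)) \<le> - ln (1 - x) - 1 + c * y"
      by simp
    then have 1: "(ln (1 + real g) - ln (1 + real (g - card J))) / ln A \<le> (- ln (1 - x) - 1 + c * y) / ln A"
      using pos by (simp add: divide_right_mono)
    have "ln (1 + real (g - card J)) \<le> ln (1 + real g)" by simp
    then have "0 \<le> (ln (1 + real g) - ln (1 + real (g - card J))) / ln A" using pos by simp
    then have "lyap A (g - card J) - lyap A g \<le> (ln (1 + real g) - ln (1 + real (g - card J))) / ln A"
      unfolding lyap_def diff_divide_distrib by simp
    with 1 show "lyap A (g - card J) - lyap A g
        \<le> (1 / ln A) * (- ln (1 - x) - 1 + (1 - x) * (1 + real g) * (1 / (1 + real (g - card J))))"
      by (simp add: c_def y_def)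
  qed
  also have "\<dots> = (1 / ln A) * ((- ln (1 - x) - 1) * (\<Sum>J\<in>Pow W. ?w J)
      + (1 - x) * (1 + real g) * (\<Sum>J\<in>Pow W. ?w J * (1 / (1 + real (g - card J)))))"
    unfolding sum_distrib_left sum.distrib[symmetric]
    by (intro sum.cong refl) (simp only: algebra_simps)
  also have "\<dots> \<le> (1 / ln A) * ((- ln (1 - x) - 1) * 1 + (1 - x) * (1 + real g) * (1 / ((1 - x) * (1 + real g))))"
    unfolding w1
    using sum_Pow_weights_inverse[OF fW, of x] assms pos
    by (intro mult_left_mono add_left_mono) (auto simp: g_def)
  also have "\<dots> = - ln (1 - x) / ln A"
    using assms by simp
  finally show ?thesis using le b1 by simp
qed

lemma weights_ge_2_mono:
  fixes x :: real
  assumes "0 \<le> x" "x \<le> 1" "D \<le> d" "1 \<le> D"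
  shows "1 - (1 - x) ^ D - real D * x * (1 - x) ^ (D - 1) \<le> 1 - (1 - x) ^ d - real d * x * (1 - x) ^ (d - 1)"
  using assms(3)
proof (induction d rule: dec_induct)
  case base
  show ?case by simp
next
  case (step d)
  obtain e where e: "d = Suc e" using step assms by (cases d) auto
  have "(1 - (1 - x) ^ Suc d - real (Suc d) * x * (1 - x) ^ (Suc d - 1))
      - (1 - (1 - x) ^ d - real d * x * (1 - x) ^ (d - 1)) = real d * x\<^sup>2 * (1 - x) ^ e"
    unfolding e by (simp add: algebra_simps power2_eq_square)
  moreover have "0 \<le> real d * x\<^sup>2 * (1 - x) ^ e" using assms by simp
  ultimately show ?case using step.IH by linarith
qed

section \<open>The generator and the transition semigroup\<close>

definition gen :: "real measure \<Rightarrow> (nat set set \<Rightarrow> real) \<Rightarrow> nat set set \<Rightarrow> real" where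
  "gen \<Lambda> F q = (\<Sum>K | K \<subseteq> q \<and> 2 \<le> card K. lam \<Lambda> (card q) (card K) * (F (merge q K) - F q))"

lemma finite_parts: "finite (parts n)"
proof (rule finite_subset)
  show "parts n \<subseteq> Pow (Pow {..<n})"
    by (auto simp: parts_def dest: partition_onD1)
qed simp

lemma partsD:
  assumes "p \<in> parts n"
  shows "\<Union>p = {..<n}" "finite p" "{} \<notin> p" "b \<in> p \<Longrightarrow> c \<in> p \<Longrightarrow> i \<in> b \<Longrightarrow> i \<in> c \<Longrightarrow> b = c"
    "b \<in> p \<Longrightarrow> finite b"
proof -
  have *: "partition_on {..<n} p" using assms by (simp add: parts_def)
  show U: "\<Union>p = {..<n}" using partition_onD1[OF *] by simp
  show "{} \<notin> p" using partition_onD3[OF *] .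
  have "p \<subseteq> Pow {..<n}" using U by auto
  then show "finite p" by (rule finite_subset) simp
  show "b \<in> p \<Longrightarrow> c \<in> p \<Longrightarrow> i \<in> b \<Longrightarrow> i \<in> c \<Longrightarrow> b = c"
    using partition_onD2[OF *] by (auto simp: disjoint_def)
  show "b \<in> p \<Longrightarrow> finite b"
    using U by (metis Union_upper finite_lessThan finite_subset)
qed

lemma partsI:
  assumes "\<Union>p = {..<n}" "{} \<notin> p" "\<And>b c i. b \<in> p \<Longrightarrow> c \<in> p \<Longrightarrow> i \<in> b \<Longrightarrow> i \<in> c \<Longrightarrow> b = c"
  shows "p \<in> parts n"
  using assms unfolding parts_def partition_on_def disjoint_def by auto

lemma merge_in_parts:
  assumes "p \<in> parts n" "K \<subseteq> p" "2 \<le> card K"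
  shows "merge p K \<in> parts n"
proof -
  note p = partsD[OF assms(1)]
  have K: "K \<noteq> {}" using assms by auto
  show ?thesis
  proof (rule partsI)
    have "\<Union>(merge p K) = \<Union>(K \<union> (p - K))" unfolding merge_def by (simp only: Union_Un_distrib Union_insert)
    also have "K \<union> (p - K) = p" using assms(2) by blast
    finally show "\<Union>(merge p K) = {..<n}" using p(1) by simp
    have "\<Union>K \<noteq> {}" using p(3) K assms(2) by (metis Union_empty_conv ex_in_conv subsetD)
    then show "{} \<notin> merge p K" using p(3) by (auto simp: merge_def)
    show "b = c" if "b \<in> merge p K" "c \<in> merge p K" "i \<in> b" "i \<in> c" for b c i
      using that p(4) assms(2) unfolding merge_def by blast
  qed
qed

lemma sum_Qgen:
  assumes q: "q \<in> parts n"
  shows "(\<Sum>r\<in>parts n. Qgen \<Lambda> n q r * F r) = gen \<Lambda> F q"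
proof -
  let ?KS = "{K. K \<subseteq> q \<and> 2 \<le> card K}"
  let ?l = "\<lambda>K. lam \<Lambda> (card q) (card K)"
  have fin: "finite ?KS" using partsD(2)[OF q] by simp
  have "(\<Sum>r\<in>parts n. Qgen \<Lambda> n q r * F r)
    = (\<Sum>r\<in>parts n. (\<Sum>K\<in>{K\<in>?KS. merge q K = r}. ?l K * F (merge q K))
        - (if q = r then (\<Sum>K\<in>?KS. ?l K) * F r else 0))"
  proof (intro sum.cong refl)
    fix r assume r: "r \<in> parts n"
    have "{K\<in>?KS. merge q K = r} = {K. K \<subseteq> q \<and> 2 \<le> card K \<and> merge q K = r}" by auto
    then show "Qgen \<Lambda> n q r * F r = (\<Sum>K\<in>{K\<in>?KS. merge q K = r}. ?l K * F (merge q K))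
        - (if q = r then (\<Sum>K\<in>?KS. ?l K) * F r else 0)"
      using q r by (simp add: Qgen_def left_diff_distrib sum_distrib_right)
  qed
  also have "\<dots> = (\<Sum>K\<in>?KS. ?l K * F (merge q K)) - (\<Sum>K\<in>?KS. ?l K) * F q"
  proof -
    have "(\<Sum>r\<in>parts n. \<Sum>K\<in>{K\<in>?KS. merge q K = r}. ?l K * F (merge q K)) = (\<Sum>K\<in>?KS. ?l K * F (merge q K))"
      by (rule sum.group[OF fin finite_parts]) (use merge_in_parts[OF q] in auto)
    moreover have "(\<Sum>r\<in>parts n. if q = r then (\<Sum>K\<in>?KS. ?l K) * F r else 0) = (\<Sum>K\<in>?KS. ?l K) * F q"
      using q by (simp add: finite_parts)
    ultimately show ?thesis by (simp only: sum_subtractf)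
  qed
  also have "\<dots> = gen \<Lambda> F q"
    by (simp add: gen_def right_diff_distrib sum_subtractf sum_distrib_right)
  finally show ?thesis .
qed

lemma Qpow_bound: "\<exists>B. \<forall>m p. \<forall>q\<in>parts n. \<bar>Qpow \<Lambda> n m p q\<bar> \<le> B ^ m"
proof -
  define B where "B = (\<Sum>r\<in>parts n. \<Sum>q\<in>parts n. \<bar>Qgen \<Lambda> n r q\<bar>)"
  have col: "(\<Sum>r\<in>parts n. \<bar>Qgen \<Lambda> n r q\<bar>) \<le> B" if "q \<in> parts n" for q
    unfolding B_def by (intro sum_mono member_le_sum that finite_parts) auto
  have B0: "0 \<le> B" unfolding B_def by (intro sum_nonneg) auto
  have "\<forall>q\<in>parts n. \<bar>Qpow \<Lambda> n m p q\<bar> \<le> B ^ m" for m p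
  proof (induction m)
    case 0 show ?case by simp
  next
    case (Suc m)
    show ?case
    proof
      fix q assume q: "q \<in> parts n"
      have "\<bar>Qpow \<Lambda> n (Suc m) p q\<bar> \<le> (\<Sum>r\<in>parts n. \<bar>Qpow \<Lambda> n m p r * Qgen \<Lambda> n r q\<bar>)"
        by simp
      also have "\<dots> \<le> (\<Sum>r\<in>parts n. B ^ m * \<bar>Qgen \<Lambda> n r q\<bar>)"
        using Suc by (intro sum_mono) (auto simp: abs_mult intro!: mult_right_mono)
      also have "\<dots> \<le> B ^ m * B"
        using col[OF q] B0 by (simp add: sum_distrib_left[symmetric] mult_left_mono)
      finally show "\<bar>Qpow \<Lambda> n (Suc m) p q\<bar> \<le> B ^ Suc m" by (simp add: mult.commute)
    qed
  qed
  then show ?thesis by blast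
qed

lemma summable_trans:
  assumes "q \<in> parts n"
  shows "summable (\<lambda>m. Qpow \<Lambda> n m p q / fact m * t ^ m)"
proof -
  obtain B where B: "\<And>m. \<bar>Qpow \<Lambda> n m p q\<bar> \<le> B ^ m" using Qpow_bound assms by metis
  have "summable (\<lambda>m. (B * \<bar>t\<bar>) ^ m /\<^sub>R fact m)" by (rule summable_exp_generic)
  then show ?thesis
  proof (rule summable_comparison_test[rotated], intro exI[of _ 0] allI impI)
    fix m
    have "norm (Qpow \<Lambda> n m p q / fact m * t ^ m) = \<bar>Qpow \<Lambda> n m p q\<bar> * \<bar>t\<bar> ^ m / fact m"
      by (simp add: abs_mult power_abs)
    also have "\<dots> \<le> B ^ m * \<bar>t\<bar> ^ m / fact m"
      by (intro divide_right_mono mult_right_mono B) auto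
    also have "\<dots> = (B * \<bar>t\<bar>) ^ m /\<^sub>R fact m"
      by (simp add: power_mult_distrib divide_inverse mult.commute)
    finally show "norm (Qpow \<Lambda> n m p q / fact m * t ^ m) \<le> (B * \<bar>t\<bar>) ^ m /\<^sub>R fact m" .
  qed
qed

lemma trans_powser: "trans \<Lambda> n t p q = (\<Sum>m. Qpow \<Lambda> n m p q / fact m * t ^ m)"
  unfolding trans_def by (simp add: mult.commute)

lemma trans_0: "trans \<Lambda> n 0 p q = (if p = q then 1 else 0)"
  unfolding trans_powser powser_zero by simp

lemma trans_deriv:
  assumes q: "q \<in> parts n"
  shows "((\<lambda>t. trans \<Lambda> n t p q) has_real_derivative (\<Sum>r\<in>parts n. trans \<Lambda> n t p r * Qgen \<Lambda> n r q)) (at t)"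
proof -
  let ?c = "\<lambda>m. Qpow \<Lambda> n m p q / fact m"
  have "((\<lambda>t. \<Sum>m. ?c m * t ^ m) has_real_derivative (\<Sum>m. diffs ?c m * t ^ m)) (at t)"
    by (rule termdiffs_strong_converges_everywhere) (rule summable_trans[OF q])
  also have "(\<Sum>m. diffs ?c m * t ^ m) = (\<Sum>m. \<Sum>r\<in>parts n. Qpow \<Lambda> n m p r / fact m * t ^ m * Qgen \<Lambda> n r q)"
  proof (rule arg_cong[where f = suminf], rule ext)
    fix m
    have "diffs ?c m = Qpow \<Lambda> n (Suc m) p q / fact m"
      unfolding diffs_def fact_Suc by (simp add: divide_simps del: Qpow.simps)
    then show "diffs ?c m * t ^ m = (\<Sum>r\<in>parts n. Qpow \<Lambda> n m p r / fact m * t ^ m * Qgen \<Lambda> n r q)"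
      by (simp only: Qpow.simps sum_divide_distrib sum_distrib_right) (simp add: mult_ac)
  qed
  also have "\<dots> = (\<Sum>r\<in>parts n. \<Sum>m. Qpow \<Lambda> n m p r / fact m * t ^ m * Qgen \<Lambda> n r q)"
    by (rule suminf_sum) (intro summable_mult2 summable_trans)
  also have "\<dots> = (\<Sum>r\<in>parts n. trans \<Lambda> n t p r * Qgen \<Lambda> n r q)"
    unfolding trans_powser by (intro sum.cong refl suminf_mult2[symmetric] summable_trans)
  finally show ?thesis unfolding trans_powser .
qed

lemma trans_apply_deriv:
  "((\<lambda>t. \<Sum>q\<in>parts n. trans \<Lambda> n t p q * F q) has_real_derivative
     (\<Sum>q\<in>parts n. trans \<Lambda> n t p q * gen \<Lambda> F q)) (at t)"
proof -
  have "((\<lambda>t. \<Sum>q\<in>parts n. trans \<Lambda> n t p q * F q) has_real_derivative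
     (\<Sum>q\<in>parts n. (\<Sum>r\<in>parts n. trans \<Lambda> n t p r * Qgen \<Lambda> n r q) * F q)) (at t)"
    by (intro DERIV_sum DERIV_cmult_right trans_deriv)
  also have "(\<Sum>q\<in>parts n. (\<Sum>r\<in>parts n. trans \<Lambda> n t p r * Qgen \<Lambda> n r q) * F q)
      = (\<Sum>r\<in>parts n. \<Sum>q\<in>parts n. trans \<Lambda> n t p r * Qgen \<Lambda> n r q * F q)"
    unfolding sum_distrib_right by (rule sum.swap)
  also have "\<dots> = (\<Sum>r\<in>parts n. trans \<Lambda> n t p r * (\<Sum>q\<in>parts n. Qgen \<Lambda> n r q * F q))"
    by (simp add: sum_distrib_left mult.assoc)
  also have "\<dots> = (\<Sum>r\<in>parts n. trans \<Lambda> n t p r * gen \<Lambda> F r)"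
    by (intro sum.cong refl) (simp add: sum_Qgen)
  finally show ?thesis .
qed

definition relabel :: "(nat \<Rightarrow> nat) \<Rightarrow> nat set set \<Rightarrow> nat set set" where
  "relabel \<sigma> p = (\<lambda>b. \<sigma> ` b) ` p"

locale involution =
  fixes \<sigma> :: "nat \<Rightarrow> nat" and n :: nat
  assumes invol: "\<And>x. \<sigma> (\<sigma> x) = x" and less_iff: "\<And>x. \<sigma> x < n \<longleftrightarrow> x < n"
begin

lemma inj: "inj \<sigma>"
  by (metis invol injI)

lemma relabel_relabel [simp]: "relabel \<sigma> (relabel \<sigma> p) = p"
  by (simp add: relabel_def image_image invol)

lemma relabel_eq_iff [simp]: "relabel \<sigma> p = relabel \<sigma> q \<longleftrightarrow> p = q"
  by (metis relabel_relabel)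

lemma image_eq_iff [simp]: "\<sigma> ` b = \<sigma> ` c \<longleftrightarrow> b = c"
  by (simp add: inj inj_image_eq_iff)

lemma relabel_parts: 
  assumes "p \<in> parts n" shows "relabel \<sigma> p \<in> parts n"
proof (rule partsI)
  note p = partsD[OF assms]
  have "\<Union>(relabel \<sigma> p) = \<sigma> ` \<Union>p" by (auto simp: relabel_def)
  also have "\<dots> = {..<n}" unfolding p(1)
  proof safe
    fix x assume "x < n" then show "x \<in> \<sigma> ` {..<n}"
      by (metis imageI invol less_iff lessThan_iff)
  qed (simp add: less_iff)
  finally show "\<Union>(relabel \<sigma> p) = {..<n}" .
  show "{} \<notin> relabel \<sigma> p" using p(3) by (auto simp: relabel_def)
  show "b = c" if bc: "b \<in> relabel \<sigma> p" "c \<in> relabel \<sigma> p" "i \<in> b" "i \<in> c" for b c i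
  proof -
    obtain b' c' where *: "b' \<in> p" "b = \<sigma> ` b'" "c' \<in> p" "c = \<sigma> ` c'" using bc by (auto simp: relabel_def)
    then have "\<sigma> i \<in> b'" "\<sigma> i \<in> c'" using bc(3,4) by (metis imageE invol)+
    then show ?thesis using * p(4) by blast
  qed
qed

lemma relabel_parts_iff [simp]: "relabel \<sigma> p \<in> parts n \<longleftrightarrow> p \<in> parts n"
  by (metis relabel_parts relabel_relabel)

lemma relabel_singletons: "relabel \<sigma> (singletons n) = singletons n"
proof -
  have "\<exists>i\<in>{..<n}. x = \<sigma> i" if "x < n" for x using that by (metis invol less_iff lessThan_iff)
  then show ?thesis
    by (auto simp: relabel_def singletons_def less_iff image_image)
qed

lemma card_relabel [simp]: "card (relabel \<sigma> K) = card K"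
  unfolding relabel_def by (rule card_image) (auto simp: inj_on_def)

lemma relabel_subset [simp]: "relabel \<sigma> K \<subseteq> relabel \<sigma> p \<longleftrightarrow> K \<subseteq> p"
  unfolding relabel_def by (rule inj_image_subset_iff) (auto simp: inj_def)

lemma relabel_merge: "merge (relabel \<sigma> p) (relabel \<sigma> K) = relabel \<sigma> (merge p K)"
proof -
  have "relabel \<sigma> p - relabel \<sigma> K = relabel \<sigma> (p - K)"
    unfolding relabel_def by (rule image_set_diff[symmetric]) (auto simp: inj_def)
  moreover have "\<Union>(relabel \<sigma> K) = \<sigma> ` \<Union>K" by (auto simp: relabel_def)
  ultimately show ?thesis by (simp add: merge_def) (simp add: relabel_def)
qed

lemma sum_relabel:
  assumes "\<And>K. P' (relabel \<sigma> K) \<longleftrightarrow> P K"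
  shows "(\<Sum>K | P' K. f K) = (\<Sum>K | P K. f (relabel \<sigma> K))"
proof (rule sum.reindex_bij_witness[where i = "relabel \<sigma>" and j = "relabel \<sigma>"])
  show "relabel \<sigma> a \<in> {K. P K}" if "a \<in> {K. P' K}" for a using that assms[of "relabel \<sigma> a"] by simp
  show "relabel \<sigma> a \<in> {K. P' K}" if "a \<in> {K. P K}" for a using that assms[of a] by simp
qed auto

lemma Qgen_relabel: "Qgen \<Lambda> n (relabel \<sigma> p) (relabel \<sigma> q) = Qgen \<Lambda> n p q"
proof -
  have "(\<Sum>K | K \<subseteq> relabel \<sigma> p \<and> 2 \<le> card K \<and> merge (relabel \<sigma> p) K = relabel \<sigma> q. lam \<Lambda> (card p) (card K))
    = (\<Sum>K | K \<subseteq> p \<and> 2 \<le> card K \<and> merge p K = q. lam \<Lambda> (card p) (card (relabel \<sigma> K)))"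
    by (rule sum_relabel) (simp add: relabel_merge)
  moreover have "(\<Sum>K | K \<subseteq> relabel \<sigma> p \<and> 2 \<le> card K. lam \<Lambda> (card p) (card K))
    = (\<Sum>K | K \<subseteq> p \<and> 2 \<le> card K. lam \<Lambda> (card p) (card (relabel \<sigma> K)))"
    by (rule sum_relabel) simp
  ultimately show ?thesis unfolding Qgen_def by (simp only: relabel_parts_iff relabel_eq_iff card_relabel)
qed

lemma Qpow_relabel: "Qpow \<Lambda> n m (relabel \<sigma> p) (relabel \<sigma> q) = Qpow \<Lambda> n m p q"
proof (induction m arbitrary: q)
  case 0 show ?case by simp
next
  case (Suc m)
  have "(\<Sum>r | r \<in> parts n. Qpow \<Lambda> n m (relabel \<sigma> p) r * Qgen \<Lambda> n r (relabel \<sigma> q))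
    = (\<Sum>r | r \<in> parts n. Qpow \<Lambda> n m (relabel \<sigma> p) (relabel \<sigma> r) * Qgen \<Lambda> n (relabel \<sigma> r) (relabel \<sigma> q))"
    by (rule sum_relabel) simp
  then show ?case by (simp add: Suc Qgen_relabel)
qed

lemma trans_singletons_relabel: "trans \<Lambda> n t (singletons n) (relabel \<sigma> q) = trans \<Lambda> n t (singletons n) q"
  unfolding trans_def using Qpow_relabel[of \<Lambda> _ "singletons n" q] by (simp add: relabel_singletons)

end

section \<open>Dynkin's formula for the restricted coalescent\<close>

lemma (in finite_measure) measure_liminf_le:
  fixes A :: "nat \<Rightarrow> 'a set"
  assumes "\<And>n. A n \<in> sets M" "\<And>n. N0 \<le> n \<Longrightarrow> measure M (A n) \<le> x"
  shows "measure M (\<Union>N. \<Inter>n\<in>{N..}. A n) \<le> x"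
proof -
  let ?B = "\<lambda>N. \<Inter>n\<in>{N..}. A n"
  have m: "?B N \<in> sets M" for N using assms(1) by (intro sets.countable_INT') auto
  have "incseq ?B" unfolding incseq_def by (auto intro: order_trans)
  then have "(\<lambda>N. measure M (?B N)) \<longlonglongrightarrow> measure M (\<Union>N. ?B N)"
    by (intro finite_Lim_measure_incseq) (use m in auto)
  moreover have "measure M (?B N) \<le> x" if "N0 \<le> N" for N
    using finite_measure_mono[of "?B N" "A N"] assms that by (meson INT_lower atLeast_iff le_refl order_trans)
  ultimately show ?thesis by (intro LIMSEQ_le_const2) auto
qed

lemma (in finite_measure) AE_by_small_exceptions:
  assumes "\<And>e. 0 < e \<Longrightarrow> \<exists>E\<in>sets M. measure M E \<le> e \<and> (AE \<omega> in M. \<omega> \<notin> E \<longrightarrow> P \<omega>)"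
  shows "AE \<omega> in M. P \<omega>"
proof -
  have "\<forall>k. \<exists>E\<in>sets M. measure M E \<le> 1 / real (Suc k) \<and> (AE \<omega> in M. \<omega> \<notin> E \<longrightarrow> P \<omega>)"
    using assms by simp
  then obtain E where E: "\<And>k. E k \<in> sets M" "\<And>k. measure M (E k) \<le> 1 / real (Suc k)"
    "\<And>k. AE \<omega> in M. \<omega> \<notin> E k \<longrightarrow> P \<omega>" by metis
  have m: "(\<Inter>k. E k) \<in> sets M" using E(1) by auto
  have "measure M (\<Inter>k. E k) \<le> 1 / real (Suc k)" for k
    using finite_measure_mono[of "\<Inter>k. E k" "E k"] E(1)[of k] E(2)[of k] by (meson INT_lower UNIV_I order_trans)
  moreover have "(\<lambda>k. 1 / real (Suc k)) \<longlonglongrightarrow> 0" by (rule lim_1_over_n[THEN LIMSEQ_Suc])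
  ultimately have "measure M (\<Inter>k. E k) \<le> 0" by (intro LIMSEQ_le_const) auto
  then have "(\<Inter>k. E k) \<in> null_sets M"
    using m by (intro null_setsI) (auto simp: emeasure_eq_measure measure_le_0_iff)
  then have "AE \<omega> in M. \<omega> \<notin> (\<Inter>k. E k)" by (rule AE_not_in)
  moreover have "AE \<omega> in M. \<forall>k. \<omega> \<notin> E k \<longrightarrow> P \<omega>" using E(3) by (subst AE_all_countable) auto
  ultimately show ?thesis by eventually_elim auto
qed

lemma restrI: "b \<in> P \<Longrightarrow> i \<in> b \<Longrightarrow> i < n \<Longrightarrow> b \<inter> {..<n} \<in> restr n P"
  unfolding restr_def by (intro DiffI imageI) auto

lemma restrE:
  assumes "c \<in> restr n P"
  obtains b where "b \<in> P" "c = b \<inter> {..<n}" "c \<noteq> {}"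
  using assms by (auto simp: restr_def)

lemma restr_parts:
  assumes "partition_on UNIV P" shows "restr n P \<in> parts n"
proof (rule partsI)
  have U: "\<Union>P = UNIV" using partition_onD1[OF assms] by simp
  have d: "b = c" if "b \<in> P" "c \<in> P" "i \<in> b" "i \<in> c" for b c i
    using partition_onD2[OF assms] that by (auto simp: disjoint_def)
  show "\<Union>(restr n P) = {..<n}"
  proof safe
    fix i assume i: "i < n"
    obtain b where b: "b \<in> P" "i \<in> b" using U by (metis UNIV_I UnionE)
    have "b \<inter> {..<n} \<in> restr n P" using b i by (rule restrI)
    then show "i \<in> \<Union>(restr n P)" using b i by (intro UnionI[of "b \<inter> {..<n}"]) auto
  qed (auto simp: restr_def)
  show "{} \<notin> restr n P" by (simp add: restr_def)
  show "b = c" if bc: "b \<in> restr n P" "c \<in> restr n P" "i \<in> b" "i \<in> c" for b c i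
  proof -
    obtain b' c' where "b' \<in> P" "c' \<in> P" "b = b' \<inter> {..<n}" "c = c' \<inter> {..<n}"
      using bc(1,2) by (elim restrE) blast
    then show ?thesis using bc(3,4) d[of b' c' i] by simp
  qed
qed

lemma restr_singletons: "restr n (range (\<lambda>i. {i})) = singletons n"
proof -
  have "{i} \<inter> {..<n} = (if i < n then {i} else {})" for i by auto
  then show ?thesis by (auto simp: restr_def singletons_def image_image)
qed

definition sim :: "nat set set \<Rightarrow> nat \<Rightarrow> nat \<Rightarrow> bool" where
  "sim P i j \<longleftrightarrow> (\<exists>b\<in>P. i \<in> b \<and> j \<in> b)"

lemma sim_restr: "i < n \<Longrightarrow> j < n \<Longrightarrow> sim (restr n P) i j \<longleftrightarrow> sim P i j"
proof
  assume "i < n" "j < n" "sim (restr n P) i j"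
  then obtain c where "c \<in> restr n P" "i \<in> c" "j \<in> c" by (auto simp: sim_def)
  then show "sim P i j" by (elim restrE) (auto simp: sim_def)
next
  assume n: "i < n" "j < n" and "sim P i j"
  then obtain b where "b \<in> P" "i \<in> b" "j \<in> b" by (auto simp: sim_def)
  then show "sim (restr n P) i j"
    unfolding sim_def using n restrI[of b P i n] by (intro bexI[of _ "b \<inter> {..<n}"]) auto
qed

lemma sim_merge: "sim q i j \<Longrightarrow> K \<subseteq> q \<Longrightarrow> sim (merge q K) i j"
  by (fastforce simp: sim_def merge_def)

locale coalescent =
  fixes \<Lambda> :: "real measure" and M :: "'w measure" and Coal :: "real \<Rightarrow> 'w \<Rightarrow> nat set set"
  assumes finite_Lambda: "finite_measure \<Lambda>"
    and sets_Lambda: "sets \<Lambda> = sets borel"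
    and supp_Lambda: "emeasure \<Lambda> (- {0..1}) = 0"
    and coal: "lambda_coalescent \<Lambda> M Coal"
begin

sublocale prob_space M
  using coal by (simp add: lambda_coalescent_def)

abbreviation X :: "nat \<Rightarrow> real \<Rightarrow> 'w \<Rightarrow> nat set set" where
  "X n t \<omega> \<equiv> restr n (Coal t \<omega>)"

lemmas path_properties = coal[unfolded lambda_coalescent_def, THEN conjunct2, THEN conjunct1, THEN bspec]

lemma Coal_partition: "\<omega> \<in> space M \<Longrightarrow> 0 \<le> t \<Longrightarrow> partition_on UNIV (Coal t \<omega>)"
  using path_properties[THEN conjunct2, THEN conjunct1] by simp

lemma Coal_right_cont:
  "\<omega> \<in> space M \<Longrightarrow> 0 \<le> t \<Longrightarrow> \<exists>e>0. \<forall>s. t \<le> s \<and> s < t + e \<longrightarrow> X n s \<omega> = X n t \<omega>"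
  using path_properties[THEN conjunct2, THEN conjunct2, THEN conjunct1] by simp

lemma X_parts: "\<omega> \<in> space M \<Longrightarrow> 0 \<le> t \<Longrightarrow> X n t \<omega> \<in> parts n"
  by (simp add: Coal_partition restr_parts)

lemma X_0: "\<omega> \<in> space M \<Longrightarrow> X n 0 \<omega> = singletons n"
  using coal restr_singletons unfolding lambda_coalescent_def by auto

lemma X_event: "0 \<le> t \<Longrightarrow> {\<omega>\<in>space M. X n t \<omega> = q} \<in> events"
  using coal unfolding lambda_coalescent_def by blast

definition jp :: "nat \<Rightarrow> real \<Rightarrow> real \<Rightarrow> nat set set \<Rightarrow> nat set set \<Rightarrow> real" where
  "jp n s t p q = prob {\<omega>\<in>space M. X n s \<omega> = p \<and> X n t \<omega> = q}"

definition mp :: "nat \<Rightarrow> real \<Rightarrow> nat set set \<Rightarrow> real" where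
  "mp n t p = prob {\<omega>\<in>space M. X n t \<omega> = p}"

lemma joint_event: 
  assumes "0 \<le> s" "0 \<le> t"
  shows "{\<omega>\<in>space M. X n s \<omega> = p \<and> X n t \<omega> = q} \<in> events"
proof -
  have "{\<omega>\<in>space M. X n s \<omega> = p \<and> X n t \<omega> = q} = {\<omega>\<in>space M. X n s \<omega> = p} \<inter> {\<omega>\<in>space M. X n t \<omega> = q}"
    by auto
  then show ?thesis using X_event assms by simp
qed

lemma joint_expand:
  fixes f :: "nat set set \<Rightarrow> nat set set \<Rightarrow> real"
  assumes "0 \<le> s" "0 \<le> t" "\<omega> \<in> space M"
  shows "f (X n s \<omega>) (X n t \<omega>) = (\<Sum>p\<in>parts n. \<Sum>q\<in>parts n.
      f p q * indicator {\<omega>\<in>space M. X n s \<omega> = p \<and> X n t \<omega> = q} \<omega>)"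
proof -
  have "(\<Sum>p\<in>parts n. \<Sum>q\<in>parts n. f p q * indicator {\<omega>\<in>space M. X n s \<omega> = p \<and> X n t \<omega> = q} \<omega>)
    = (\<Sum>p\<in>parts n. if X n s \<omega> = p then (\<Sum>q\<in>parts n. if X n t \<omega> = q then f p q else 0) else 0)"
    using assms by (intro sum.cong) (auto simp: indicator_def intro!: sum.cong)
  also have "\<dots> = f (X n s \<omega>) (X n t \<omega>)"
    using X_parts assms by (simp add: finite_parts)
  finally show ?thesis by simp
qed

lemma joint_measurable:
  fixes f :: "nat set set \<Rightarrow> nat set set \<Rightarrow> real"
  assumes "0 \<le> s" "0 \<le> t"
  shows "(\<lambda>\<omega>. f (X n s \<omega>) (X n t \<omega>)) \<in> borel_measurable M"
proof -
  have "(\<lambda>\<omega>. \<Sum>p\<in>parts n. \<Sum>q\<in>parts n.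
      f p q * indicator {\<omega>\<in>space M. X n s \<omega> = p \<and> X n t \<omega> = q} \<omega>) \<in> borel_measurable M"
    using joint_event[OF assms] by (intro borel_measurable_sum borel_measurable_times borel_measurable_indicator) auto
  then show ?thesis by (subst measurable_cong[OF joint_expand[OF assms]])
qed

lemma joint_integrable:
  fixes f :: "nat set set \<Rightarrow> nat set set \<Rightarrow> real"
  assumes "0 \<le> s" "0 \<le> t"
  shows "integrable M (\<lambda>\<omega>. f (X n s \<omega>) (X n t \<omega>))"
proof -
  have "integrable M (\<lambda>\<omega>. \<Sum>p\<in>parts n. \<Sum>q\<in>parts n.
      f p q * indicator {\<omega>\<in>space M. X n s \<omega> = p \<and> X n t \<omega> = q} \<omega>)"
    using joint_event[OF assms]
    by (intro Bochner_Integration.integrable_sum integrable_mult_right integrable_real_indicator) (auto simp: emeasure_eq_measure)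
  then show ?thesis by (subst Bochner_Integration.integrable_cong[OF refl joint_expand[OF assms]])
qed

lemma joint_expectation:
  fixes f :: "nat set set \<Rightarrow> nat set set \<Rightarrow> real"
  assumes "0 \<le> s" "0 \<le> t"
  shows "expectation (\<lambda>\<omega>. f (X n s \<omega>) (X n t \<omega>)) = (\<Sum>p\<in>parts n. \<Sum>q\<in>parts n. jp n s t p q * f p q)"
proof -
  have *: "integrable M (\<lambda>\<omega>. f p q * indicator {\<omega>\<in>space M. X n s \<omega> = p \<and> X n t \<omega> = q} \<omega>)" for p q
    using joint_event[OF assms]
    by (intro integrable_mult_right integrable_real_indicator) (auto simp: emeasure_eq_measure)
  have "expectation (\<lambda>\<omega>. f (X n s \<omega>) (X n t \<omega>)) = expectation (\<lambda>\<omega>. \<Sum>p\<in>parts n. \<Sum>q\<in>parts n.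
      f p q * indicator {\<omega>\<in>space M. X n s \<omega> = p \<and> X n t \<omega> = q} \<omega>)"
    by (rule Bochner_Integration.integral_cong[OF refl joint_expand[OF assms]])
  also have "\<dots> = (\<Sum>p\<in>parts n. \<Sum>q\<in>parts n. jp n s t p q * f p q)"
    using joint_event[OF assms] *
    by (subst Bochner_Integration.integral_sum, (rule Bochner_Integration.integrable_sum)?, simp)+
      (simp add: jp_def mult.commute)
  finally show ?thesis .
qed

lemma joint_pred_event:
  assumes "0 \<le> s" "0 \<le> t"
  shows "{\<omega>\<in>space M. \<phi> (X n s \<omega>) (X n t \<omega>)} \<in> events"
proof -
  have "{\<omega>\<in>space M. (if \<phi> (X n s \<omega>) (X n t \<omega>) then 1 else 0 :: real) = 1} \<in> events"
    using joint_measurable[OF assms, where f = "\<lambda>p q. if \<phi> p q then 1 else 0"]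
    by (intro borel_measurable_eq) auto
  moreover have "{\<omega>\<in>space M. (if \<phi> (X n s \<omega>) (X n t \<omega>) then 1 else 0 :: real) = 1}
      = {\<omega>\<in>space M. \<phi> (X n s \<omega>) (X n t \<omega>)}" by auto
  ultimately show ?thesis by simp
qed

lemma prob_eq_expectation:
  assumes "0 \<le> s" "0 \<le> t"
  shows "prob {\<omega>\<in>space M. \<phi> (X n s \<omega>) (X n t \<omega>)}
      = expectation (\<lambda>\<omega>. if \<phi> (X n s \<omega>) (X n t \<omega>) then 1 else 0)"
proof -
  have "expectation (\<lambda>\<omega>. if \<phi> (X n s \<omega>) (X n t \<omega>) then 1 else 0)
    = expectation (indicator {\<omega>\<in>space M. \<phi> (X n s \<omega>) (X n t \<omega>)})"
    by (intro Bochner_Integration.integral_cong) (auto simp: indicator_def)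
  also have "\<dots> = prob {\<omega>\<in>space M. \<phi> (X n s \<omega>) (X n t \<omega>)}"
    by (subst Bochner_Integration.integral_indicator) (auto intro!: arg_cong[where f = prob])
  finally show ?thesis by (rule sym)
qed

lemma mp_eq:
  assumes "0 \<le> t"
  shows "mp n t q = trans \<Lambda> n t (singletons n) q"
proof (cases "t = 0")
  case True
  have "{\<omega>\<in>space M. X n 0 \<omega> = q} = (if singletons n = q then space M else {})"
    using X_0 by auto
  then show ?thesis using True by (simp add: mp_def trans_0 prob_space)
next
  case False
  have "sorted_wrt (<) (0 # map fst [(t, q)])" using assms False by simp
  then have "measure M {\<omega>\<in>space M. \<forall>(t, q)\<in>set [(t, q)]. restr n (Coal t \<omega>) = q}
          = path_prob (trans \<Lambda> n) 0 (singletons n) [(t, q)]"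
    using coal unfolding lambda_coalescent_def by blast
  then show ?thesis by (simp add: mp_def)
qed

lemma jp_eq:
  assumes "0 \<le> s" "s < t"
  shows "jp n s t p q = mp n s p * trans \<Lambda> n (t - s) p q"
proof (cases "s = 0")
  case True
  have "{\<omega>\<in>space M. X n 0 \<omega> = p \<and> X n t \<omega> = q} = (if singletons n = p then {\<omega>\<in>space M. X n t \<omega> = q} else {})"
    using X_0 by auto
  then have "jp n 0 t p q = (if singletons n = p then mp n t q else 0)"
    by (simp add: jp_def mp_def)
  then show ?thesis using assms True by (auto simp: mp_eq trans_0)
next
  case False
  have "sorted_wrt (<) (0 # map fst [(s, p), (t, q)])" using assms False by simp
  then have "measure M {\<omega>\<in>space M. \<forall>(t, q)\<in>set [(s, p), (t, q)]. restr n (Coal t \<omega>) = q}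
          = path_prob (trans \<Lambda> n) 0 (singletons n) [(s, p), (t, q)]"
    using coal unfolding lambda_coalescent_def by blast
  then show ?thesis using assms by (simp add: jp_def mp_eq)
qed

lemma mp_nonneg: "0 \<le> mp n t p" and jp_nonneg: "0 \<le> jp n s t p q"
  by (simp_all add: mp_def jp_def)

lemma sum_jp: 
  assumes "0 \<le> s" "0 \<le> t"
  shows "(\<Sum>q\<in>parts n. jp n s t p q) = mp n s p"
proof -
  have "mp n s p = prob (\<Union>q\<in>parts n. {\<omega>\<in>space M. X n s \<omega> = p \<and> X n t \<omega> = q})"
    unfolding mp_def by (rule arg_cong[where f = prob]) (use X_parts assms in auto)
  also have "\<dots> = (\<Sum>q\<in>parts n. jp n s t p q)"
    unfolding jp_def using joint_event[OF assms]
    by (intro finite_measure_finite_Union finite_parts) (auto simp: disjoint_family_on_def)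
  finally show ?thesis by simp
qed

lemma sum_mp: 
  assumes "0 \<le> t"
  shows "(\<Sum>p\<in>parts n. mp n t p) = 1"
proof -
  have "1 = prob (\<Union>q\<in>parts n. {\<omega>\<in>space M. X n t \<omega> = q})"
    unfolding prob_space[symmetric] by (rule arg_cong[where f = prob]) (use X_parts assms in auto)
  also have "\<dots> = (\<Sum>q\<in>parts n. mp n t q)"
    unfolding mp_def using X_event[OF assms]
    by (intro finite_measure_finite_Union finite_parts) (auto simp: disjoint_family_on_def)
  finally show ?thesis by simp
qed

lemma single_expectation:
  fixes F :: "nat set set \<Rightarrow> real"
  assumes "0 \<le> t"
  shows "expectation (\<lambda>\<omega>. F (X n t \<omega>)) = (\<Sum>q\<in>parts n. mp n t q * F q)"
proof -
  have "expectation (\<lambda>\<omega>. F (X n t \<omega>)) = (\<Sum>p\<in>parts n. \<Sum>q\<in>parts n. jp n t t p q * F p)"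
    by (rule joint_expectation[OF assms assms, where f = "\<lambda>p q. F p"])
  then show ?thesis by (simp add: sum_distrib_right[symmetric] sum_jp assms)
qed

lemma dynkin:
  assumes "0 \<le> s" "s < t" "p \<in> parts n" and gen: "\<And>q. q \<in> parts n \<Longrightarrow> gen \<Lambda> F q \<le> c"
  shows "(\<Sum>q\<in>parts n. jp n s t p q * F q) \<le> mp n s p * (F p + c * (t - s))"
proof (cases "mp n s p = 0")
  case True
  then show ?thesis using assms by (simp add: jp_eq)
next
  case False
  then have mp: "0 < mp n s p" using mp_nonneg[of n s p] by linarith
  let ?T = "\<lambda>u q. trans \<Lambda> n u p q"
  \<comment> \<open>The exponential series need not be shown to be nonnegative: it is a conditional probability.\<close>
  have nonneg: "0 \<le> ?T u q" if "0 < u" for u q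
    using jp_nonneg[of n s "s + u" p q] jp_eq[of s "s + u" n p q] assms that mp
    by (simp add: zero_le_mult_iff)
  have sum1: "(\<Sum>q\<in>parts n. ?T u q) = 1" if "0 < u" for u
    using sum_jp[of s "s + u" n p] assms that mp
    by (simp add: jp_eq sum_distrib_left[symmetric])
  let ?f = "\<lambda>u. \<Sum>q\<in>parts n. ?T u q * F q"
  obtain z where z: "0 < z" "z < t - s" "?f (t - s) - ?f 0 = (t - s - 0) * (\<Sum>q\<in>parts n. ?T z q * gen \<Lambda> F q)"
    using MVT2[of 0 "t - s" ?f "\<lambda>u. \<Sum>q\<in>parts n. ?T u q * gen \<Lambda> F q"] trans_apply_deriv assms by auto
  have "(\<Sum>q\<in>parts n. ?T z q * gen \<Lambda> F q) \<le> (\<Sum>q\<in>parts n. ?T z q * c)"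
    by (intro sum_mono mult_left_mono gen nonneg z)
  also have "\<dots> = c" using sum1[OF z(1)] by (simp add: sum_distrib_right[symmetric])
  finally have "(t - s) * (\<Sum>q\<in>parts n. ?T z q * gen \<Lambda> F q) \<le> (t - s) * c"
    using assms by (intro mult_left_mono) auto
  moreover have "?f 0 = F p" using assms by (simp add: trans_0 finite_parts if_distrib[of "\<lambda>x. x * _"] cong: if_cong)
  ultimately have "?f (t - s) \<le> F p + (t - s) * c" using z(3) by simp
  then have "?f (t - s) \<le> F p + c * (t - s)" by (simp only: mult.commute)
  then have "mp n s p * ?f (t - s) \<le> mp n s p * (F p + c * (t - s))"
    using mp by (intro mult_left_mono) auto
  then show ?thesis using assms by (simp add: jp_eq sum_distrib_left mult.assoc)
qed

lemma dynkin_expectation: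
  assumes st: "0 \<le> s" "s < t"
    and gen: "\<And>p q. p \<in> parts n \<Longrightarrow> q \<in> parts n \<Longrightarrow> \<phi> p \<Longrightarrow> gen \<Lambda> (F p) q \<le> c"
    and d: "\<And>p. p \<in> parts n \<Longrightarrow> \<phi> p \<Longrightarrow> F p p \<le> d" and dc: "0 \<le> d + c * (t - s)"
  shows "expectation (\<lambda>\<omega>. if \<phi> (X n s \<omega>) then F (X n s \<omega>) (X n t \<omega>) else 0) \<le> d + c * (t - s)"
proof -
  have "expectation (\<lambda>\<omega>. if \<phi> (X n s \<omega>) then F (X n s \<omega>) (X n t \<omega>) else 0)
    = (\<Sum>p\<in>parts n. \<Sum>q\<in>parts n. jp n s t p q * (if \<phi> p then F p q else 0))"
    by (rule joint_expectation[where f = "\<lambda>p q. if \<phi> p then F p q else 0"]) (use st in auto)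
  also have "\<dots> \<le> (\<Sum>p\<in>parts n. mp n s p * (d + c * (t - s)))"
  proof (rule sum_mono)
    fix p assume p: "p \<in> parts n"
    show "(\<Sum>q\<in>parts n. jp n s t p q * (if \<phi> p then F p q else 0)) \<le> mp n s p * (d + c * (t - s))"
    proof (cases "\<phi> p")
      case True
      have "(\<Sum>q\<in>parts n. jp n s t p q * F p q) \<le> mp n s p * (F p p + c * (t - s))"
        by (rule dynkin[OF st p]) (rule gen[OF p _ True])
      also have "\<dots> \<le> mp n s p * (d + c * (t - s))"
        using d[OF p True] by (intro mult_left_mono mp_nonneg) simp
      finally show ?thesis using True by simp
    qed (use dc mp_nonneg in simp)
  qed
  also have "\<dots> = d + c * (t - s)" using st by (simp add: sum_distrib_right[symmetric] sum_mp)
  finally show ?thesis .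
qed

lemma dynkin_prob:
  assumes st: "0 \<le> s" "s < t"
    and gen: "\<And>p q. p \<in> parts n \<Longrightarrow> q \<in> parts n \<Longrightarrow> \<phi> p \<Longrightarrow> gen \<Lambda> (F p) q \<le> c"
    and d: "\<And>p. p \<in> parts n \<Longrightarrow> \<phi> p \<Longrightarrow> F p p \<le> d" and dc: "0 \<le> d + c * (t - s)"
    and F0: "\<And>p q. 0 \<le> F p q" and a: "0 < a"
  shows "prob {\<omega>\<in>space M. \<phi> (X n s \<omega>) \<and> a \<le> F (X n s \<omega>) (X n t \<omega>)} \<le> (d + c * (t - s)) / a"
proof -
  have t: "0 \<le> t" using st by simp
  have "a * prob {\<omega>\<in>space M. \<phi> (X n s \<omega>) \<and> a \<le> F (X n s \<omega>) (X n t \<omega>)}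
    = a * expectation (\<lambda>\<omega>. if \<phi> (X n s \<omega>) \<and> a \<le> F (X n s \<omega>) (X n t \<omega>) then 1 else 0)"
    by (subst prob_eq_expectation[OF st(1) t, where \<phi> = "\<lambda>p q. \<phi> p \<and> a \<le> F p q"]) simp
  also have "\<dots> = expectation (\<lambda>\<omega>. a * (if \<phi> (X n s \<omega>) \<and> a \<le> F (X n s \<omega>) (X n t \<omega>) then 1 else 0))"
    by simp
  also have "\<dots> \<le> expectation (\<lambda>\<omega>. if \<phi> (X n s \<omega>) then F (X n s \<omega>) (X n t \<omega>) else 0)"
    using F0
    by (intro integral_mono joint_integrable[OF st(1) t, where f = "\<lambda>p q. if \<phi> p then F p q else 0"]
        joint_integrable[OF st(1) t, where f = "\<lambda>p q. a * (if \<phi> p \<and> a \<le> F p q then 1 else 0)"]) auto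
  also have "\<dots> \<le> d + c * (t - s)" by (rule dynkin_expectation[OF st gen d dc])
  finally show ?thesis using a by (simp add: field_simps)
qed

lemma expectation_growth:
  assumes "0 < t" and le: "\<And>u. 0 < u \<Longrightarrow> u < t \<Longrightarrow> expectation (\<lambda>\<omega>. gen \<Lambda> F (X n u \<omega>)) \<le> c"
  shows "expectation (\<lambda>\<omega>. F (X n t \<omega>)) \<le> F (singletons n) + c * t"
proof -
  let ?f = "\<lambda>u. \<Sum>q\<in>parts n. trans \<Lambda> n u (singletons n) q * F q"
  let ?g = "\<lambda>u. \<Sum>q\<in>parts n. trans \<Lambda> n u (singletons n) q * gen \<Lambda> F q"
  obtain z where z: "0 < z" "z < t" "?f t - ?f 0 = (t - 0) * ?g z"
    using MVT2[of 0 t ?f ?g] trans_apply_deriv assms by auto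
  have "?g z \<le> c" using le[OF z(1,2)] z(1) by (simp add: single_expectation mp_eq)
  then have "t * ?g z \<le> t * c" using assms by (intro mult_left_mono) auto
  moreover have "singletons n \<in> parts n"
    by (rule partsI) (auto simp: singletons_def)
  then have "?f 0 = F (singletons n)"
    by (simp add: trans_0 finite_parts if_distrib[of "\<lambda>x. x * _"] cong: if_cong)
  ultimately have "?f t \<le> F (singletons n) + t * c" using z(3) by simp
  then show ?thesis using assms(1) by (simp add: single_expectation mp_eq mult.commute[of t c])
qed

lemma AE_Lambda: "AE x in \<Lambda>. 0 \<le> x \<and> x \<le> 1"
proof -
  have "- {0..1::real} \<in> null_sets \<Lambda>" using supp_Lambda sets_Lambda by (auto simp: null_sets_def)
  then show ?thesis by (rule AE_I') auto
qed

lemma lam_nonneg: "0 \<le> lam \<Lambda> i k"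
  unfolding lam_def by (rule integral_nonneg_AE) (use AE_Lambda in eventually_elim, auto)

lemma AE_sim_mono:
  assumes "0 \<le> s" "s < t"
  shows "AE \<omega> in M. sim (Coal s \<omega>) i j \<longrightarrow> sim (Coal t \<omega>) i j"
proof -
  define n where "n = Suc (max i j)"
  have n: "i < n" "j < n" by (auto simp: n_def)
  let ?F = "\<lambda>p q. if sim q i j then 0 else 1 :: real"
  let ?E = "{\<omega>\<in>space M. sim (X n s \<omega>) i j \<and> 1 \<le> ?F (X n s \<omega>) (X n t \<omega>)}"
  have "prob ?E \<le> (0 + 0 * (t - s)) / 1"
  proof (rule dynkin_prob[OF assms, where \<phi> = "\<lambda>p. sim p i j"])
    fix p q assume "p \<in> parts n" "q \<in> parts n"
    show "gen \<Lambda> (?F p) q \<le> 0"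
      unfolding gen_def using sim_merge[of q i j] lam_nonneg
      by (intro sum_nonpos mult_nonneg_nonpos) auto
  qed auto
  then have "prob ?E = 0" by (simp add: measure_le_0_iff)
  moreover have "?E \<in> events"
    by (rule joint_pred_event[where \<phi> = "\<lambda>p q. sim p i j \<and> 1 \<le> ?F p q"]) (use assms in auto)
  ultimately have "?E \<in> null_sets M" by (auto simp: null_sets_def emeasure_eq_measure)
  then have "AE \<omega> in M. \<omega> \<notin> ?E" by (rule AE_not_in)
  then show ?thesis
    using AE_space
  proof eventually_elim
    case (elim \<omega>)
    then show ?case using sim_restr[OF n] by (auto split: if_splits)
  qed
qed

lemma AE_sim_mono_all:
  "AE \<omega> in M. \<forall>s t i j. 0 \<le> s \<longrightarrow> s \<le> t \<longrightarrow> sim (Coal s \<omega>) i j \<longrightarrow> sim (Coal t \<omega>) i j"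
proof -
  have "AE \<omega> in M. \<forall>z\<in>{z. 0 \<le> fst z \<and> fst z < snd z}. \<forall>i j.
      sim (Coal (real_of_rat (fst z)) \<omega>) i j \<longrightarrow> sim (Coal (real_of_rat (snd z)) \<omega>) i j"
    by (subst AE_ball_countable) (auto simp: AE_all_countable of_rat_less intro!: AE_sim_mono)
  then show ?thesis using AE_space
  proof eventually_elim
    case (elim \<omega>)
    show ?case
    proof (intro allI impI)
      fix s t :: real and i j assume st: "0 \<le> s" "s \<le> t" and sim: "sim (Coal s \<omega>) i j"
      define n where "n = Suc (max i j)"
      have n: "i < n" "j < n" by (auto simp: n_def)
      obtain e where e: "e > 0" "\<And>s'. s \<le> s' \<and> s' < s + e \<Longrightarrow> X n s' \<omega> = X n s \<omega>"
        using Coal_right_cont elim(2) st by metis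
      obtain d where d: "d > 0" "\<And>s'. t \<le> s' \<and> s' < t + d \<Longrightarrow> X n s' \<omega> = X n t \<omega>"
        using Coal_right_cont[of \<omega> t n] elim(2) st by auto
      show "sim (Coal t \<omega>) i j"
      proof (cases "s = t")
        case False
        then have "s < min t (s + e)" using st e by auto
        then obtain a where a: "s < real_of_rat a" "real_of_rat a < min t (s + e)" using of_rat_dense by blast
        obtain b where b: "t < real_of_rat b" "real_of_rat b < t + d" using of_rat_dense[of t "t + d"] d by auto
        have "sim (Coal (real_of_rat a) \<omega>) i j" 
          using sim e(2)[of "real_of_rat a"] a n by (metis less_eq_real_def min_less_iff_conj sim_restr)
        moreover have "0 < real_of_rat a" "real_of_rat a < real_of_rat b" using a b st by linarith+
        then have "0 \<le> a" "a < b" by (simp_all add: of_rat_less)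
        ultimately have "sim (Coal (real_of_rat b) \<omega>) i j" using elim(1) by fastforce
        then show ?thesis using d(2)[of "real_of_rat b"] b n by (metis less_eq_real_def sim_restr)
      qed (use sim in simp)
    qed
  qed
qed

end

section \<open>Finitely many atomic blocks\<close>

definition nonsingle :: "nat set set \<Rightarrow> nat set set" where
  "nonsingle p = {b\<in>p. 2 \<le> card b}"

lemma card_nonsingle_merge_le:
  assumes "finite q"
  shows "card (nonsingle (merge q K)) \<le> Suc (card (nonsingle q))"
proof -
  have "nonsingle (merge q K) \<subseteq> insert (\<Union>K) (nonsingle q)" by (auto simp: nonsingle_def merge_def)
  moreover have "finite (nonsingle q)" using assms by (simp add: nonsingle_def)
  ultimately have "card (nonsingle (merge q K)) \<le> card (insert (\<Union>K) (nonsingle q))"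
    by (intro card_mono) auto
  then show ?thesis using card_insert_le_m1 \<open>finite (nonsingle q)\<close> by (metis card_insert_if le_SucI order_trans order_refl)
qed

lemma card_le_nonsingle_restr:
  assumes "partition_on UNIV P" "B \<subseteq> P" and two: "\<And>b. b \<in> B \<Longrightarrow> 2 \<le> card (b \<inter> {..<n})"
  shows "card B \<le> card (nonsingle (restr n P))"
proof (rule card_inj_on_le[where f = "\<lambda>b. b \<inter> {..<n}"])
  have ne: "\<exists>i. i \<in> b \<inter> {..<n}" if "b \<in> B" for b using two[OF that] by (metis card.empty ex_in_conv not_numeral_le_zero)
  show "inj_on (\<lambda>b. b \<inter> {..<n}) B"
  proof (rule inj_onI)
    fix b c assume bc: "b \<in> B" "c \<in> B" "b \<inter> {..<n} = c \<inter> {..<n}"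
    obtain i where "i \<in> b \<inter> {..<n}" using ne bc by blast
    then have "i \<in> b" "i \<in> c" using bc by auto
    then show "b = c"
      using partition_onD2[OF assms(1)] bc assms(2) unfolding disjoint_def by blast
  qed
  show "(\<lambda>b. b \<inter> {..<n}) ` B \<subseteq> nonsingle (restr n P)"
  proof safe
    fix b assume b: "b \<in> B"
    then obtain i where "i \<in> b" "i < n" using ne by fastforce
    then show "b \<inter> {..<n} \<in> nonsingle (restr n P)"
      using restrI[of b P i n] two[OF b] assms(2) b by (auto simp: nonsingle_def)
  qed
  show "finite (nonsingle (restr n P))"
    using partsD(2)[OF restr_parts[OF assms(1)]] by (simp add: nonsingle_def)
qed

lemma infinite_imp_card_ge:
  fixes b :: "nat set"
  assumes "infinite b"
  shows "\<exists>N. \<forall>n\<ge>N. m \<le> card (b \<inter> {..<n})"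
proof -
  obtain B where B: "B \<subseteq> b" "finite B" "card B = m" using assms infinite_arbitrarily_large by blast
  obtain N where N: "B \<subseteq> {..<N}" using B(2) finite_nat_iff_bounded by blast
  have "m \<le> card (b \<inter> {..<n})" if "N \<le> n" for n
    unfolding B(3)[symmetric] using B N that by (intro card_mono) auto
  then show ?thesis by blast
qed

lemma atomic_infinite:
  assumes "atomic b" shows "infinite b"
proof
  assume fin: "finite b"
  obtain f where f: "f > 0" "(\<lambda>k. real (card (b \<inter> {..<k})) / real k) \<longlonglongrightarrow> f"
    using assms by (auto simp: atomic_def)
  have "(\<lambda>k. real (card (b \<inter> {..<k})) / real k) \<longlonglongrightarrow> 0"
  proof (rule tendsto_sandwich[where f = "\<lambda>_. 0" and h = "\<lambda>k. real (card b) / real k"])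
    show "(\<lambda>k. real (card b) / real k) \<longlonglongrightarrow> 0" by (rule lim_const_over_n)
    show "\<forall>\<^sub>F k in sequentially. real (card (b \<inter> {..<k})) / real k \<le> real (card b) / real k"
      using fin by (intro always_eventually allI divide_right_mono) (auto intro!: card_mono)
  qed auto
  then have "f = 0" using f LIMSEQ_unique by blast
  then show False using f by simp
qed

lemma finite_imp_card_ge:
  assumes "finite B" "\<And>b. b \<in> B \<Longrightarrow> infinite (b :: nat set)"
  shows "\<exists>N. \<forall>n\<ge>N. \<forall>b\<in>B. m \<le> card (b \<inter> {..<n})"
proof -
  have "\<forall>b\<in>B. \<exists>N. \<forall>n\<ge>N. m \<le> card (b \<inter> {..<n})" using infinite_imp_card_ge assms(2) by blast
  then have "\<forall>b\<in>B. eventually (\<lambda>n. m \<le> card (b \<inter> {..<n})) sequentially"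
    by (simp add: eventually_sequentially)
  then have "eventually (\<lambda>n. \<forall>b\<in>B. m \<le> card (b \<inter> {..<n})) sequentially"
    using assms(1) by (simp add: eventually_ball_finite)
  then show ?thesis by (simp add: eventually_sequentially)
qed

locale dust_coalescent = coalescent +
  assumes no_atom_1: "emeasure \<Lambda> {1} = 0" and mu1: "mu_neg \<Lambda> 1 < \<infinity>"
begin

lemma borel_Lambda: "f \<in> borel_measurable borel \<Longrightarrow> f \<in> borel_measurable \<Lambda>"
  using measurable_cong_sets[OF sets_Lambda refl] by blast

lemma AE_Lambda_01: "AE x in \<Lambda>. 0 < x \<and> x < 1"
proof -
  have "{1} \<in> null_sets \<Lambda>" using no_atom_1 sets_Lambda by (auto simp: null_sets_def)
  then have 1: "AE x in \<Lambda>. x \<noteq> 1" by (rule AE_I') auto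
  have "AE x in \<Lambda>. (if x = 0 then \<infinity> else ennreal (1 / x ^ 1)) \<noteq> \<infinity>"
    using mu1 unfolding mu_neg_def by (intro nn_integral_PInf_AE borel_Lambda) auto
  with 1 AE_Lambda show ?thesis
    by eventually_elim (auto split: if_splits)
qed

lemma nn_integral_mu_neg: "(\<integral>\<^sup>+ x. ennreal (1 / x ^ m) \<partial>\<Lambda>) = mu_neg \<Lambda> m"
  unfolding mu_neg_def 
proof (rule nn_integral_cong_AE)
  show "AE x in \<Lambda>. ennreal (1 / x ^ m) = (if x = 0 then \<infinity> else ennreal (1 / x ^ m))"
    using AE_Lambda_01 by eventually_elim auto
qed

lemma integrable_inverse_power:
  assumes "mu_neg \<Lambda> m < \<infinity>"
  shows "integrable \<Lambda> (\<lambda>x. 1 / x ^ m)"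
proof (rule integrableI_nonneg)
  show "(\<lambda>x. 1 / x ^ m) \<in> borel_measurable \<Lambda>" by (rule borel_Lambda) auto
  show "AE x in \<Lambda>. 0 \<le> 1 / x ^ m" using AE_Lambda_01 by eventually_elim auto
qed (use assms nn_integral_mu_neg in simp)

lemma integrable_lam: "integrable \<Lambda> (\<lambda>x. x ^ (k - 2) * (1 - x) ^ (i - k))"
proof (rule finite_measure.integrable_const_bound[OF finite_Lambda, where B = 1])
  show "AE x in \<Lambda>. norm (x ^ (k - 2) * (1 - x) ^ (i - k)) \<le> 1"
    using AE_Lambda by eventually_elim (auto simp: abs_mult power_abs intro!: mult_le_one power_le_one)
qed (auto intro!: borel_Lambda)

lemma sum_lam_le:
  assumes w: "integrable \<Lambda> w" and "finite p"
    and le: "\<And>x. 0 < x \<Longrightarrow> x < 1 \<Longrightarrow>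
      (\<Sum>K | K \<subseteq> p \<and> 2 \<le> card K. x ^ card K * (1 - x) ^ (card p - card K) * g K) \<le> x\<^sup>2 * w x"
  shows "(\<Sum>K | K \<subseteq> p \<and> 2 \<le> card K. lam \<Lambda> (card p) (card K) * g K) \<le> integral\<^sup>L \<Lambda> w"
proof -
  let ?KS = "{K. K \<subseteq> p \<and> 2 \<le> card K}"
  let ?h = "\<lambda>x. \<Sum>K\<in>?KS. x ^ (card K - 2) * (1 - x) ^ (card p - card K) * g K"
  have "(\<Sum>K\<in>?KS. lam \<Lambda> (card p) (card K) * g K) = integral\<^sup>L \<Lambda> ?h"
    unfolding lam_def by (simp add: Bochner_Integration.integral_sum integrable_lam)
  also have "\<dots> \<le> integral\<^sup>L \<Lambda> w"
  proof (rule integral_mono_AE[OF _ w])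
    show "integrable \<Lambda> ?h" by (intro Bochner_Integration.integrable_sum integrable_mult_left integrable_lam)
    show "AE x in \<Lambda>. ?h x \<le> w x"
      using AE_Lambda_01
    proof eventually_elim
      case (elim x)
      have "x\<^sup>2 * ?h x = (\<Sum>K\<in>?KS. x ^ card K * (1 - x) ^ (card p - card K) * g K)"
        unfolding sum_distrib_left
      proof (rule sum.cong)
        fix K assume "K \<in> ?KS"
        then have "x\<^sup>2 * x ^ (card K - 2) = x ^ card K" by (metis le_add_diff_inverse power_add mem_Collect_eq)
        then show "x\<^sup>2 * (x ^ (card K - 2) * (1 - x) ^ (card p - card K) * g K)
            = x ^ card K * (1 - x) ^ (card p - card K) * g K" by (simp flip: mult.assoc)
      qed simp
      then have "x\<^sup>2 * ?h x \<le> x\<^sup>2 * w x" using le elim by simp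
      then show ?case using elim by simp
    qed
  qed
  finally show ?thesis .
qed

lemma sum_lam_total_le:
  assumes "mu_neg \<Lambda> 2 < \<infinity>" "finite p"
  shows "(\<Sum>K | K \<subseteq> p \<and> 2 \<le> card K. lam \<Lambda> (card p) (card K)) \<le> (\<integral>x. 1 / x ^ 2 \<partial>\<Lambda>)"
proof -
  have "(\<Sum>K | K \<subseteq> p \<and> 2 \<le> card K. lam \<Lambda> (card p) (card K) * 1) \<le> (\<integral>x. 1 / x ^ 2 \<partial>\<Lambda>)"
  proof (rule sum_lam_le[OF integrable_inverse_power[OF assms(1)] assms(2)])
    fix x :: real assume x: "0 < x" "x < 1"
    have "(\<Sum>K | K \<subseteq> p \<and> 2 \<le> card K. x ^ card K * (1 - x) ^ (card p - card K) * 1)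
      \<le> (\<Sum>K\<in>Pow p. x ^ card K * (1 - x) ^ (card p - card K) * 1)"
      using assms x by (intro sum_mono2) auto
    also have "\<dots> = 1" using sum_Pow_weights[OF assms(2)] by simp
    finally show "(\<Sum>K | K \<subseteq> p \<and> 2 \<le> card K. x ^ card K * (1 - x) ^ (card p - card K) * 1) \<le> x\<^sup>2 * (1 / x ^ 2)"
      using x by simp
  qed
  then show ?thesis by simp
qed

lemma prob_grid_nonsingle_le:
  assumes "mu_neg \<Lambda> 2 < \<infinity>" "0 < m"
  shows "prob {\<omega>\<in>space M. \<exists>j\<le>T * Suc r. m \<le> card (nonsingle (X n (real j / real (Suc r)) \<omega>))}
    \<le> (\<integral>x. 1 / x ^ 2 \<partial>\<Lambda>) * real T / real m"
proof -
  define c where "c = (\<integral>x. 1 / x ^ 2 \<partial>\<Lambda>)"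
  have c0: "0 \<le> c" unfolding c_def by simp
  define t where "t j = real j / real (Suc r)" for j
  define S where "S p = real (card (nonsingle p))" for p
  define J where "J = T * Suc r"
  let ?d = "\<lambda>j \<omega>. max 0 (S (X n (t (Suc j)) \<omega>) - S (X n (t j) \<omega>))"
  let ?V = "\<lambda>\<omega>. \<Sum>j<J. ?d j \<omega>"
  have t: "0 \<le> t j" "t j < t (Suc j)" "t (Suc j) - t j = 1 / real (Suc r)" for j
    by (auto simp: t_def divide_simps)
  have dint: "integrable M (?d j)" for j
    by (rule joint_integrable[where f = "\<lambda>p q. max 0 (S q - S p)"]) (use t in auto)
  have d: "expectation (?d j) \<le> c / real (Suc r)" for j
  proof -
    have "expectation (\<lambda>\<omega>. if True then max 0 (S (X n (t (Suc j)) \<omega>) - S (X n (t j) \<omega>)) else 0)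
        \<le> 0 + c * (t (Suc j) - t j)"
    proof (rule dynkin_expectation[where \<phi> = "\<lambda>_. True" and F = "\<lambda>p q. max 0 (S q - S p)"])
      fix p q assume "p \<in> parts n" and q: "q \<in> parts n"
      have "gen \<Lambda> (\<lambda>q. max 0 (S q - S p)) q \<le> (\<Sum>K | K \<subseteq> q \<and> 2 \<le> card K. lam \<Lambda> (card q) (card K) * 1)"
        unfolding gen_def
      proof (intro sum_mono mult_left_mono lam_nonneg)
        fix K
        have "S (merge q K) \<le> S q + 1"
          using card_nonsingle_merge_le[OF partsD(2)[OF q], of K] by (simp add: S_def)
        then show "max 0 (S (merge q K) - S p) - max 0 (S q - S p) \<le> 1" by simp
      qed
      also have "\<dots> \<le> c" using sum_lam_total_le[OF assms(1) partsD(2)[OF q]] by (simp add: c_def)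
      finally show "gen \<Lambda> (\<lambda>q. max 0 (S q - S p)) q \<le> c" .
    qed (use t c0 in auto)
    then show ?thesis by (simp add: t(3))
  qed
  have le: "S (X n (t j) \<omega>) \<le> (\<Sum>i<j. ?d i \<omega>)" if "\<omega> \<in> space M" for j \<omega>
  proof (induction j)
    case 0
    have "nonsingle (singletons n) = {}" by (auto simp: nonsingle_def singletons_def)
    then show ?case using X_0[OF that] by (simp add: t_def S_def)
  next
    case (Suc j)
    then show ?case by simp
  qed
  have "prob {\<omega>\<in>space M. \<exists>j\<le>J. m \<le> card (nonsingle (X n (t j) \<omega>))} \<le> prob {\<omega>\<in>space M. real m \<le> ?V \<omega>}"
  proof (rule finite_measure_mono)
    show "{\<omega>\<in>space M. real m \<le> ?V \<omega>} \<in> events"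
      using dint by (intro borel_measurable_le borel_measurable_sum) auto
    show "{\<omega>\<in>space M. \<exists>j\<le>J. m \<le> card (nonsingle (X n (t j) \<omega>))} \<subseteq> {\<omega>\<in>space M. real m \<le> ?V \<omega>}"
    proof safe
      fix \<omega> j assume w: "\<omega> \<in> space M" and j: "j \<le> J" "m \<le> card (nonsingle (X n (t j) \<omega>))"
      have "real m \<le> S (X n (t j) \<omega>)" using j by (simp add: S_def)
      also have "\<dots> \<le> (\<Sum>i<j. ?d i \<omega>)" by (rule le[OF w])
      also have "\<dots> \<le> ?V \<omega>" using j by (intro sum_mono2) auto
      finally show "real m \<le> ?V \<omega>" .
    qed
  qed
  also have "\<dots> \<le> expectation ?V / real m"
    using assms dint
    by (intro integral_Markov_inequality_measure[where A = "{}"]) (auto intro!: sum_nonneg Bochner_Integration.integrable_sum)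
  also have "\<dots> \<le> c * real T / real m"
  proof (rule divide_right_mono)
    have "expectation ?V = (\<Sum>j<J. expectation (?d j))"
      by (rule Bochner_Integration.integral_sum) (rule dint)
    also have "\<dots> \<le> (\<Sum>j<J. c / real (Suc r))" by (intro sum_mono d)
    also have "\<dots> = real T * real (Suc r) * (c / real (Suc r))" unfolding J_def of_nat_mult[symmetric] by simp
    also have "\<dots> = c * real T" by (simp del: of_nat_Suc)
    finally show "expectation ?V \<le> c * real T" .
  qed simp
  finally show ?thesis unfolding c_def J_def t_def .
qed

lemma AE_finite_atomic:
  assumes "mu_neg \<Lambda> 2 < \<infinity>"
  shows "AE \<omega> in M. \<forall>t>0. finite {b \<in> Coal t \<omega>. atomic b}"
proof -
  define c where "c = (\<integral>x. 1 / x ^ 2 \<partial>\<Lambda>)"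
  have c0: "0 \<le> c" unfolding c_def by simp
  have "AE \<omega> in M. \<forall>t>0. t < real T \<longrightarrow> finite {b \<in> Coal t \<omega>. atomic b}" for T
  proof (rule AE_by_small_exceptions)
    fix e :: real assume e: "0 < e"
    obtain m0 where "c * real T / e < real m0" using reals_Archimedean2 by blast
    define m where "m = Suc m0"
    have m: "0 < m" "c * real T / real m \<le> e"
    proof -
      have "c * real T / e < real m" using \<open>c * real T / e < real m0\<close> by (simp add: m_def)
      then show "c * real T / real m \<le> e" using e by (simp add: m_def field_simps)
    qed (simp add: m_def)
    define A where "A n r = {\<omega>\<in>space M. \<exists>j\<le>T * Suc r. m \<le> card (nonsingle (X n (real j / real (Suc r)) \<omega>))}" for n r
    define B where "B n = (\<Union>R. \<Inter>r\<in>{R..}. A n r)" for n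
    define E where "E = (\<Union>N. \<Inter>n\<in>{N..}. B n)"
    have A: "A n r \<in> events" for n r
    proof -
      have "A n r = (\<Union>j\<in>{..T * Suc r}. {\<omega>\<in>space M. m \<le> card (nonsingle (X n (real j / real (Suc r)) \<omega>))})"
        by (auto simp: A_def)
      also have "\<dots> \<in> events"
        by (intro sets.finite_UN finite_atMost joint_pred_event[where t = 0 and \<phi> = "\<lambda>p q. m \<le> card (nonsingle p)"]) auto
      finally show ?thesis .
    qed
    have Am: "prob (A n r) \<le> e" for n r
      using prob_grid_nonsingle_le[OF assms m(1), of T r n] m(2) unfolding A_def c_def by linarith
    have Bm: "B n \<in> events" for n unfolding B_def using A by (intro sets.countable_UN sets.countable_INT' image_subsetI) auto
    have Em: "E \<in> events" unfolding E_def using Bm by (intro sets.countable_UN sets.countable_INT' image_subsetI) auto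
    have "prob (B n) \<le> e" for n unfolding B_def by (rule measure_liminf_le[OF A Am])
    then have "prob E \<le> e" unfolding E_def by (intro measure_liminf_le[OF Bm])
    moreover have "AE \<omega> in M. \<omega> \<notin> E \<longrightarrow> (\<forall>t>0. t < real T \<longrightarrow> finite {b \<in> Coal t \<omega>. atomic b})"
      using AE_space
    proof eventually_elim
      case w: (elim \<omega>)
      show ?case
      proof (intro impI allI)
        fix t assume nE: "\<omega> \<notin> E" and t: "0 < t" "t < real T"
        show "finite {b \<in> Coal t \<omega>. atomic b}"
        proof (rule ccontr)
          assume "infinite {b \<in> Coal t \<omega>. atomic b}"
          then obtain Bs where Bs: "Bs \<subseteq> {b \<in> Coal t \<omega>. atomic b}" "finite Bs" "card Bs = m"
            using infinite_arbitrarily_large by blast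
          obtain N where N: "\<And>n b. N \<le> n \<Longrightarrow> b \<in> Bs \<Longrightarrow> 2 \<le> card (b \<inter> {..<n})"
            using finite_imp_card_ge[OF Bs(2), of 2] Bs(1) atomic_infinite by blast
          have "\<omega> \<in> B n" if n: "N \<le> n" for n
          proof -
            have mS: "m \<le> card (nonsingle (X n t \<omega>))"
              unfolding Bs(3)[symmetric] using Bs N[OF n] Coal_partition[OF w] t
              by (intro card_le_nonsingle_restr) auto
            obtain d where d: "d > 0" "\<And>s. t \<le> s \<and> s < t + d \<Longrightarrow> X n s \<omega> = X n t \<omega>"
              using Coal_right_cont[OF w, of t n] t by auto
            obtain R where R: "1 / real (Suc R) < d" using d(1) nat_approx_posE by blast
            have "\<omega> \<in> A n r" if r: "R \<le> r" for r
            proof -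
              define j where "j = nat \<lceil>t * real (Suc r)\<rceil>"
              have rj: "real j = of_int \<lceil>t * real (Suc r)\<rceil>" using t by (simp add: j_def)
              have j1: "t * real (Suc r) \<le> real j" "real j < t * real (Suc r) + 1"
                unfolding rj by linarith+
              have "t * real (Suc r) < real T * real (Suc r)" using t by (intro mult_strict_right_mono) auto
              then have "\<lceil>t * real (Suc r)\<rceil> \<le> int (T * Suc r)" by (intro ceiling_le) (simp only: of_int_of_nat_eq of_nat_mult of_int_mult less_imp_le)
              then have j2: "j \<le> T * Suc r" unfolding j_def by linarith
              have "1 / real (Suc r) \<le> 1 / real (Suc R)" using r by (simp add: frac_le)
              then have "1 / real (Suc r) < d" using R by linarith
              moreover have "real j / real (Suc r) < t + 1 / real (Suc r)" "t \<le> real j / real (Suc r)"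
                using j1 by (simp_all add: field_simps del: of_nat_Suc)
              ultimately have "X n (real j / real (Suc r)) \<omega> = X n t \<omega>" by (intro d(2)) auto
              then show ?thesis unfolding A_def using w mS j2 by auto
            qed
            then show ?thesis unfolding B_def by auto
          qed
          then have "\<omega> \<in> E" unfolding E_def by auto
          then show False using nE by simp
        qed
      qed
    qed
    ultimately show "\<exists>E\<in>events. prob E \<le> e \<and> (AE \<omega> in M. \<omega> \<notin> E \<longrightarrow> (\<forall>t>0. t < real T \<longrightarrow> finite {b \<in> Coal t \<omega>. atomic b}))"
      using Em by blast
  qed
  then have "AE \<omega> in M. \<forall>T. \<forall>t>0. t < real T \<longrightarrow> finite {b \<in> Coal t \<omega>. atomic b}"
    by (subst AE_all_countable) blast
  then show ?thesis by eventually_elim (use reals_Archimedean2 in blast)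
qed

end

section \<open>Averages of pairwise equicorrelated variables\<close>

lemma fourth_power_bracket:
  fixes n K :: nat
  assumes "(K + 1) ^ 4 \<le> n"
  obtains k where "K \<le> k" "(k + 1) ^ 4 \<le> n" "n < (k + 2) ^ 4"
proof -
  define k0 where "k0 = (LEAST k. n < (k + 1) ^ 4)"
  have "n + 1 \<le> (n + 1) ^ 4" by (rule self_le_power) auto
  then have ex: "n < (n + 1) ^ 4" by simp
  have 1: "n < (k0 + 1) ^ 4" unfolding k0_def by (rule LeastI[of "\<lambda>k. n < (k + 1) ^ 4", OF ex])
  have "k0 \<noteq> 0"
  proof
    assume "k0 = 0"
    then have "n = 0" using 1 by simp
    then show False using assms by simp
  qed
  then obtain k where k: "k0 = Suc k" by (cases k0) auto
  have 2: "(k + 1) ^ 4 \<le> n"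
    using not_less_Least[of k "\<lambda>k. n < (k + 1) ^ 4"] k unfolding k0_def by simp
  have 3: "n < (k + 2) ^ 4" using 1 k by simp
  have "(K + 1) ^ 4 < (k + 2) ^ 4" using assms 3 by linarith
  then have "K + 1 < k + 2" by (rule power_less_imp_less_base) simp
  then have "K \<le> k" by simp
  then show ?thesis using 2 3 by (rule that)
qed

lemma average_tendsto_from_fourth_powers:
  fixes y :: "nat \<Rightarrow> real"
  assumes y: "\<And>j. 0 \<le> y j" "\<And>j. y j \<le> 1"
    and lim: "(\<lambda>k. (\<Sum>j<(k + 1) ^ 4. y j) / real ((k + 1) ^ 4)) \<longlonglongrightarrow> L"
  shows "(\<lambda>n. (\<Sum>j<n. y j) / real n) \<longlonglongrightarrow> L"
proof (rule LIMSEQ_I)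
  fix e :: real assume e: "0 < e"
  have "(\<lambda>k. 1 - (real (k + 1) / real (k + 2)) ^ 4) \<longlonglongrightarrow> 1 - 1 ^ 4"
  proof (intro tendsto_intros)
    have "(\<lambda>k. 1 - 1 / real (k + 2)) \<longlonglongrightarrow> 1 - 0"
      by (intro tendsto_intros LIMSEQ_ignore_initial_segment[OF lim_1_over_n])
    moreover have "1 - 1 / real (k + 2) = real (k + 1) / real (k + 2)" for k
      by (simp add: field_simps)
    ultimately show "(\<lambda>k. real (k + 1) / real (k + 2)) \<longlonglongrightarrow> 1" by simp
  qed
  then have "(\<lambda>k. 1 - (real (k + 1) / real (k + 2)) ^ 4) \<longlonglongrightarrow> 0" by simp
  then have "\<forall>\<^sub>F k in sequentially. 1 - (real (k + 1) / real (k + 2)) ^ 4 < e / 2"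
    using e by (intro order_tendstoD(2)) auto
  moreover have "\<forall>\<^sub>F k in sequentially. dist ((\<Sum>j<(k + 1) ^ 4. y j) / real ((k + 1) ^ 4)) L < e / 2"
    using lim e by (intro tendstoD) auto
  ultimately have "\<forall>\<^sub>F k in sequentially. 1 - (real (k + 1) / real (k + 2)) ^ 4 < e / 2
      \<and> dist ((\<Sum>j<(k + 1) ^ 4. y j) / real ((k + 1) ^ 4)) L < e / 2"
    by (rule eventually_conj)
  then obtain K where "\<forall>k\<ge>K. 1 - (real (k + 1) / real (k + 2)) ^ 4 < e / 2
      \<and> dist ((\<Sum>j<(k + 1) ^ 4. y j) / real ((k + 1) ^ 4)) L < e / 2"
    unfolding eventually_sequentially by blast
  then have K: "\<And>k. K \<le> k \<Longrightarrow> 1 - (real (k + 1) / real (k + 2)) ^ 4 < e / 2"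
    "\<And>k. K \<le> k \<Longrightarrow> \<bar>(\<Sum>j<(k + 1) ^ 4. y j) / real ((k + 1) ^ 4) - L\<bar> < e / 2"
    unfolding dist_real_def by blast+
  have "\<bar>(\<Sum>j<n. y j) / real n - L\<bar> < e" if n: "(K + 1) ^ 4 \<le> n" for n
  proof -
    obtain k where k: "K \<le> k" "(k + 1) ^ 4 \<le> n" "n < (k + 2) ^ 4" using fourth_power_bracket[OF n] .
    define m where "m = (k + 1) ^ 4"
    define Sm where "Sm = (\<Sum>j<m. y j)"
    define D where "D = (\<Sum>j=m..<n. y j)"
    have m: "0 < m" "m \<le> n" using k by (auto simp: m_def)
    have Sn: "(\<Sum>j<n. y j) = Sm + D"
      unfolding Sm_def D_def lessThan_atLeast0 using m by (subst sum.atLeastLessThan_concat) auto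
    have Sm: "0 \<le> Sm" "Sm \<le> real m"
      unfolding Sm_def using y sum_bounded_above[of "{..<m}" y 1] by (auto intro!: sum_nonneg)
    have D: "0 \<le> D" "D \<le> real n - real m"
      unfolding D_def using y sum_bounded_above[of "{m..<n}" y 1] m by (auto intro!: sum_nonneg simp: of_nat_diff)
    have n0: "0 < real n" "0 < real m" using m by auto
    have eq: "(Sm + D) / real n - Sm / real m = D / real n - Sm / real m * ((real n - real m) / real n)"
      using n0 by (simp add: field_simps)
    have b1: "0 \<le> D / real n" "D / real n \<le> (real n - real m) / real n"
      using D n0 by (auto intro!: divide_right_mono)
    have b2: "0 \<le> Sm / real m" "Sm / real m \<le> 1" using Sm n0 by auto
    have b3: "0 \<le> (real n - real m) / real n" using m n0 by auto
    have b4: "0 \<le> Sm / real m * ((real n - real m) / real n)" using b2 b3 by (rule_tac mult_nonneg_nonneg)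
    have b5: "Sm / real m * ((real n - real m) / real n) \<le> 1 * ((real n - real m) / real n)"
      using b2 b3 by (intro mult_right_mono)
    have "\<bar>(Sm + D) / real n - Sm / real m\<bar> \<le> (real n - real m) / real n"
      unfolding eq using b1 b4 b5 by linarith
    also have "\<dots> = 1 - real m / real n" using n0 by (simp add: diff_divide_distrib)
    also have "\<dots> \<le> 1 - real m / real ((k + 2) ^ 4)"
    proof -
      have "real n \<le> real ((k + 2) ^ 4)" using k(3) by (metis less_imp_le of_nat_le_iff)
      then have "real m / real ((k + 2) ^ 4) \<le> real m / real n" using n0 by (intro divide_left_mono) auto
      then show ?thesis by linarith
    qed
    also have "\<dots> = 1 - (real (k + 1) / real (k + 2)) ^ 4"
      by (simp add: m_def power_divide del: of_nat_add of_nat_Suc)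
    also have "\<dots> < e / 2" by (rule K(1)[OF k(1)])
    finally have "\<bar>(Sm + D) / real n - Sm / real m\<bar> < e / 2" .
    moreover have "\<bar>Sm / real m - L\<bar> < e / 2"
      unfolding Sm_def m_def by (rule K(2)[OF k(1)])
    ultimately show ?thesis unfolding Sn by linarith
  qed
  then show "\<exists>no. \<forall>n\<ge>no. norm ((\<Sum>j<n. y j) / real n - L) < e"
    unfolding real_norm_def by blast
qed

context prob_space
begin

lemma average_diff_second_moment:
  fixes Y :: "nat \<Rightarrow> 'a \<Rightarrow> real"
  assumes meas: "\<And>j. Y j \<in> borel_measurable M"
    and Y: "\<And>j \<omega>. 0 \<le> Y j \<omega>" "\<And>j \<omega>. Y j \<omega> \<le> 1"
    and c: "\<And>j k. j \<noteq> k \<Longrightarrow> expectation (\<lambda>\<omega>. Y j \<omega> * Y k \<omega>) = c"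
    and mn: "0 < m" "m \<le> n"
  shows "expectation (\<lambda>\<omega>. ((\<Sum>j<m. Y j \<omega>) / real m - (\<Sum>j<n. Y j \<omega>) / real n)\<^sup>2) \<le> 1 / real m"
    and "integrable M (\<lambda>\<omega>. ((\<Sum>j<m. Y j \<omega>) / real m - (\<Sum>j<n. Y j \<omega>) / real n)\<^sup>2)"
proof -
  define w where "w j = (if j < m then 1 / real m else 0) - 1 / real n" for j
  have yy: "integrable M (\<lambda>\<omega>. Y j \<omega> * Y k \<omega>)" for j k
    using Y meas by (intro integrable_const_bound[where B = 1]) (auto simp: abs_mult intro!: mult_le_one)
  have "0 \<le> expectation (\<lambda>\<omega>. Y 0 \<omega> * Y 1 \<omega>)"
    by (intro Bochner_Integration.integral_nonneg mult_nonneg_nonneg Y)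
  then have c0: "0 \<le> c" using c[of 0 1] by simp
  have n0: "0 < real n" "0 < real m" using mn by auto
  have restr: "(\<Sum>j<n. (if j < m then f j else 0)) = (\<Sum>j<m. f j)" for f :: "nat \<Rightarrow> real"
  proof -
    have "{..<n} \<inter> {j. j < m} = {..<m}" using mn by auto
    then show ?thesis by (simp add: sum.If_cases)
  qed
  have eq: "((\<Sum>j<m. Y j \<omega>) / real m - (\<Sum>j<n. Y j \<omega>) / real n)\<^sup>2
      = (\<Sum>j<n. \<Sum>k<n. w j * w k * (Y j \<omega> * Y k \<omega>))" for \<omega>
  proof -
    have "(\<Sum>j<n. w j * Y j \<omega>) = (\<Sum>j<n. (if j < m then Y j \<omega> / real m else 0)) - (\<Sum>j<n. Y j \<omega> / real n)"
      unfolding sum_subtractf[symmetric] by (intro sum.cong) (auto simp: w_def field_simps)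
    also have "\<dots> = (\<Sum>j<m. Y j \<omega>) / real m - (\<Sum>j<n. Y j \<omega>) / real n"
      unfolding restr by (simp add: sum_divide_distrib)
    finally have "((\<Sum>j<m. Y j \<omega>) / real m - (\<Sum>j<n. Y j \<omega>) / real n)\<^sup>2
        = (\<Sum>j<n. w j * Y j \<omega>) * (\<Sum>k<n. w k * Y k \<omega>)" by (simp add: power2_eq_square)
    then show ?thesis unfolding sum_product by (simp only: mult_ac)
  qed
  show "integrable M (\<lambda>\<omega>. ((\<Sum>j<m. Y j \<omega>) / real m - (\<Sum>j<n. Y j \<omega>) / real n)\<^sup>2)"
    unfolding eq using yy by (intro Bochner_Integration.integrable_sum integrable_mult_right)
  have sw: "(\<Sum>j<n. w j) = 0"
    unfolding w_def sum_subtractf restr using n0 by simp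
  have sw2: "(\<Sum>j<n. (w j)\<^sup>2) \<le> 1 / real m"
  proof -
    have "(\<Sum>j<n. (w j)\<^sup>2) = (\<Sum>j<n. (if j < m then (1 / real m)\<^sup>2 - 2 / (real m * real n) else 0) + (1 / real n)\<^sup>2)"
      using n0 by (intro sum.cong) (auto simp: w_def power2_eq_square field_simps)
    also have "\<dots> = real m * ((1 / real m)\<^sup>2 - 2 / (real m * real n)) + real n * (1 / real n)\<^sup>2"
      unfolding sum.distrib restr by simp
    also have "\<dots> = 1 / real m - 1 / real n" using n0 by (simp add: power2_eq_square field_simps)
    also have "\<dots> \<le> 1 / real m" using n0 by simp
    finally show ?thesis .
  qed
  have "expectation (\<lambda>\<omega>. ((\<Sum>j<m. Y j \<omega>) / real m - (\<Sum>j<n. Y j \<omega>) / real n)\<^sup>2)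
    = (\<Sum>j<n. \<Sum>k<n. w j * w k * expectation (\<lambda>\<omega>. Y j \<omega> * Y k \<omega>))"
    unfolding eq using yy by (subst Bochner_Integration.integral_sum, force)+ simp
  also have "\<dots> = (\<Sum>j<n. \<Sum>k<n. w j * w k * c + (if k = j then (w j)\<^sup>2 * (expectation (\<lambda>\<omega>. Y j \<omega> * Y j \<omega>) - c) else 0))"
    by (intro sum.cong refl) (auto simp: c power2_eq_square algebra_simps)
  also have "\<dots> = (\<Sum>j<n. w j) * (\<Sum>k<n. w k) * c + (\<Sum>j<n. (w j)\<^sup>2 * (expectation (\<lambda>\<omega>. Y j \<omega> * Y j \<omega>) - c))"
  proof -
    have "(\<Sum>j<n. w j) * (\<Sum>k<n. w k) * c = (\<Sum>j<n. \<Sum>k<n. w j * w k * c)"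
      by (subst sum_product) (simp only: sum_distrib_right)
    then show ?thesis unfolding sum.distrib by (simp add: sum.delta)
  qed
  also have "\<dots> \<le> (\<Sum>j<n. (w j)\<^sup>2 * 1)"
  proof -
    have "expectation (\<lambda>\<omega>. Y j \<omega> * Y j \<omega>) - c \<le> 1" for j
    proof -
      have "expectation (\<lambda>\<omega>. Y j \<omega> * Y j \<omega>) \<le> 1"
        using Y by (intro integral_le_const yy AE_I2 mult_le_one)
      then show ?thesis using c0 by linarith
    qed
    then have "(\<Sum>j<n. (w j)\<^sup>2 * (expectation (\<lambda>\<omega>. Y j \<omega> * Y j \<omega>) - c)) \<le> (\<Sum>j<n. (w j)\<^sup>2 * 1)"
      by (intro sum_mono mult_left_mono) auto
    then show ?thesis unfolding sw by simp
  qed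
  also have "\<dots> \<le> 1 / real m" using sw2 by simp
  finally show "expectation (\<lambda>\<omega>. ((\<Sum>j<m. Y j \<omega>) / real m - (\<Sum>j<n. Y j \<omega>) / real n)\<^sup>2) \<le> 1 / real m" .
qed

lemma AE_average_convergent:
  fixes Y :: "nat \<Rightarrow> 'a \<Rightarrow> real"
  assumes meas: "\<And>j. Y j \<in> borel_measurable M"
    and Y: "\<And>j \<omega>. 0 \<le> Y j \<omega>" "\<And>j \<omega>. Y j \<omega> \<le> 1"
    and c: "\<And>j k. j \<noteq> k \<Longrightarrow> expectation (\<lambda>\<omega>. Y j \<omega> * Y k \<omega>) = c"
  shows "AE \<omega> in M. convergent (\<lambda>n. (\<Sum>j<n. Y j \<omega>) / real n)"
proof -
  define A where "A n \<omega> = (\<Sum>j<n. Y j \<omega>) / real n" for n \<omega>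
  \<comment> \<open>Along fourth powers the second moments of the increments stay summable after weighting by squares.\<close>
  define Z where "Z k \<omega> = A ((k + 1) ^ 4) \<omega> - A ((k + 2) ^ 4) \<omega>" for k \<omega>
  let ?f = "\<lambda>k \<omega>. (real (k + 1))\<^sup>2 * (Z k \<omega>)\<^sup>2"
  have int: "integrable M (?f k)" and le: "expectation (?f k) \<le> 1 / (real (k + 1))\<^sup>2" for k
  proof -
    have mn: "0 < (k + 1) ^ 4" "(k + 1) ^ 4 \<le> (k + 2) ^ 4" by (auto intro!: power_mono)
    note sm = average_diff_second_moment[OF meas Y c mn]
    show "integrable M (?f k)" unfolding Z_def A_def by (intro integrable_mult_right sm(2))
    have "expectation (?f k) = (real (k + 1))\<^sup>2 * expectation (\<lambda>\<omega>. (Z k \<omega>)\<^sup>2)" by simp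
    also have "\<dots> \<le> (real (k + 1))\<^sup>2 * (1 / real ((k + 1) ^ 4))"
      unfolding Z_def A_def by (intro mult_left_mono sm(1)) auto
    also have "\<dots> = 1 / (real (k + 1))\<^sup>2"
      unfolding of_nat_power by (simp add: divide_simps power_add[symmetric] del: of_nat_add)
    finally show "expectation (?f k) \<le> 1 / (real (k + 1))\<^sup>2" .
  qed
  have sq: "summable (\<lambda>k. 1 / (real (k + 1))\<^sup>2)"
    using inverse_power_summable[of 2, where 'a = real] summable_Suc_iff[of "\<lambda>n. inverse (real n ^ 2)"]
    by (simp add: inverse_eq_divide)
  have "(\<integral>\<^sup>+ \<omega>. (\<Sum>k. ennreal (?f k \<omega>)) \<partial>M) = (\<Sum>k. \<integral>\<^sup>+ \<omega>. ennreal (?f k \<omega>) \<partial>M)"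
    using int by (intro nn_integral_suminf) auto
  also have "\<dots> \<le> (\<Sum>k. ennreal (1 / (real (k + 1))\<^sup>2))"
  proof (intro suminf_le)
    fix k
    have "(\<integral>\<^sup>+ \<omega>. ennreal (?f k \<omega>) \<partial>M) = ennreal (expectation (?f k))"
      by (rule nn_integral_eq_integral[OF int]) auto
    then show "(\<integral>\<^sup>+ \<omega>. ennreal (?f k \<omega>) \<partial>M) \<le> ennreal (1 / (real (k + 1))\<^sup>2)"
      using le[of k] by (metis ennreal_leI)
  qed auto
  also have "\<dots> = ennreal (\<Sum>k. 1 / (real (k + 1))\<^sup>2)"
    using sq by (intro suminf_ennreal_eq summable_sums) auto
  also have "\<dots> < \<infinity>" by simp
  finally have "AE \<omega> in M. (\<Sum>k. ennreal (?f k \<omega>)) \<noteq> \<infinity>"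
    using int by (intro nn_integral_PInf_AE) auto
  then show ?thesis
  proof eventually_elim
    case (elim \<omega>)
    have s1: "summable (\<lambda>k. ?f k \<omega>)"
      using elim by (intro summable_suminf_not_top) auto
    have s2: "summable (\<lambda>k. (?f k \<omega> + 1 / (real (k + 1))\<^sup>2) / 2)"
      by (intro summable_divide summable_add s1 sq)
    have "summable (\<lambda>k. Z k \<omega>)"
    proof (rule summable_comparison_test[OF _ s2], intro exI[of _ 0] allI impI)
      fix k
      have "0 \<le> (real (k + 1) * \<bar>Z k \<omega>\<bar> - 1 / real (k + 1))\<^sup>2" by simp
      also have "\<dots> = ?f k \<omega> + 1 / (real (k + 1))\<^sup>2 - 2 * \<bar>Z k \<omega>\<bar>"
        by (simp add: power2_diff power_mult_distrib power_divide del: of_nat_add of_nat_Suc)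
      finally show "norm (Z k \<omega>) \<le> (?f k \<omega> + 1 / (real (k + 1))\<^sup>2) / 2" by simp
    qed
    then obtain L' where "(\<lambda>n. \<Sum>k<n. Z k \<omega>) \<longlonglongrightarrow> L'"
      by (auto simp: summable_iff_convergent convergent_def)
    moreover have "(\<Sum>k<n. Z k \<omega>) = A 1 \<omega> - A ((n + 1) ^ 4) \<omega>" for n
      by (induction n) (auto simp: Z_def)
    ultimately have "(\<lambda>n. A 1 \<omega> - A ((n + 1) ^ 4) \<omega>) \<longlonglongrightarrow> L'" by simp
    from tendsto_diff[OF tendsto_const[of "A 1 \<omega>"] this]
    obtain L where "(\<lambda>n. A ((n + 1) ^ 4) \<omega>) \<longlonglongrightarrow> L" by auto
    then have "(\<lambda>n. (\<Sum>j<n. Y j \<omega>) / real n) \<longlonglongrightarrow> L"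
      unfolding A_def by (intro average_tendsto_from_fourth_powers Y)
    then show ?case by (rule convergentI)
  qed
qed

end

section \<open>Non-singleton blocks are atomic\<close>

definition swap :: "nat \<Rightarrow> nat \<Rightarrow> nat \<Rightarrow> nat" where
  "swap a b = id(a := b, b := a)"

lemma involution_swap: "a < n \<Longrightarrow> b < n \<Longrightarrow> involution (swap a b) n"
  by unfold_locales (auto simp: swap_def)

context involution
begin

lemma sim_relabel: "sim (relabel \<sigma> p) i j \<longleftrightarrow> sim p (\<sigma> i) (\<sigma> j)"
proof -
  have "x \<in> \<sigma> ` b \<longleftrightarrow> \<sigma> x \<in> b" for x b by (metis imageE image_eqI invol)
  then show ?thesis by (simp add: sim_def relabel_def)
qed

lemma card_sim_relabel:
  assumes "\<sigma> i = i"
  shows "card {k. k < n \<and> sim (relabel \<sigma> p) i k} = card {k. k < n \<and> sim p i k}"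
proof (rule bij_betw_same_card[of \<sigma>])
  show "bij_betw \<sigma> {k. k < n \<and> sim (relabel \<sigma> p) i k} {k. k < n \<and> sim p i k}"
    by (rule bij_betw_byWitness[where f' = \<sigma>]) (auto simp: invol less_iff sim_relabel assms)
qed

end

lemma block_eq_sim:
  assumes "partition_on UNIV P" "b \<in> P" "i \<in> b"
  shows "b = {k. sim P i k}"
  using partition_onD2[OF assms(1)] assms(2,3) unfolding disjoint_def sim_def by blast

context coalescent
begin

lemma prob_relabel:
  assumes "involution \<sigma> n" "0 \<le> t"
  shows "prob {\<omega>\<in>space M. \<phi> (X n t \<omega>)} = prob {\<omega>\<in>space M. \<phi> (relabel \<sigma> (X n t \<omega>))}"
proof -
  interpret involution \<sigma> n by fact
  have P: "prob {\<omega>\<in>space M. \<psi> (X n t \<omega>)} = (\<Sum>q | q \<in> parts n. mp n t q * (if \<psi> q then 1 else 0))" for \<psi>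
    using prob_eq_expectation[OF assms(2,2), where \<phi> = "\<lambda>p q. \<psi> p"]
      single_expectation[OF assms(2), where F = "\<lambda>q. if \<psi> q then 1 else 0" and n = n] by simp
  have "(\<Sum>q | q \<in> parts n. mp n t q * (if \<phi> q then 1 else 0))
    = (\<Sum>q | q \<in> parts n. mp n t (relabel \<sigma> q) * (if \<phi> (relabel \<sigma> q) then 1 else 0))"
    by (rule sum_relabel) simp
  then show ?thesis
    unfolding P P[of "\<lambda>q. \<phi> (relabel \<sigma> q)"] using assms(2) by (simp add: mp_eq trans_singletons_relabel)
qed

lemma sim_pair_event:
  assumes "0 \<le> t"
  shows "{\<omega>\<in>space M. sim (Coal t \<omega>) i a \<and> sim (Coal t \<omega>) i b} \<in> events"
proof -
  define n where "n = Suc (max i (max a b))"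
  have n: "i < n" "a < n" "b < n" by (auto simp: n_def)
  have "{\<omega>\<in>space M. sim (X n t \<omega>) i a \<and> sim (X n t \<omega>) i b} \<in> events"
    using joint_pred_event[OF assms assms, where \<phi> = "\<lambda>p q. sim p i a \<and> sim p i b"] .
  then show ?thesis using n by (simp add: sim_restr)
qed

lemma prob_sim_pair_swap:
  assumes "0 \<le> t" "a \<noteq> i" "a' \<noteq> i" "a \<noteq> b" "a' \<noteq> b"
  shows "prob {\<omega>\<in>space M. sim (Coal t \<omega>) i a \<and> sim (Coal t \<omega>) i b}
    = prob {\<omega>\<in>space M. sim (Coal t \<omega>) i a' \<and> sim (Coal t \<omega>) i b}"
proof -
  define n where "n = Suc (max i (max a (max a' b)))"
  have n: "i < n" "a < n" "a' < n" "b < n" by (auto simp: n_def)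
  interpret involution "swap a a'" n using n by (intro involution_swap)
  have "prob {\<omega>\<in>space M. sim (X n t \<omega>) i a \<and> sim (X n t \<omega>) i b}
    = prob {\<omega>\<in>space M. sim (relabel (swap a a') (X n t \<omega>)) i a \<and> sim (relabel (swap a a') (X n t \<omega>)) i b}"
    by (rule prob_relabel[OF involution_axioms assms(1), where \<phi> = "\<lambda>q. sim q i a \<and> sim q i b"])
  also have "\<dots> = prob {\<omega>\<in>space M. sim (X n t \<omega>) i a' \<and> sim (X n t \<omega>) i b}"
    unfolding sim_relabel using assms by (simp add: swap_def)
  finally show ?thesis using n by (simp add: sim_restr)
qed

lemma prob_sim_pair_const:
  assumes "0 \<le> t" "a \<noteq> i" "a' \<noteq> i" "b \<noteq> i" "b' \<noteq> i" "a \<noteq> b" "a' \<noteq> b'"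
  shows "prob {\<omega>\<in>space M. sim (Coal t \<omega>) i a \<and> sim (Coal t \<omega>) i b}
    = prob {\<omega>\<in>space M. sim (Coal t \<omega>) i a' \<and> sim (Coal t \<omega>) i b'}"
proof -
  define f where "f a b = prob {\<omega>\<in>space M. sim (Coal t \<omega>) i a \<and> sim (Coal t \<omega>) i b}" for a b
  have sw: "f x y = f x' y" if "x \<noteq> i" "x' \<noteq> i" "x \<noteq> y" "x' \<noteq> y" for x x' y
    unfolding f_def using that assms(1) by (intro prob_sim_pair_swap)
  have sym: "f x y = f y x" for x y unfolding f_def by (simp add: conj_commute)
  define l where "l = Suc (i + a + b + a' + b')"
  have l: "l \<noteq> i" "l \<noteq> a" "l \<noteq> b" "l \<noteq> a'" "l \<noteq> b'" by (auto simp: l_def)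
  have "f a b = f l b" using l assms by (intro sw) auto
  also have "\<dots> = f b l" by (rule sym)
  also have "\<dots> = f b' l" using l assms by (intro sw) auto
  also have "\<dots> = f l b'" by (rule sym)
  also have "\<dots> = f a' b'" using l assms by (intro sw) auto
  finally show ?thesis unfolding f_def .
qed

lemma AE_sim_average_convergent:
  assumes "0 \<le> t"
  shows "AE \<omega> in M. convergent (\<lambda>n. (\<Sum>j<n. if sim (Coal t \<omega>) i (i + 1 + j) then 1 else 0 :: real) / real n)"
proof -
  let ?Y = "\<lambda>j \<omega>. indicator {\<omega>\<in>space M. sim (Coal t \<omega>) i (i + 1 + j)} \<omega> :: real"
  have ev: "{\<omega>\<in>space M. sim (Coal t \<omega>) i (i + 1 + j)} \<in> events" for j
    using sim_pair_event[OF assms, of i "i + 1 + j" "i + 1 + j"] by simp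
  have "AE \<omega> in M. convergent (\<lambda>n. (\<Sum>j<n. ?Y j \<omega>) / real n)"
  proof (rule AE_average_convergent)
    show "?Y j \<in> borel_measurable M" for j using ev by (intro borel_measurable_indicator)
    fix j k :: nat assume "j \<noteq> k"
    have "expectation (\<lambda>\<omega>. ?Y j \<omega> * ?Y k \<omega>)
      = expectation (indicator {\<omega>\<in>space M. sim (Coal t \<omega>) i (i + 1 + j) \<and> sim (Coal t \<omega>) i (i + 1 + k)})"
      by (intro Bochner_Integration.integral_cong) (auto simp: indicator_def)
    also have "\<dots> = prob {\<omega>\<in>space M. sim (Coal t \<omega>) i (i + 1 + j) \<and> sim (Coal t \<omega>) i (i + 1 + k)}"
      by (subst Bochner_Integration.integral_indicator) (auto intro!: arg_cong[where f = prob])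
    also have "\<dots> = prob {\<omega>\<in>space M. sim (Coal t \<omega>) i (i + 1) \<and> sim (Coal t \<omega>) i (i + 2)}"
      using \<open>j \<noteq> k\<close> by (intro prob_sim_pair_const assms) auto
    finally show "expectation (\<lambda>\<omega>. ?Y j \<omega> * ?Y k \<omega>)
      = prob {\<omega>\<in>space M. sim (Coal t \<omega>) i (i + 1) \<and> sim (Coal t \<omega>) i (i + 2)}" .
  qed (auto simp: indicator_def)
  then show ?thesis using AE_space
  proof eventually_elim
    case (elim \<omega>)
    have "(\<Sum>j<n. ?Y j \<omega>) = (\<Sum>j<n. if sim (Coal t \<omega>) i (i + 1 + j) then 1 else 0)" for n
      using elim(2) by (intro sum.cong) (auto simp: indicator_def)
    then show ?case using elim(1) by simp
  qed
qed

lemma prob_sim_small_block_le: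
  assumes "0 \<le> t" "i < n" "j < n" "i \<noteq> j" "0 \<le> \<delta>"
  shows "prob {\<omega>\<in>space M. sim (X n t \<omega>) i j \<and> real (card {k. k < n \<and> sim (X n t \<omega>) i k}) \<le> \<delta> * real n} \<le> 2 * \<delta>"
proof -
  define C where "C p = real (card {k. k < n \<and> sim p i k})" for p
  define f where "f k = prob {\<omega>\<in>space M. sim (X n t \<omega>) i k \<and> C (X n t \<omega>) \<le> \<delta> * real n}" for k
  define I where "I = {..<n} - {i}"
  have f: "f k = f j" if "k \<in> I" for k
  proof -
    have k: "k < n" "k \<noteq> i" using that by (auto simp: I_def)
    interpret involution "swap k j" n using k assms by (intro involution_swap)
    have "swap k j i = i" using k assms by (simp add: swap_def)
    then have C: "C (relabel (swap k j) p) = C p" for p unfolding C_def by (simp add: card_sim_relabel)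
    have "f k = prob {\<omega>\<in>space M. sim (relabel (swap k j) (X n t \<omega>)) i k \<and> C (relabel (swap k j) (X n t \<omega>)) \<le> \<delta> * real n}"
      unfolding f_def
      by (rule prob_relabel[OF involution_axioms assms(1), where \<phi> = "\<lambda>q. sim q i k \<and> C q \<le> \<delta> * real n"])
    then show ?thesis using \<open>swap k j i = i\<close> k unfolding C f_def by (simp add: sim_relabel) (simp add: swap_def)
  qed
  have fe: "f k = expectation (\<lambda>\<omega>. if sim (X n t \<omega>) i k \<and> C (X n t \<omega>) \<le> \<delta> * real n then 1 else 0)" for k
    unfolding f_def by (rule prob_eq_expectation[OF assms(1,1), where \<phi> = "\<lambda>p q. sim p i k \<and> C p \<le> \<delta> * real n"])
  have int: "integrable M (\<lambda>\<omega>. if sim (X n t \<omega>) i k \<and> C (X n t \<omega>) \<le> \<delta> * real n then 1 else 0 :: real)" for k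
    by (rule joint_integrable[OF assms(1,1), where f = "\<lambda>p q. if sim p i k \<and> C p \<le> \<delta> * real n then 1 else 0"])
  have "real (card I) * f j = (\<Sum>k\<in>I. f k)" using f by simp
  also have "\<dots> = expectation (\<lambda>\<omega>. \<Sum>k\<in>I. if sim (X n t \<omega>) i k \<and> C (X n t \<omega>) \<le> \<delta> * real n then 1 else 0)"
    unfolding fe by (rule Bochner_Integration.integral_sum[symmetric]) (rule int)
  also have "\<dots> \<le> \<delta> * real n"
  proof (rule integral_le_const)
    show "AE \<omega> in M. (\<Sum>k\<in>I. if sim (X n t \<omega>) i k \<and> C (X n t \<omega>) \<le> \<delta> * real n then 1 else 0) \<le> \<delta> * real n"
    proof (rule AE_I2)
      fix \<omega>
      show "(\<Sum>k\<in>I. if sim (X n t \<omega>) i k \<and> C (X n t \<omega>) \<le> \<delta> * real n then 1 else 0 :: real) \<le> \<delta> * real n"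
      proof (cases "C (X n t \<omega>) \<le> \<delta> * real n")
        case True
        then have "(\<Sum>k\<in>I. if sim (X n t \<omega>) i k \<and> C (X n t \<omega>) \<le> \<delta> * real n then 1 else 0 :: real)
          = real (card {k\<in>I. sim (X n t \<omega>) i k})"
          by (simp add: I_def sum.If_cases Int_def)
        also have "\<dots> \<le> C (X n t \<omega>)"
          unfolding C_def of_nat_le_iff by (rule card_mono) (auto simp: I_def)
        finally show ?thesis using True by linarith
      qed (use assms in auto)
    qed
  qed (intro Bochner_Integration.integrable_sum int)
  finally have *: "real (card I) * f j \<le> \<delta> * real n" .
  have n2: "2 \<le> n" using assms by linarith
  have cI: "real (card I) = real n - 1" using assms by (simp add: I_def of_nat_diff)
  have "real n \<le> 2 * (real n - 1)" using n2 of_nat_le_iff[of 2 n, where 'a = real] by simp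
  then have "\<delta> * real n \<le> \<delta> * (2 * (real n - 1))" using assms by (intro mult_left_mono)
  with * have "(real n - 1) * f j \<le> (real n - 1) * (2 * \<delta>)" unfolding cI by (simp add: mult_ac)
  then have "f j \<le> 2 * \<delta>" using n2 by simp
  then show ?thesis unfolding f_def C_def .
qed

lemma AE_sim_frequency_nonzero:
  assumes "0 \<le> t" "i \<noteq> j"
  shows "AE \<omega> in M. sim (Coal t \<omega>) i j \<longrightarrow> \<not> (\<lambda>n. real (card {k. k < n \<and> sim (Coal t \<omega>) i k}) / real n) \<longlonglongrightarrow> 0"
proof (rule AE_by_small_exceptions)
  fix e :: real assume e: "0 < e"
  define D where "D n = {\<omega>\<in>space M. sim (X n t \<omega>) i j \<and> real (card {k. k < n \<and> sim (X n t \<omega>) i k}) \<le> e / 2 * real n}" for n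
  define E where "E = (\<Union>N. \<Inter>n\<in>{N..}. D n)"
  have D: "D n \<in> events" for n
    unfolding D_def
    by (rule joint_pred_event[OF assms(1,1), where \<phi> = "\<lambda>p q. sim p i j \<and> real (card {k. k < n \<and> sim p i k}) \<le> e / 2 * real n"])
  have pD: "prob (D n) \<le> e" if "Suc (max i j) \<le> n" for n
    using prob_sim_small_block_le[OF assms(1), of i n j "e / 2"] assms that e unfolding D_def by auto
  have "prob E \<le> e" unfolding E_def by (rule measure_liminf_le[OF D pD])
  moreover have "E \<in> events" unfolding E_def using D by (intro sets.countable_UN sets.countable_INT' image_subsetI) auto
  moreover have "AE \<omega> in M. \<omega> \<notin> E \<longrightarrow> sim (Coal t \<omega>) i j \<longrightarrow>
      \<not> (\<lambda>n. real (card {k. k < n \<and> sim (Coal t \<omega>) i k}) / real n) \<longlonglongrightarrow> 0"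
    using AE_space
  proof eventually_elim
    case w: (elim \<omega>)
    show ?case
    proof (intro impI notI)
      assume nE: "\<omega> \<notin> E" and sim: "sim (Coal t \<omega>) i j"
        and lim: "(\<lambda>n. real (card {k. k < n \<and> sim (Coal t \<omega>) i k}) / real n) \<longlonglongrightarrow> 0"
      have "\<forall>\<^sub>F n in sequentially. real (card {k. k < n \<and> sim (Coal t \<omega>) i k}) / real n < e / 2"
        using lim e by (intro order_tendstoD(2)) auto
      then obtain N where N: "\<And>n. N \<le> n \<Longrightarrow> real (card {k. k < n \<and> sim (Coal t \<omega>) i k}) / real n < e / 2"
        unfolding eventually_sequentially by blast
      have "\<omega> \<in> D n" if n: "max N (Suc (max i j)) \<le> n" for n
      proof -
        have ij: "i < n" "j < n" "N \<le> n" using n by auto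
        have "{k. k < n \<and> sim (X n t \<omega>) i k} = {k. k < n \<and> sim (Coal t \<omega>) i k}"
          using ij sim_restr by blast
        moreover have "real (card {k. k < n \<and> sim (Coal t \<omega>) i k}) \<le> e / 2 * real n"
          using N[OF ij(3)] ij(1) by (simp add: field_simps)
        ultimately show ?thesis unfolding D_def using w sim ij by (simp add: sim_restr)
      qed
      then have "\<omega> \<in> E" unfolding E_def by blast
      then show False using nE by simp
    qed
  qed
  ultimately show "\<exists>E\<in>events. prob E \<le> e \<and> (AE \<omega> in M. \<omega> \<notin> E \<longrightarrow> sim (Coal t \<omega>) i j \<longrightarrow>
      \<not> (\<lambda>n. real (card {k. k < n \<and> sim (Coal t \<omega>) i k}) / real n) \<longlonglongrightarrow> 0)" by blast
qed

lemma AE_nonsingleton_atomic: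
  assumes "0 \<le> t"
  shows "AE \<omega> in M. \<forall>b\<in>Coal t \<omega>. \<forall>i\<in>b. \<forall>j\<in>b. i \<noteq> j \<longrightarrow> atomic b"
proof -
  have "AE \<omega> in M. \<forall>i. convergent (\<lambda>n. (\<Sum>j<n. if sim (Coal t \<omega>) i (i + 1 + j) then 1 else 0 :: real) / real n)"
    using AE_sim_average_convergent[OF assms] by (simp add: AE_all_countable)
  moreover have "AE \<omega> in M. \<forall>i. \<forall>j. i \<noteq> j \<longrightarrow> sim (Coal t \<omega>) i j \<longrightarrow>
      \<not> (\<lambda>n. real (card {k. k < n \<and> sim (Coal t \<omega>) i k}) / real n) \<longlonglongrightarrow> 0"
    using AE_sim_frequency_nonzero[OF assms] by (simp add: AE_all_countable)
  ultimately show ?thesis using AE_space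
  proof eventually_elim
    case (elim \<omega>)
    show ?case
    proof (intro ballI impI)
      fix b i j assume b: "b \<in> Coal t \<omega>" "i \<in> b" "j \<in> b" "i \<noteq> j"
      define c where "c n = real (card {k. k < n \<and> sim (Coal t \<omega>) i k})" for n
      have beq: "b = {k. sim (Coal t \<omega>) i k}" using Coal_partition[OF elim(3) assms] b by (intro block_eq_sim)
      have cb: "real (card (b \<inter> {..<n})) = c n" for n
      proof -
        have "b \<inter> {..<n} = {k. k < n \<and> sim (Coal t \<omega>) i k}" unfolding beq by auto
        then show ?thesis by (simp add: c_def)
      qed
      define y where "y j = (if sim (Coal t \<omega>) i (i + 1 + j) then 1 else 0 :: real)" for j
      obtain L where L: "(\<lambda>n. (\<Sum>j<n. y j) / real n) \<longlonglongrightarrow> L"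
        using elim(1) unfolding y_def convergent_def by blast
      have cs: "c (n + (i + 1)) = c (i + 1) + (\<Sum>j<n. y j)" for n
      proof (induction n)
        case (Suc n)
        have "{k. k < Suc n + (i + 1) \<and> sim (Coal t \<omega>) i k}
          = {k. k < n + (i + 1) \<and> sim (Coal t \<omega>) i k} \<union> (if sim (Coal t \<omega>) i (i + 1 + n) then {i + 1 + n} else {})"
          by (auto simp: less_Suc_eq add_ac)
        then have "c (Suc n + (i + 1)) = c (n + (i + 1)) + y n"
          unfolding c_def y_def by (simp add: card_insert_if)
        then show ?case using Suc by simp
      qed simp
      have "(\<lambda>n. c (i + 1) / real (n + (i + 1)) + (\<Sum>j<n. y j) / real n * (1 - real (i + 1) / real (n + (i + 1))))
          \<longlonglongrightarrow> 0 + L * (1 - 0)"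
        by (intro tendsto_intros L LIMSEQ_ignore_initial_segment[OF lim_const_over_n])
      moreover have "c (i + 1) / real (n + (i + 1)) + (\<Sum>j<n. y j) / real n * (1 - real (i + 1) / real (n + (i + 1)))
        = c (n + (i + 1)) / real (n + (i + 1))" for n
      proof -
        have "1 - real (i + 1) / real (n + (i + 1)) = real n / real (n + (i + 1))"
          by (simp add: field_simps)
        then show ?thesis unfolding cs by (cases "n = 0") (simp_all add: add_divide_distrib)
      qed
      ultimately have "(\<lambda>n. c (n + (i + 1)) / real (n + (i + 1))) \<longlonglongrightarrow> L" by simp
      then have lim: "(\<lambda>n. c n / real n) \<longlonglongrightarrow> L" by (rule LIMSEQ_offset)
      have "0 \<le> L" using lim by (rule LIMSEQ_le_const) (auto simp: c_def)
      moreover have "sim (Coal t \<omega>) i j" using b beq by auto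
      then have "L \<noteq> 0" using elim(2) b(4) lim unfolding c_def by blast
      ultimately show "atomic b" unfolding atomic_def cb using lim by (intro exI[of _ L]) auto
    qed
  qed
qed

end

section \<open>Survival of blocks and birth from dust\<close>

lemma bernoulli_complement:
  fixes x :: real
  assumes "0 \<le> x" "x \<le> 1"
  shows "1 - (1 - x) ^ D \<le> real D * x"
  using Bernoulli_inequality[of "- x" D] assms by simp

context dust_coalescent
begin

definition kappa :: "real \<Rightarrow> real" where
  "kappa A = (\<integral>x. min 1 (- ln (1 - x) / ln A) / x\<^sup>2 \<partial>\<Lambda>)"

lemma ln_ge_1: "3 \<le> A \<Longrightarrow> 1 \<le> ln (A :: real)"
  using exp_le by (metis dual_order.trans exp_gt_zero ln_exp ln_le_cancel_iff order_less_le_trans)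

lemma kappa_integrand_bounds:
  fixes A x :: real
  assumes "3 \<le> A" "0 < x" "x < 1"
  shows "0 \<le> min 1 (- ln (1 - x) / ln A) / x\<^sup>2" "min 1 (- ln (1 - x) / ln A) / x\<^sup>2 \<le> 2 * (1 / x ^ 1)"
proof -
  have A: "1 \<le> ln A" using assms by (intro ln_ge_1)
  have l: "0 \<le> - ln (1 - x)" using assms by simp
  show "0 \<le> min 1 (- ln (1 - x) / ln A) / x\<^sup>2"
    using A l by (intro divide_nonneg_nonneg min.boundedI[of 0]) simp_all
  have "min 1 (- ln (1 - x) / ln A) \<le> 2 * x"
  proof (cases "1 / 2 \<le> x")
    case False
    have "- ln (1 - x) = ln (1 / (1 - x))" using assms by (simp add: ln_div)
    also have "\<dots> \<le> 1 / (1 - x) - 1" using assms by (intro ln_le_minus_one) simp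
    also have "\<dots> = x / (1 - x)" using assms by (simp add: field_simps)
    also have "\<dots> \<le> x / (1 / 2)" using False assms by (intro divide_left_mono) auto
    finally have "- ln (1 - x) \<le> 2 * x" by simp
    moreover have "- ln (1 - x) / ln A \<le> - ln (1 - x) / 1" using A l by (intro divide_left_mono) auto
    ultimately show ?thesis by linarith
  qed auto
  then have "min 1 (- ln (1 - x) / ln A) / x\<^sup>2 \<le> 2 * x / x\<^sup>2" by (intro divide_right_mono) auto
  also have "\<dots> = 2 * (1 / x ^ 1)" using assms by (simp add: power2_eq_square)
  finally show "min 1 (- ln (1 - x) / ln A) / x\<^sup>2 \<le> 2 * (1 / x ^ 1)" .
qed

lemma integrable_kappa:
  assumes "3 \<le> A"
  shows "integrable \<Lambda> (\<lambda>x. min 1 (- ln (1 - x) / ln A) / x\<^sup>2)"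
proof (rule Bochner_Integration.integrable_bound)
  show "integrable \<Lambda> (\<lambda>x. 2 * (1 / x ^ 1))"
    by (intro integrable_mult_right integrable_inverse_power mu1)
  show "(\<lambda>x. min 1 (- ln (1 - x) / ln A) / x\<^sup>2) \<in> borel_measurable \<Lambda>"
    by (rule borel_Lambda) measurable
  show "AE x in \<Lambda>. norm (min 1 (- ln (1 - x) / ln A) / x\<^sup>2) \<le> norm (2 * (1 / x ^ 1))"
    using AE_Lambda_01
  proof eventually_elim
    case (elim x)
    then show ?case using kappa_integrand_bounds[OF assms, of x] unfolding real_norm_def by linarith
  qed
qed

lemma kappa_nonneg:
  assumes "3 \<le> A" shows "0 \<le> kappa A"
  unfolding kappa_def
proof (rule integral_nonneg_AE)
  show "AE x in \<Lambda>. 0 \<le> min 1 (- ln (1 - x) / ln A) / x\<^sup>2"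
    using AE_Lambda_01 by eventually_elim (use kappa_integrand_bounds[OF assms] in auto)
qed

lemma kappa_small:
  assumes "0 < e"
  shows "\<exists>A. A0 \<le> A \<and> 3 \<le> A \<and> kappa A \<le> e"
proof -
  have "(\<lambda>k. kappa (real k + 3)) \<longlonglongrightarrow> (\<integral>x. 0 \<partial>\<Lambda>)"
    unfolding kappa_def
  proof (rule integral_dominated_convergence)
    show "integrable \<Lambda> (\<lambda>x. 2 * (1 / x ^ 1))"
      by (intro integrable_mult_right integrable_inverse_power mu1)
    show "(\<lambda>x. min 1 (- ln (1 - x) / ln (real k + 3)) / x\<^sup>2) \<in> borel_measurable \<Lambda>" for k
      by (rule borel_Lambda) measurable
    show "AE x in \<Lambda>. norm (min 1 (- ln (1 - x) / ln (real k + 3)) / x\<^sup>2) \<le> 2 * (1 / x ^ 1)" for k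
      using AE_Lambda_01
    proof eventually_elim
      case (elim x)
      then show ?case using kappa_integrand_bounds[of "real k + 3" x] by simp
    qed
    show "AE x in \<Lambda>. (\<lambda>k. min 1 (- ln (1 - x) / ln (real k + 3)) / x\<^sup>2) \<longlonglongrightarrow> 0"
      using AE_Lambda_01
    proof eventually_elim
      case (elim x)
      have "filterlim (\<lambda>k. ln (real k + 3)) at_top sequentially"
        by (intro filterlim_compose[OF ln_at_top] filterlim_tendsto_add_at_top[OF tendsto_const, where c = 3, simplified add.commute]
            filterlim_real_sequentially)
      then have "(\<lambda>k. - ln (1 - x) / ln (real k + 3)) \<longlonglongrightarrow> 0"
        by (intro real_tendsto_divide_at_top[OF tendsto_const])
      then have "(\<lambda>k. min 1 (- ln (1 - x) / ln (real k + 3)) / x\<^sup>2) \<longlonglongrightarrow> min 1 0 / x\<^sup>2"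
        using elim by (intro tendsto_intros) auto
      then show ?case by simp
    qed
  qed auto
  then have "\<forall>\<^sub>F k in sequentially. kappa (real k + 3) < e"
    using assms by (intro order_tendstoD(2)) auto
  moreover have "\<forall>\<^sub>F k in sequentially. A0 \<le> real k"
    using eventually_ge_at_top[of "nat \<lceil>A0\<rceil>"] by eventually_elim linarith
  ultimately have "\<forall>\<^sub>F k in sequentially. kappa (real k + 3) < e \<and> A0 \<le> real k" by (rule eventually_conj)
  then obtain k where "kappa (real k + 3) < e" "A0 \<le> real k" unfolding eventually_sequentially by blast
  then show ?thesis by (intro exI[of _ "real k + 3"]) auto
qed

lemma sum_lam_lyap_le:
  assumes "q \<in> parts n" "W \<subseteq> q" "3 \<le> A"
  shows "(\<Sum>K | K \<subseteq> q \<and> 2 \<le> card K. lam \<Lambda> (card q) (card K) * (lyap A (card (W - K)) - lyap A (card W))) \<le> kappa A"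
  unfolding kappa_def
proof (rule sum_lam_le[OF integrable_kappa[OF assms(3)] partsD(2)[OF assms(1)]])
  fix x :: real assume x: "0 < x" "x < 1"
  have "(\<Sum>K | K \<subseteq> q \<and> 2 \<le> card K. x ^ card K * (1 - x) ^ (card q - card K) * (lyap A (card (W - K)) - lyap A (card W)))
      \<le> min 1 (- ln (1 - x) / ln A)"
    using assms by (intro sum_weights_lyap_le[OF partsD(2)[OF assms(1)] assms(2) x]) auto
  then show "(\<Sum>K | K \<subseteq> q \<and> 2 \<le> card K. x ^ card K * (1 - x) ^ (card q - card K) * (lyap A (card (W - K)) - lyap A (card W)))
      \<le> x\<^sup>2 * (min 1 (- ln (1 - x) / ln A) / x\<^sup>2)"
    using x by simp
qed

lemma prob_few_survivors_le:
  assumes st: "0 \<le> s" "s < t" and A: "3 \<le> A" "(1 + real m)\<^sup>2 \<le> A"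
  shows "prob {\<omega>\<in>space M. A \<le> 1 + real (card (R (X n s \<omega>) \<inter> X n s \<omega>))
      \<and> card (R (X n s \<omega>) \<inter> X n t \<omega>) < m} \<le> 2 * kappa A * (t - s)"
proof -
  let ?\<phi> = "\<lambda>p. A \<le> 1 + real (card (R p \<inter> p))"
  let ?F = "\<lambda>p q. lyap A (card (R p \<inter> q))"
  have "prob {\<omega>\<in>space M. ?\<phi> (X n s \<omega>) \<and> card (R (X n s \<omega>) \<inter> X n t \<omega>) < m}
    \<le> prob {\<omega>\<in>space M. ?\<phi> (X n s \<omega>) \<and> 1 / 2 \<le> ?F (X n s \<omega>) (X n t \<omega>)}"
  proof (rule finite_measure_mono)
    show "{\<omega>\<in>space M. ?\<phi> (X n s \<omega>) \<and> 1 / 2 \<le> ?F (X n s \<omega>) (X n t \<omega>)} \<in> events"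
      by (rule joint_pred_event[where \<phi> = "\<lambda>p q. ?\<phi> p \<and> 1 / 2 \<le> ?F p q"]) (use st in auto)
    have "1 / 2 \<le> lyap A g" if "g < m" for g
    proof (rule lyap_ge_half)
      have "(1 + real g)\<^sup>2 \<le> (1 + real m)\<^sup>2" using that by (intro power_mono) auto
      then show "(1 + real g)\<^sup>2 \<le> A" using A by linarith
    qed (use A in simp)
    then show "{\<omega>\<in>space M. ?\<phi> (X n s \<omega>) \<and> card (R (X n s \<omega>) \<inter> X n t \<omega>) < m}
      \<subseteq> {\<omega>\<in>space M. ?\<phi> (X n s \<omega>) \<and> 1 / 2 \<le> ?F (X n s \<omega>) (X n t \<omega>)}" by auto
  qed
  also have "\<dots> \<le> (0 + kappa A * (t - s)) / (1 / 2)"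
  proof (rule dynkin_prob[OF st, where \<phi> = ?\<phi> and F = ?F])
    fix p q assume q: "q \<in> parts n"
    note fq = partsD(2)[OF q]
    have "gen \<Lambda> (?F p) q \<le> (\<Sum>K | K \<subseteq> q \<and> 2 \<le> card K.
        lam \<Lambda> (card q) (card K) * (lyap A (card (R p \<inter> q - K)) - lyap A (card (R p \<inter> q))))"
      unfolding gen_def
    proof (intro sum_mono mult_left_mono lam_nonneg diff_right_mono lyap_antimono card_mono)
      fix K
      show "finite (R p \<inter> merge q K)" using fq by (auto simp: merge_def)
      show "R p \<inter> q - K \<subseteq> R p \<inter> merge q K" by (auto simp: merge_def)
    qed (use A in simp)
    also have "\<dots> \<le> kappa A" by (rule sum_lam_lyap_le[OF q _ A(1)]) auto
    finally show "gen \<Lambda> (?F p) q \<le> kappa A" .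
  next
    fix p assume "?\<phi> p"
    then show "?F p p \<le> 0" using A by (subst lyap_eq_0) auto
  qed (use A st kappa_nonneg[OF A(1)] lyap_range in auto)
  finally show ?thesis by simp
qed

definition dust :: "nat set set \<Rightarrow> nat set set" where
  "dust q = {b\<in>q. card b = 1}"

lemma dust_nonsingle:
  assumes "q \<in> parts n"
  shows "q = dust q \<union> nonsingle q" "dust q \<inter> nonsingle q = {}" "card q = card (dust q) + card (nonsingle q)"
proof -
  have "1 \<le> card b" if "b \<in> q" for b
    using partsD(3,5)[OF assms] that by (metis One_nat_def Suc_leI card_gt_0_iff)
  then show 1: "q = dust q \<union> nonsingle q" unfolding dust_def nonsingle_def by force
  show 2: "dust q \<inter> nonsingle q = {}" by (auto simp: dust_def nonsingle_def)
  have "finite (dust q)" "finite (nonsingle q)" using partsD(2)[OF assms] by (auto simp: dust_def nonsingle_def)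
  then show "card q = card (dust q) + card (nonsingle q)" using card_Un_disjoint[OF _ _ 2] 1 by metis
qed

lemma card_nonsingle_merge:
  assumes q: "q \<in> parts n" and K: "K \<subseteq> q" "2 \<le> card K"
  shows "card (nonsingle (merge q K)) = Suc (card (nonsingle q - K))"
proof -
  note p = partsD[OF q]
  have K0: "finite K" using p(2) K finite_subset by blast
  obtain b c where bc: "b \<in> K" "c \<in> K" "b \<noteq> c"
    using K(2) K0 by (metis One_nat_def Suc_1 card_le_Suc0_iff_eq not_less_eq_eq)
  have bq: "b \<in> q" "c \<in> q" using bc K by auto
  obtain i where i: "i \<in> b" using p(3) bq by (metis ex_in_conv)
  obtain j where j: "j \<in> c" using p(3) bq by (metis ex_in_conv)
  have ij: "i \<noteq> j" using p(4)[OF bq i] j bc by auto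
  have fU: "finite (\<Union>K)" using K0 K p(5) by (intro finite_Union) auto
  have "card {i, j} \<le> card (\<Union>K)" using fU i j bc by (intro card_mono) auto
  then have c2: "2 \<le> card (\<Union>K)" using ij by simp
  have notin: "\<Union>K \<notin> q - K"
  proof
    assume "\<Union>K \<in> q - K"
    then have U: "\<Union>K \<in> q" "\<Union>K \<notin> K" by auto
    have "i \<in> \<Union>K" using i bc by auto
    then have "b = \<Union>K" using p(4)[OF bq(1) U(1) i] by simp
    then show False using U(2) bc(1) by simp
  qed
  have "nonsingle (merge q K) = insert (\<Union>K) (nonsingle q - K)"
    using c2 by (auto simp: nonsingle_def merge_def)
  moreover have "\<Union>K \<notin> nonsingle q - K" using notin by (auto simp: nonsingle_def)
  moreover have "finite (nonsingle q - K)" using p(2) by (simp add: nonsingle_def)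
  ultimately show ?thesis by simp
qed

definition birth :: "nat \<Rightarrow> nat \<Rightarrow> real" where
  "birth D m = (\<integral>x. (1 - x) ^ m * (1 - (1 - x) ^ D - real D * x * (1 - x) ^ (D - 1)) / x\<^sup>2 \<partial>\<Lambda>)"

lemma birth_integrand_bounds:
  assumes "0 < x" "x < 1" "1 \<le> D"
  shows "0 \<le> (1 - x) ^ m * (1 - (1 - x) ^ D - real D * x * (1 - x) ^ (D - 1)) / x\<^sup>2"
    "(1 - x) ^ m * (1 - (1 - x) ^ D - real D * x * (1 - x) ^ (D - 1)) / x\<^sup>2 \<le> real D * (1 / x ^ 1)"
proof -
  let ?g = "1 - (1 - x) ^ D - real D * x * (1 - x) ^ (D - 1)"
  have g0: "0 \<le> ?g" using weights_ge_2_mono[of x 1 D] assms by simp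
  then show "0 \<le> (1 - x) ^ m * ?g / x\<^sup>2" using assms by (intro divide_nonneg_nonneg mult_nonneg_nonneg) auto
  have "0 \<le> real D * x * (1 - x) ^ (D - 1)" using assms by simp
  then have g1: "?g \<le> real D * x" using bernoulli_complement[of x D] assms by linarith
  have "(1 - x) ^ m * ?g \<le> 1 * (real D * x)"
    using g0 g1 assms by (intro mult_mono power_le_one) auto
  then have "(1 - x) ^ m * ?g / x\<^sup>2 \<le> (real D * x) / x\<^sup>2" by (intro divide_right_mono) auto
  also have "\<dots> = real D * (1 / x ^ 1)" using assms by (simp add: power2_eq_square)
  finally show "(1 - x) ^ m * ?g / x\<^sup>2 \<le> real D * (1 / x ^ 1)" .
qed

lemma integrable_birth:
  assumes "1 \<le> D"
  shows "integrable \<Lambda> (\<lambda>x. (1 - x) ^ m * (1 - (1 - x) ^ D - real D * x * (1 - x) ^ (D - 1)) / x\<^sup>2)"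
proof (rule Bochner_Integration.integrable_bound)
  show "integrable \<Lambda> (\<lambda>x. real D * (1 / x ^ 1))"
    by (intro integrable_mult_right integrable_inverse_power mu1)
  show "(\<lambda>x. (1 - x) ^ m * (1 - (1 - x) ^ D - real D * x * (1 - x) ^ (D - 1)) / x\<^sup>2) \<in> borel_measurable \<Lambda>"
    by (rule borel_Lambda) measurable
  show "AE x in \<Lambda>. norm ((1 - x) ^ m * (1 - (1 - x) ^ D - real D * x * (1 - x) ^ (D - 1)) / x\<^sup>2) \<le> norm (real D * (1 / x ^ 1))"
    using AE_Lambda_01
  proof eventually_elim
    case (elim x)
    then show ?case using birth_integrand_bounds[of x D m] assms unfolding real_norm_def by linarith
  qed
qed

lemma birth_le_sum_lam:
  assumes q: "q \<in> parts n" and D: "1 \<le> D" "D \<le> card (dust q)" and m: "card (nonsingle q) \<le> m"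
  shows "birth D m \<le> (\<Sum>K | K \<subseteq> q \<and> 2 \<le> card K. lam \<Lambda> (card q) (card K) * (if K \<subseteq> dust q then 1 else 0))"
proof -
  let ?w = "\<lambda>x. (1 - x) ^ m * (1 - (1 - x) ^ D - real D * x * (1 - x) ^ (D - 1)) / x\<^sup>2"
  let ?Z = "dust q"
  note fq = partsD(2)[OF q]
  have fZ: "finite ?Z" using fq by (simp add: dust_def)
  have Zq: "?Z \<subseteq> q" by (auto simp: dust_def)
  have "(\<Sum>K | K \<subseteq> q \<and> 2 \<le> card K. lam \<Lambda> (card q) (card K) * - (if K \<subseteq> ?Z then 1 else 0)) \<le> (\<integral>x. - ?w x \<partial>\<Lambda>)"
  proof (rule sum_lam_le[OF _ fq])
    show "integrable \<Lambda> (\<lambda>x. - ?w x)" by (intro Bochner_Integration.integrable_minus integrable_birth D)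
    fix x :: real assume x: "0 < x" "x < 1"
    let ?d = "card ?Z"
    have "(\<Sum>K | K \<subseteq> q \<and> 2 \<le> card K. x ^ card K * (1 - x) ^ (card q - card K) * (if K \<subseteq> ?Z then 1 else 0))
      = (\<Sum>K | K \<subseteq> ?Z \<and> 2 \<le> card K. x ^ card K * (1 - x) ^ (card q - card K) * (if K \<subseteq> ?Z then 1 else 0))"
      using fq Zq by (intro sum.mono_neutral_right) auto
    also have "\<dots> = (\<Sum>K | K \<subseteq> ?Z \<and> 2 \<le> card K. (1 - x) ^ card (nonsingle q) * (x ^ card K * (1 - x) ^ (?d - card K)))"
    proof (rule sum.cong)
      fix K assume K: "K \<in> {K. K \<subseteq> ?Z \<and> 2 \<le> card K}"
      then have "card K \<le> ?d" using fZ by (auto intro: card_mono)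
      then have "card q - card K = card (nonsingle q) + (?d - card K)" using dust_nonsingle(3)[OF q] by simp
      then show "x ^ card K * (1 - x) ^ (card q - card K) * (if K \<subseteq> ?Z then 1 else 0)
        = (1 - x) ^ card (nonsingle q) * (x ^ card K * (1 - x) ^ (?d - card K))"
        using K by (simp add: power_add)
    qed simp
    also have "\<dots> = (1 - x) ^ card (nonsingle q) * (1 - (1 - x) ^ ?d - real ?d * x * (1 - x) ^ (?d - 1))"
      unfolding sum_distrib_left[symmetric] sum_Pow_weights_ge_2[OF fZ] ..
    also have "\<dots> \<ge> (1 - x) ^ m * (1 - (1 - x) ^ D - real D * x * (1 - x) ^ (D - 1))"
    proof (rule mult_mono)
      show "(1 - x) ^ m \<le> (1 - x) ^ card (nonsingle q)" using x m by (intro power_decreasing) auto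
      show "1 - (1 - x) ^ D - real D * x * (1 - x) ^ (D - 1) \<le> 1 - (1 - x) ^ ?d - real ?d * x * (1 - x) ^ (?d - 1)"
        using x D by (intro weights_ge_2_mono) auto
      show "0 \<le> 1 - (1 - x) ^ D - real D * x * (1 - x) ^ (D - 1)"
        using weights_ge_2_mono[of x 1 D] x D by simp
    qed (use x in auto)
    finally have "(1 - x) ^ m * (1 - (1 - x) ^ D - real D * x * (1 - x) ^ (D - 1))
      \<le> (\<Sum>K | K \<subseteq> q \<and> 2 \<le> card K. x ^ card K * (1 - x) ^ (card q - card K) * (if K \<subseteq> ?Z then 1 else 0))" .
    then show "(\<Sum>K | K \<subseteq> q \<and> 2 \<le> card K. x ^ card K * (1 - x) ^ (card q - card K) * - (if K \<subseteq> ?Z then 1 else 0)) \<le> x\<^sup>2 * - ?w x"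
      using x by (simp only: mult_minus_right sum_negf) simp
  qed
  then show ?thesis by (simp only: mult_minus_right sum_negf integral_minus birth_def neg_le_iff_le)
qed

lemma birth_unbounded:
  assumes mu2: "mu_neg \<Lambda> 2 = \<infinity>"
  shows "\<exists>D\<ge>1. L \<le> birth D m"
proof (rule ccontr)
  assume "\<not> (\<exists>D\<ge>1. L \<le> birth D m)"
  then have "\<not> L \<le> birth (Suc D) m" for D by auto
  then have L: "birth (Suc D) m \<le> L" for D using less_imp_le not_le by blast
  let ?v = "\<lambda>D x. (1 - x) ^ m * (1 - (1 - x) ^ Suc D - real (Suc D) * x * (1 - x) ^ D) / x\<^sup>2"
  have v: "birth (Suc D) m = integral\<^sup>L \<Lambda> (?v D)" "integrable \<Lambda> (?v D)" for D
    using integrable_birth[of "Suc D" m] by (simp_all add: birth_def)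
  have "(\<integral>\<^sup>+ x. ennreal ((1 - x) ^ m / x\<^sup>2) \<partial>\<Lambda>) = (\<integral>\<^sup>+ x. liminf (\<lambda>D. ennreal (?v D x)) \<partial>\<Lambda>)"
  proof (rule nn_integral_cong_AE)
    show "AE x in \<Lambda>. ennreal ((1 - x) ^ m / x\<^sup>2) = liminf (\<lambda>D. ennreal (?v D x))"
      using AE_Lambda_01
    proof eventually_elim
      case (elim x)
      have p: "(\<lambda>D. (1 - x) ^ Suc D) \<longlonglongrightarrow> 0"
        using elim by (intro LIMSEQ_Suc LIMSEQ_power_zero) auto
      have n: "(\<lambda>D. real D * (1 - x) ^ D) \<longlonglongrightarrow> 0"
        using elim by (intro powser_times_n_limit_0) auto
      have "(\<lambda>D. real (Suc D) * x * (1 - x) ^ D) = (\<lambda>D. x * (real D * (1 - x) ^ D) + x * (1 - x) ^ D)"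
        by (auto simp: algebra_simps)
      moreover have "(\<lambda>D. x * (real D * (1 - x) ^ D) + x * (1 - x) ^ D) \<longlonglongrightarrow> x * 0 + x * 0"
        using elim by (intro tendsto_intros n LIMSEQ_power_zero) auto
      ultimately have nn: "(\<lambda>D. real (Suc D) * x * (1 - x) ^ D) \<longlonglongrightarrow> 0" by simp
      have "(\<lambda>D. ?v D x) \<longlonglongrightarrow> (1 - x) ^ m * (1 - 0 - 0) / x\<^sup>2"
        using elim by (intro tendsto_intros p nn) auto
      then have "(\<lambda>D. ennreal (?v D x)) \<longlonglongrightarrow> ennreal ((1 - x) ^ m / x\<^sup>2)"
        by (intro tendsto_ennrealI) simp
      then show ?case by (intro lim_imp_Liminf[symmetric]) auto
    qed
  qed
  also have "\<dots> \<le> liminf (\<lambda>D. \<integral>\<^sup>+ x. ennreal (?v D x) \<partial>\<Lambda>)"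
    using v(2) by (intro nn_integral_liminf) auto
  also have "\<dots> \<le> ennreal L"
  proof (rule Liminf_le)
    show "\<forall>\<^sub>F D in sequentially. (\<integral>\<^sup>+ x. ennreal (?v D x) \<partial>\<Lambda>) \<le> ennreal L"
    proof (intro always_eventually allI)
      fix D
      have "(\<integral>\<^sup>+ x. ennreal (?v D x) \<partial>\<Lambda>) = ennreal (birth (Suc D) m)"
        unfolding v(1)
      proof (rule nn_integral_eq_integral[OF v(2)])
        show "AE x in \<Lambda>. 0 \<le> ?v D x" using AE_Lambda_01
        proof eventually_elim
          case (elim x)
          then show ?case using birth_integrand_bounds(1)[of x "Suc D" m] by simp
        qed
      qed
      then show "(\<integral>\<^sup>+ x. ennreal (?v D x) \<partial>\<Lambda>) \<le> ennreal L" using L[of D] by (simp add: ennreal_leI)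
    qed
  qed simp
  finally have fin: "(\<integral>\<^sup>+ x. ennreal ((1 - x) ^ m / x\<^sup>2) \<partial>\<Lambda>) \<le> ennreal L" .
  have "mu_neg \<Lambda> 2 = (\<integral>\<^sup>+ x. ennreal (1 / x ^ 2) \<partial>\<Lambda>)" by (simp add: nn_integral_mu_neg)
  also have "\<dots> \<le> (\<integral>\<^sup>+ x. ennreal (2 ^ m) * ennreal ((1 - x) ^ m / x\<^sup>2) + 4 \<partial>\<Lambda>)"
  proof (rule nn_integral_mono_AE)
    show "AE x in \<Lambda>. ennreal (1 / x ^ 2) \<le> ennreal (2 ^ m) * ennreal ((1 - x) ^ m / x\<^sup>2) + 4"
      using AE_Lambda_01
    proof eventually_elim
      case (elim x)
      have nn: "0 \<le> 2 ^ m * ((1 - x) ^ m / x\<^sup>2)" using elim by simp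
      have "1 / x ^ 2 \<le> 2 ^ m * ((1 - x) ^ m / x\<^sup>2) + 4"
      proof (cases "x \<le> 1 / 2")
        case True
        have "1 \<le> (2 * (1 - x)) ^ m" using True by (intro one_le_power) auto
        then have "1 / x ^ 2 \<le> (2 * (1 - x)) ^ m / x ^ 2" by (intro divide_right_mono) auto
        then have "1 / x ^ 2 \<le> 2 ^ m * ((1 - x) ^ m / x\<^sup>2)" by (simp only: power_mult_distrib times_divide_eq_right)
        then show ?thesis by linarith
      next
        case False
        then have "(1 / 2)\<^sup>2 \<le> x\<^sup>2" by (intro power_mono) auto
        then have "1 / x\<^sup>2 \<le> 1 / (1 / 2)\<^sup>2" using elim by (intro divide_left_mono) auto
        then have "1 / x\<^sup>2 \<le> 4" by (simp add: power2_eq_square)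
        then show ?thesis using nn by linarith
      qed
      then have "ennreal (1 / x ^ 2) \<le> ennreal (2 ^ m * ((1 - x) ^ m / x\<^sup>2) + 4)" by (rule ennreal_leI)
      also have "\<dots> = ennreal (2 ^ m * ((1 - x) ^ m / x\<^sup>2)) + ennreal 4"
        using nn by (intro ennreal_plus) auto
      also have "\<dots> = ennreal (2 ^ m) * ennreal ((1 - x) ^ m / x\<^sup>2) + 4"
        using elim by (subst ennreal_mult) auto
      finally show ?case .
    qed
  qed
  also have "\<dots> = ennreal (2 ^ m) * (\<integral>\<^sup>+ x. ennreal ((1 - x) ^ m / x\<^sup>2) \<partial>\<Lambda>) + 4 * emeasure \<Lambda> (space \<Lambda>)"
  proof -
    have ms: "(\<lambda>x. ennreal ((1 - x) ^ m / x\<^sup>2)) \<in> borel_measurable \<Lambda>" by (rule borel_Lambda) measurable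
    then show ?thesis by (subst nn_integral_add) (auto simp: nn_integral_cmult)
  qed
  also have "\<dots> < \<infinity>"
    using fin finite_measure.emeasure_finite[OF finite_Lambda, of "space \<Lambda>"]
    by (auto simp: ennreal_mult_less_top less_top order_le_less_trans[OF _ ennreal_less_top])
  finally show False using mu2 by simp
qed

end

section \<open>Infinitely many atomic blocks\<close>

context dust_coalescent
begin

lemma gen_lyap_nonsingle_le:
  assumes q: "q \<in> parts n" and A: "3 \<le> A"
  shows "gen \<Lambda> (\<lambda>q. lyap A (card (nonsingle q))) q \<le> kappa A
    - (lyap A (card (nonsingle q)) - lyap A (Suc (card (nonsingle q))))
      * (\<Sum>K | K \<subseteq> q \<and> 2 \<le> card K. lam \<Lambda> (card q) (card K) * (if K \<subseteq> dust q then 1 else 0))"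
proof -
  let ?W = "nonsingle q"
  let ?b = "lyap A (card ?W) - lyap A (Suc (card ?W))"
  have A1: "1 < A" using A by simp
  have "gen \<Lambda> (\<lambda>q. lyap A (card (nonsingle q))) q
    \<le> (\<Sum>K | K \<subseteq> q \<and> 2 \<le> card K. lam \<Lambda> (card q) (card K) * (lyap A (card (?W - K)) - lyap A (card ?W))
        - ?b * (lam \<Lambda> (card q) (card K) * (if K \<subseteq> dust q then 1 else 0)))"
    unfolding gen_def
  proof (rule sum_mono)
    fix K assume "K \<in> {K. K \<subseteq> q \<and> 2 \<le> card K}"
    then have K: "K \<subseteq> q" "2 \<le> card K" by auto
    have "lyap A (card (nonsingle (merge q K))) - lyap A (card ?W)
      \<le> lyap A (card (?W - K)) - lyap A (card ?W) - ?b * (if K \<subseteq> dust q then 1 else 0)"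
    proof (cases "K \<subseteq> dust q")
      case True
      then have "?W - K = ?W" using dust_nonsingle(2)[OF q] by blast
      then show ?thesis using True card_nonsingle_merge[OF q K] by simp
    next
      case False
      have "lyap A (Suc (card (?W - K))) \<le> lyap A (card (?W - K))" by (rule lyap_antimono[OF A1]) simp
      then show ?thesis using False card_nonsingle_merge[OF q K] by simp
    qed
    then have "lam \<Lambda> (card q) (card K) * (lyap A (card (nonsingle (merge q K))) - lyap A (card ?W))
      \<le> lam \<Lambda> (card q) (card K) * (lyap A (card (?W - K)) - lyap A (card ?W) - ?b * (if K \<subseteq> dust q then 1 else 0))"
      by (rule mult_left_mono[OF _ lam_nonneg])
    then show "lam \<Lambda> (card q) (card K) * (lyap A (card (nonsingle (merge q K))) - lyap A (card ?W))
      \<le> lam \<Lambda> (card q) (card K) * (lyap A (card (?W - K)) - lyap A (card ?W))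
        - ?b * (lam \<Lambda> (card q) (card K) * (if K \<subseteq> dust q then 1 else 0))"
      by (simp only: right_diff_distrib mult_ac)
  qed
  also have "\<dots> = (\<Sum>K | K \<subseteq> q \<and> 2 \<le> card K. lam \<Lambda> (card q) (card K) * (lyap A (card (?W - K)) - lyap A (card ?W)))
      - ?b * (\<Sum>K | K \<subseteq> q \<and> 2 \<le> card K. lam \<Lambda> (card q) (card K) * (if K \<subseteq> dust q then 1 else 0))"
    by (simp only: sum_subtractf sum_distrib_left)
  also have "\<dots> \<le> kappa A - ?b * (\<Sum>K | K \<subseteq> q \<and> 2 \<le> card K. lam \<Lambda> (card q) (card K) * (if K \<subseteq> dust q then 1 else 0))"
    by (intro diff_right_mono sum_lam_lyap_le[OF q _ A]) (auto simp: nonsingle_def)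
  finally show ?thesis .
qed

lemma prob_little_dust_le:
  assumes "0 < t" "3 \<le> A" "(1 + real D)\<^sup>2 \<le> A" "A \<le> 1 + real n"
  shows "prob {\<omega>\<in>space M. card (dust (X n t \<omega>)) < D} \<le> 2 * kappa A * t"
proof -
  have cs: "card (singletons n) = n" unfolding singletons_def by (simp add: card_image)
  have "prob {\<omega>\<in>space M. card (dust (X n t \<omega>)) < D} \<le> prob {\<omega>\<in>space M.
      A \<le> 1 + real (card (singletons n \<inter> X n 0 \<omega>)) \<and> card (singletons n \<inter> X n t \<omega>) < D}"
  proof (rule finite_measure_mono)
    show "{\<omega>\<in>space M. A \<le> 1 + real (card (singletons n \<inter> X n 0 \<omega>)) \<and> card (singletons n \<inter> X n t \<omega>) < D} \<in> events"
      by (rule joint_pred_event[where \<phi> = "\<lambda>p q. A \<le> 1 + real (card (singletons n \<inter> p)) \<and> card (singletons n \<inter> q) < D"])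
        (use assms in auto)
    show "{\<omega>\<in>space M. card (dust (X n t \<omega>)) < D} \<subseteq> {\<omega>\<in>space M.
      A \<le> 1 + real (card (singletons n \<inter> X n 0 \<omega>)) \<and> card (singletons n \<inter> X n t \<omega>) < D}"
    proof safe
      fix \<omega> assume w: "\<omega> \<in> space M" and d: "card (dust (X n t \<omega>)) < D"
      show "A \<le> 1 + real (card (singletons n \<inter> X n 0 \<omega>))" using X_0[OF w] cs assms by simp
      have "finite (dust (X n t \<omega>))" using partsD(2)[OF X_parts[OF w]] assms(1) by (simp add: dust_def)
      then have "card (singletons n \<inter> X n t \<omega>) \<le> card (dust (X n t \<omega>))"
        by (rule card_mono) (auto simp: dust_def singletons_def)
      then show "card (singletons n \<inter> X n t \<omega>) < D" using d by simp
    qed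
  qed
  also have "\<dots> \<le> 2 * kappa A * (t - 0)"
    by (rule prob_few_survivors_le[where R = "\<lambda>_. singletons n"]) (use assms in auto)
  finally show ?thesis by simp
qed

lemma exists_time_many_blocks:
  assumes mu2: "mu_neg \<Lambda> 2 = \<infinity>" and "0 < s" "0 < e" "0 < m"
  shows "\<exists>n t. 0 < t \<and> t < s \<and> prob {\<omega>\<in>space M. card (nonsingle (X n t \<omega>)) < m} \<le> e"
proof -
  define A where "A = real m + 3"
  have A: "3 \<le> A" "1 < A" "1 + real m \<le> A" by (auto simp: A_def)
  define \<delta> where "\<delta> = (ln (1 + real m) - ln (real m)) / ln A"
  have \<delta>: "0 < \<delta>" unfolding \<delta>_def using A assms by (intro divide_pos_pos) auto
  define L where "L = 2 * (kappa A + 2 / s) / (\<delta> * e)"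
  have L0: "0 \<le> L" unfolding L_def using \<delta> assms kappa_nonneg[OF A(1)] by (intro divide_nonneg_pos mult_nonneg_nonneg add_nonneg_nonneg) auto
  have L: "\<delta> * L * (e / 2) = kappa A + 2 / s" unfolding L_def using \<delta> assms by simp
  obtain D where D: "1 \<le> D" "L \<le> birth D m" using birth_unbounded[OF mu2] by blast
  obtain A' where A': "(1 + real D)\<^sup>2 \<le> A'" "3 \<le> A'" "kappa A' \<le> e / (4 * s)"
    using kappa_small[of "e / (4 * s)" "(1 + real D)\<^sup>2"] assms by auto
  define n where "n = nat \<lceil>A'\<rceil>"
  have n: "A' \<le> 1 + real n" unfolding n_def by linarith
  let ?F = "\<lambda>q. lyap A (card (nonsingle q))"
  have dust: "prob {\<omega>\<in>space M. card (dust (X n u \<omega>)) < D} \<le> e / 2" if u: "0 < u" "u < s" for u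
  proof -
    have "prob {\<omega>\<in>space M. card (dust (X n u \<omega>)) < D} \<le> 2 * kappa A' * u"
      using u A' n by (intro prob_little_dust_le) auto
    also have "\<dots> \<le> 2 * (e / (4 * s)) * s" using A' u kappa_nonneg assms by (intro mult_mono) auto
    also have "\<dots> = e / 2" using assms by simp
    finally show ?thesis .
  qed
  have gen: "gen \<Lambda> ?F q \<le> kappa A - \<delta> * L * (if card (nonsingle q) < m \<and> \<not> card (dust q) < D then 1 else 0)"
    if q: "q \<in> parts n" for q
  proof -
    let ?r = "\<Sum>K | K \<subseteq> q \<and> 2 \<le> card K. lam \<Lambda> (card q) (card K) * (if K \<subseteq> dust q then 1 else 0)"
    let ?b = "lyap A (card (nonsingle q)) - lyap A (Suc (card (nonsingle q)))"
    have r0: "0 \<le> ?r" by (intro sum_nonneg mult_nonneg_nonneg lam_nonneg) auto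
    have b0: "0 \<le> ?b" using lyap_antimono[OF A(2), of "card (nonsingle q)" "Suc (card (nonsingle q))"] by simp
    have "\<delta> * L * (if card (nonsingle q) < m \<and> \<not> card (dust q) < D then 1 else 0) \<le> ?b * ?r"
    proof (cases "card (nonsingle q) < m \<and> \<not> card (dust q) < D")
      case True
      have "\<delta> \<le> ?b" unfolding \<delta>_def using True A by (intro lyap_Suc_diff) auto
      moreover have "L \<le> ?r" using birth_le_sum_lam[OF q D(1), of m] True D by simp
      ultimately have "\<delta> * L \<le> ?b * ?r" using L0 b0 by (intro mult_mono) auto
      then show ?thesis using True by simp
    next
      case False
      then show ?thesis using mult_nonneg_nonneg[OF b0 r0] by auto
    qed
    then show ?thesis using gen_lyap_nonsingle_le[OF q A(1)] by linarith
  qed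
  have "\<exists>t. 0 < t \<and> t < s \<and> prob {\<omega>\<in>space M. card (nonsingle (X n t \<omega>)) < m} \<le> e"
  proof (rule ccontr)
    assume "\<not> (\<exists>t. 0 < t \<and> t < s \<and> prob {\<omega>\<in>space M. card (nonsingle (X n t \<omega>)) < m} \<le> e)"
    then have big: "e \<le> prob {\<omega>\<in>space M. card (nonsingle (X n u \<omega>)) < m}" if "0 < u" "u < s" for u
      using that less_imp_le not_le by blast
    have "expectation (\<lambda>\<omega>. ?F (X n s \<omega>)) \<le> ?F (singletons n) + (- 2 / s) * s"
    proof (rule expectation_growth[OF assms(2)])
      fix u assume u: "0 < u" "u < s"
      have u0: "0 \<le> u" using u by simp
      let ?G = "\<lambda>q. card (nonsingle q) < m \<and> \<not> card (dust q) < D"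
      have ev: "{\<omega>\<in>space M. \<psi> (X n u \<omega>)} \<in> events" for \<psi>
        by (rule joint_pred_event[OF u0 u0, where \<phi> = "\<lambda>p q. \<psi> p"])
      have "prob {\<omega>\<in>space M. card (nonsingle (X n u \<omega>)) < m}
        \<le> prob ({\<omega>\<in>space M. ?G (X n u \<omega>)} \<union> {\<omega>\<in>space M. card (dust (X n u \<omega>)) < D})"
        using ev[of ?G] ev[of "\<lambda>q. card (dust q) < D"] by (intro finite_measure_mono) auto
      also have "\<dots> \<le> prob {\<omega>\<in>space M. ?G (X n u \<omega>)} + prob {\<omega>\<in>space M. card (dust (X n u \<omega>)) < D}"
        by (rule measure_Un_le[OF ev[of ?G] ev[of "\<lambda>q. card (dust q) < D"]])
      finally have G: "e / 2 \<le> prob {\<omega>\<in>space M. ?G (X n u \<omega>)}"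
        using big[OF u] dust[OF u] by linarith
      have int: "integrable M (\<lambda>\<omega>. f (X n u \<omega>))" for f :: "nat set set \<Rightarrow> real"
        by (rule joint_integrable[OF u0 u0, where f = "\<lambda>p q. f p"])
      have "expectation (\<lambda>\<omega>. gen \<Lambda> ?F (X n u \<omega>))
        \<le> expectation (\<lambda>\<omega>. kappa A - \<delta> * L * (if ?G (X n u \<omega>) then 1 else 0))"
      proof (rule integral_mono)
        show "integrable M (\<lambda>\<omega>. gen \<Lambda> ?F (X n u \<omega>))" by (rule int)
        show "integrable M (\<lambda>\<omega>. kappa A - \<delta> * L * (if ?G (X n u \<omega>) then 1 else 0))"
          by (rule int[of "\<lambda>q. kappa A - \<delta> * L * (if ?G q then 1 else 0)"])
      qed (rule gen[OF X_parts[OF _ u0]])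
      also have "\<dots> = kappa A - \<delta> * L * expectation (\<lambda>\<omega>. if ?G (X n u \<omega>) then 1 else 0)"
        using int[of "\<lambda>q. if ?G q then 1 else 0"] by (simp add: prob_space)
      also have "expectation (\<lambda>\<omega>. if ?G (X n u \<omega>) then 1 else 0) = prob {\<omega>\<in>space M. ?G (X n u \<omega>)}"
        by (rule prob_eq_expectation[OF u0 u0, where \<phi> = "\<lambda>p q. ?G p", symmetric])
      also have "kappa A - \<delta> * L * prob {\<omega>\<in>space M. ?G (X n u \<omega>)} \<le> kappa A - \<delta> * L * (e / 2)"
        using G \<delta> L0 by (intro diff_left_mono mult_left_mono) auto
      also have "\<dots> = - 2 / s" unfolding L by simp
      finally show "expectation (\<lambda>\<omega>. gen \<Lambda> ?F (X n u \<omega>)) \<le> - 2 / s" .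
    qed
    also have "\<dots> \<le> 1 + - 2" using lyap_range(2)[OF A(2), of "card (nonsingle (singletons n))"] assms by simp
    finally have "expectation (\<lambda>\<omega>. ?F (X n s \<omega>)) < 0" by simp
    moreover have "0 \<le> expectation (\<lambda>\<omega>. ?F (X n s \<omega>))" by (intro Bochner_Integration.integral_nonneg lyap_range)
    ultimately show False by simp
  qed
  then show ?thesis by blast
qed

lemma card_nonsingle_restr_le:
  assumes P: "partition_on UNIV P" and "n0 \<le> n"
  shows "card (nonsingle (restr n0 P)) \<le> card {b \<in> restr n P. 2 \<le> card (b \<inter> {..<n0})}"
proof -
  let ?R = "{b \<in> restr n P. 2 \<le> card (b \<inter> {..<n0})}"
  have fin: "finite ?R" using partsD(2)[OF restr_parts[OF P]] by simp
  have "nonsingle (restr n0 P) \<subseteq> (\<lambda>b. b \<inter> {..<n0}) ` ?R"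
  proof
    fix c assume c: "c \<in> nonsingle (restr n0 P)"
    then have "c \<in> restr n0 P" and c2: "2 \<le> card c" by (auto simp: nonsingle_def)
    then obtain b where b: "b \<in> P" "c = b \<inter> {..<n0}" "c \<noteq> {}" by (elim restrE)
    obtain i where i: "i \<in> b" "i < n0" using b by auto
    have "b \<inter> {..<n} \<in> restr n P" using b i assms by (intro restrI[of b P i]) auto
    moreover have "b \<inter> {..<n} \<inter> {..<n0} = c" using b assms by auto
    ultimately show "c \<in> (\<lambda>b. b \<inter> {..<n0}) ` ?R" using c2 by (intro image_eqI[of _ _ "b \<inter> {..<n}"]) auto
  qed
  then have "card (nonsingle (restr n0 P)) \<le> card ((\<lambda>b. b \<inter> {..<n0}) ` ?R)" using fin by (intro card_mono) auto
  also have "\<dots> \<le> card ?R" using fin by (rule card_image_le)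
  finally show ?thesis .
qed

end

lemma block_of_all_restrictions:
  assumes Q: "partition_on UNIV Q" and "i \<in> b" and b: "\<And>n. n0 \<le> n \<Longrightarrow> b \<inter> {..<n} \<in> restr n Q"
  shows "b \<in> Q"
proof -
  have U: "\<Union>Q = UNIV" using partition_onD1[OF Q] by simp
  obtain c where c: "c \<in> Q" "i \<in> c" using U by (metis UNIV_I UnionE)
  have "b \<inter> {..<n} = c \<inter> {..<n}" if n: "max n0 (Suc i) \<le> n" for n
  proof -
    have "b \<inter> {..<n} \<in> restr n Q" using b n by simp
    then obtain c' where c': "c' \<in> Q" "b \<inter> {..<n} = c' \<inter> {..<n}" by (elim restrE)
    have "i \<in> b \<inter> {..<n}" using assms(2) n by auto
    then have "i \<in> c'" using c' by auto
    then have "c' = c" using partition_onD2[OF Q] c c' unfolding disjoint_def by blast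
    then show ?thesis using c' by simp
  qed
  note eq = this
  have "k \<in> b \<longleftrightarrow> k \<in> c" for k
  proof -
    have "b \<inter> {..<max (max n0 (Suc i)) (Suc k)} = c \<inter> {..<max (max n0 (Suc i)) (Suc k)}" by (rule eq) simp
    moreover have "k \<in> {..<max (max n0 (Suc i)) (Suc k)}" by simp
    ultimately show ?thesis by blast
  qed
  then have "b = c" by auto
  then show ?thesis using c by simp
qed

lemma card_decreasing_limit:
  fixes G :: "nat \<Rightarrow> 'a set"
  assumes "finite (G n0)" and mono: "\<And>n n'. n0 \<le> n \<Longrightarrow> n \<le> n' \<Longrightarrow> G n' \<subseteq> G n"
    and card: "\<And>n. n0 \<le> n \<Longrightarrow> m \<le> card (G n)"
  shows "m \<le> card (\<Inter>n\<in>{n0..}. G n)"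
proof -
  let ?H = "\<Inter>n\<in>{n0..}. G n"
  have "\<forall>b\<in>G n0. eventually (\<lambda>n. b \<in> G n \<longrightarrow> b \<in> ?H) sequentially"
  proof
    fix b
    show "eventually (\<lambda>n. b \<in> G n \<longrightarrow> b \<in> ?H) sequentially"
    proof (cases "b \<in> ?H")
      case False
      then obtain k where k: "n0 \<le> k" "b \<notin> G k" by auto
      then have "b \<notin> G n" if "k \<le> n" for n using mono[OF k(1) that] by blast
      then show ?thesis unfolding eventually_sequentially by blast
    qed simp
  qed
  then have "eventually (\<lambda>n. \<forall>b\<in>G n0. b \<in> G n \<longrightarrow> b \<in> ?H) sequentially"
    by (rule eventually_ball_finite[OF assms(1)])
  then obtain N where N: "\<And>n. N \<le> n \<Longrightarrow> \<forall>b\<in>G n0. b \<in> G n \<longrightarrow> b \<in> ?H"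
    unfolding eventually_sequentially by blast
  define k where "k = max N n0"
  have sub: "G k \<subseteq> G n0" by (rule mono) (auto simp: k_def)
  have "N \<le> k" by (simp add: k_def)
  then have "G k \<subseteq> ?H" using N[of k] sub by blast
  moreover have "?H \<subseteq> G n0" by auto
  then have "finite ?H" using assms(1) finite_subset by blast
  ultimately have "card (G k) \<le> card ?H" by (intro card_mono)
  then show ?thesis using card[of k] by (simp add: k_def)
qed

lemma block_between:
  assumes "partition_on UNIV P" "partition_on UNIV Q" "partition_on UNIV R"
    and PQ: "\<And>i j. sim P i j \<Longrightarrow> sim Q i j" and QR: "\<And>i j. sim Q i j \<Longrightarrow> sim R i j"
    and b: "b \<in> P" "b \<in> R"
  shows "b \<in> Q"
proof -
  have "b \<noteq> {}" using partition_onD3[OF assms(1)] b by auto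
  then obtain i where i: "i \<in> b" by auto
  have "\<Union>Q = UNIV" using partition_onD1[OF assms(2)] by simp
  then obtain c where c: "c \<in> Q" "i \<in> c" by (metis UNIV_I UnionE)
  have eq: "b = {k. sim P i k}" "b = {k. sim R i k}" "c = {k. sim Q i k}"
    by (rule block_eq_sim[OF assms(1) b(1) i], rule block_eq_sim[OF assms(3) b(2) i], rule block_eq_sim[OF assms(2) c])
  have "b \<subseteq> c" unfolding eq(3) by (subst eq(1)) (use PQ in auto)
  moreover have "c \<subseteq> b" unfolding eq(3) by (subst eq(2)) (use QR in auto)
  ultimately have "b = c" by (rule equalityI)
  then show ?thesis using c by simp
qed

context dust_coalescent
begin

lemma AE_many_atomic:
  assumes mu2: "mu_neg \<Lambda> 2 = \<infinity>" and sT: "0 < s" "s < T"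
  shows "AE \<omega> in M. \<forall>t. s \<le> t \<longrightarrow> t \<le> T \<longrightarrow> (\<exists>B \<subseteq> {b \<in> Coal t \<omega>. atomic b}. finite B \<and> m \<le> card B)"
proof (rule AE_by_small_exceptions)
  fix e :: real assume e: "0 < e"
  obtain A where A: "(1 + real m)\<^sup>2 \<le> A" "3 \<le> A" "kappa A \<le> e / (4 * T)"
    using kappa_small[of "e / (4 * T)" "(1 + real m)\<^sup>2"] e sT by auto
  define m0 where "m0 = nat \<lceil>A\<rceil>"
  have m0: "A \<le> real m0" unfolding m0_def by linarith
  then have m0': "0 < m0" using A by (cases m0) auto
  obtain n0 t0 where t0: "0 < t0" "t0 < s"
    and few: "prob {\<omega>\<in>space M. card (nonsingle (X n0 t0 \<omega>)) < m0} \<le> e / 2"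
    using exists_time_many_blocks[OF mu2 sT(1), of "e / 2" m0] e m0' by auto
  have t0': "0 \<le> t0" "t0 < T" "0 \<le> T" using t0 sT by auto
  define R where "R p = {b\<in>p. 2 \<le> card (b \<inter> {..<n0})}" for p :: "nat set set"
  define E0 where "E0 = {\<omega>\<in>space M. card (nonsingle (X n0 t0 \<omega>)) < m0}"
  define E1 where "E1 n = {\<omega>\<in>space M. A \<le> 1 + real (card (R (X n t0 \<omega>) \<inter> X n t0 \<omega>))
      \<and> card (R (X n t0 \<omega>) \<inter> X n T \<omega>) < m}" for n
  define E where "E = (\<Union>N. \<Inter>n\<in>{N..}. E0 \<union> E1 n)"
  have E0: "E0 \<in> events"
    unfolding E0_def by (rule joint_pred_event[OF t0'(1,1), where \<phi> = "\<lambda>p q. card (nonsingle p) < m0"])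
  have E1: "E1 n \<in> events" for n
    unfolding E1_def
    by (rule joint_pred_event[OF t0'(1,3), where \<phi> = "\<lambda>p q. A \<le> 1 + real (card (R p \<inter> p)) \<and> card (R p \<inter> q) < m"])
  have pE: "prob (E0 \<union> E1 n) \<le> e" for n
  proof -
    have "prob (E1 n) \<le> 2 * kappa A * (T - t0)"
      unfolding E1_def by (rule prob_few_survivors_le[OF t0'(1,2) A(2,1)])
    also have "\<dots> \<le> 2 * (e / (4 * T)) * T" using A t0 t0' kappa_nonneg e by (intro mult_mono) auto
    also have "\<dots> = e / 2" using t0 t0' by simp
    finally show ?thesis using measure_Un_le[OF E0 E1, of n] few unfolding E0_def by linarith
  qed
  have E01: "E0 \<union> E1 n \<in> events" for n using E0 E1 by auto
  have "prob E \<le> e" unfolding E_def by (rule measure_liminf_le[OF E01 pE])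
  moreover have "E \<in> events" unfolding E_def using E01 by (intro sets.countable_UN sets.countable_INT' image_subsetI) auto
  moreover have "AE \<omega> in M. \<omega> \<notin> E \<longrightarrow>
      (\<forall>t. s \<le> t \<longrightarrow> t \<le> T \<longrightarrow> (\<exists>B \<subseteq> {b \<in> Coal t \<omega>. atomic b}. finite B \<and> m \<le> card B))"
    using AE_sim_mono_all AE_nonsingleton_atomic[OF t0'(1)] AE_space
  proof eventually_elim
    case (elim \<omega>)
    note w = elim(3)
    show ?case
    proof (intro impI allI)
      fix t assume nE: "\<omega> \<notin> E" and t: "s \<le> t" "t \<le> T"
      note P0 = Coal_partition[OF w t0'(1)] and PT = Coal_partition[OF w t0'(3)]
      have Pt: "partition_on UNIV (Coal t \<omega>)" using Coal_partition[OF w] t sT by simp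
      define G where "G n = {b\<in>Coal t0 \<omega>. 2 \<le> card (b \<inter> {..<n0}) \<and> b \<inter> {..<n} \<in> X n T \<omega>}" for n
      have ne: "\<exists>i. i \<in> b \<and> i < n0" if "2 \<le> card (b \<inter> {..<n0})" for b
      proof (rule ccontr)
        assume "\<not> (\<exists>i. i \<in> b \<and> i < n0)"
        then have "b \<inter> {..<n0} = {}" by auto
        then show False using that by simp
      qed
      have finG: "finite (G n)" for n
      proof (rule finite_imageD[where f = "\<lambda>b. b \<inter> {..<n0}"])
        show "finite ((\<lambda>b. b \<inter> {..<n0}) ` G n)" by (rule finite_subset[of _ "Pow {..<n0}"]) auto
        show "inj_on (\<lambda>b. b \<inter> {..<n0}) (G n)"
        proof (rule inj_onI)
          fix b c assume bc: "b \<in> G n" "c \<in> G n" "b \<inter> {..<n0} = c \<inter> {..<n0}"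
          obtain i where "i \<in> b" "i < n0" using ne bc(1) by (auto simp: G_def)
          then have "i \<in> b" "i \<in> c" using bc(3) by auto
          then show "b = c" using partition_onD2[OF P0] bc(1,2) unfolding disjoint_def G_def by blast
        qed
      qed
      have monoG: "G n' \<subseteq> G n" if n: "n0 \<le> n" "n \<le> n'" for n n'
      proof
        fix b assume b: "b \<in> G n'"
        then have b': "b \<in> Coal t0 \<omega>" "2 \<le> card (b \<inter> {..<n0})" "b \<inter> {..<n'} \<in> X n' T \<omega>" by (auto simp: G_def)
        obtain c where c: "c \<in> Coal T \<omega>" "b \<inter> {..<n'} = c \<inter> {..<n'}" using b'(3) by (elim restrE)
        obtain i where i: "i \<in> b" "i < n0" using ne b' by auto
        have "b \<inter> {..<n} = (b \<inter> {..<n'}) \<inter> {..<n}" using n by auto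
        also have "\<dots> = c \<inter> {..<n}" unfolding c(2) using n by auto
        finally have eq: "b \<inter> {..<n} = c \<inter> {..<n}" .
        have "i \<in> b \<inter> {..<n}" using i n by simp
        then have "i \<in> c" unfolding eq by simp
        then have "c \<inter> {..<n} \<in> X n T \<omega>" using c(1) i n by (intro restrI[of c _ i]) auto
        then show "b \<in> G n" using b' eq by (simp add: G_def)
      qed
      have cardG: "m \<le> card (G n)" if n: "n0 \<le> n" for n
      proof -
        have "\<omega> \<notin> (\<Inter>k\<in>{n..}. E0 \<union> E1 k)" using nE unfolding E_def by blast
        then obtain k where k: "n \<le> k" "\<omega> \<notin> E0" "\<omega> \<notin> E1 k" by auto
        have "m0 \<le> card (nonsingle (X n0 t0 \<omega>))" using k(2) w unfolding E0_def by auto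
        also have "\<dots> \<le> card (R (X k t0 \<omega>))"
          unfolding R_def using k n by (intro card_nonsingle_restr_le[OF P0]) auto
        finally have "A \<le> 1 + real (card (R (X k t0 \<omega>)))" using m0 by linarith
        moreover have "R (X k t0 \<omega>) \<inter> X k t0 \<omega> = R (X k t0 \<omega>)" by (auto simp: R_def)
        ultimately have mk: "m \<le> card (R (X k t0 \<omega>) \<inter> X k T \<omega>)" using k(3) w unfolding E1_def by auto
        have "R (X k t0 \<omega>) \<inter> X k T \<omega> \<subseteq> (\<lambda>b. b \<inter> {..<k}) ` G k"
        proof
          fix c assume c: "c \<in> R (X k t0 \<omega>) \<inter> X k T \<omega>"
          then have c': "c \<in> X k t0 \<omega>" "2 \<le> card (c \<inter> {..<n0})" "c \<in> X k T \<omega>" by (auto simp: R_def)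
          obtain b where b: "b \<in> Coal t0 \<omega>" "c = b \<inter> {..<k}" using c'(1) by (elim restrE)
          have "b \<inter> {..<k} \<inter> {..<n0} = b \<inter> {..<n0}" using k n by auto
          then have "b \<in> G k" using b c' by (simp add: G_def)
          then show "c \<in> (\<lambda>b. b \<inter> {..<k}) ` G k" using b by simp
        qed
        then have "card (R (X k t0 \<omega>) \<inter> X k T \<omega>) \<le> card ((\<lambda>b. b \<inter> {..<k}) ` G k)"
          using finG by (intro card_mono) auto
        also have "\<dots> \<le> card (G k)" by (rule card_image_le[OF finG])
        also have "\<dots> \<le> card (G n)" using monoG[OF n k(1)] by (intro card_mono finG)
        finally show ?thesis using mk by linarith
      qed
      define H where "H = (\<Inter>n\<in>{n0..}. G n)"
      have HG: "H \<subseteq> G n" if "n0 \<le> n" for n using that by (auto simp: H_def)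
      have "m \<le> card H" unfolding H_def by (rule card_decreasing_limit[OF finG monoG cardG])
      moreover have "finite H" using HG[of n0] finG finite_subset by blast
      moreover have "H \<subseteq> {b \<in> Coal t \<omega>. atomic b}"
      proof safe
        fix b assume b: "b \<in> H"
        then have b': "b \<in> Coal t0 \<omega>" "2 \<le> card (b \<inter> {..<n0})" using HG[of n0] by (auto simp: G_def)
        obtain i where i: "i \<in> b" "i < n0" using ne b' by auto
        have "b \<in> Coal T \<omega>"
          by (rule block_of_all_restrictions[OF PT i(1), of n0]) (use b HG in \<open>auto simp: G_def\<close>)
        moreover have "sim (Coal t0 \<omega>) k l \<Longrightarrow> sim (Coal t \<omega>) k l" "sim (Coal t \<omega>) k l \<Longrightarrow> sim (Coal T \<omega>) k l" for k l
          using elim(1)[rule_format, of t0 t k l] elim(1)[rule_format, of t T k l] t t0 by auto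
        ultimately show "b \<in> Coal t \<omega>" using b'(1) by (intro block_between[OF P0 Pt PT])
        have "\<not> is_singleton (b \<inter> {..<n0})" using b'(2) unfolding is_singleton_altdef by simp
        moreover have "b \<inter> {..<n0} \<noteq> {}" using i by auto
        ultimately obtain j where "j \<in> b" "j \<noteq> i"
          using i by (metis IntD1 IntI is_singletonI' lessThan_iff)
        then show "atomic b" using elim(2) b'(1) i(1) by blast
      qed
      ultimately show "\<exists>B \<subseteq> {b \<in> Coal t \<omega>. atomic b}. finite B \<and> m \<le> card B" by blast
    qed
  qed
  ultimately show "\<exists>E\<in>events. prob E \<le> e \<and> (AE \<omega> in M. \<omega> \<notin> E \<longrightarrow>
      (\<forall>t. s \<le> t \<longrightarrow> t \<le> T \<longrightarrow> (\<exists>B \<subseteq> {b \<in> Coal t \<omega>. atomic b}. finite B \<and> m \<le> card B)))"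
    by blast
qed

lemma AE_infinite_atomic:
  assumes mu2: "mu_neg \<Lambda> 2 = \<infinity>"
  shows "AE \<omega> in M. \<forall>t>0. infinite {b \<in> Coal t \<omega>. atomic b}"
proof -
  have "AE \<omega> in M. \<forall>k m. \<forall>t. 1 / real (Suc k) \<le> t \<longrightarrow> t \<le> real (k + 2) \<longrightarrow>
      (\<exists>B \<subseteq> {b \<in> Coal t \<omega>. atomic b}. finite B \<and> m \<le> card B)"
  proof (simp only: AE_all_countable, intro allI)
    fix k m :: nat
    show "AE \<omega> in M. \<forall>t. 1 / real (Suc k) \<le> t \<longrightarrow> t \<le> real (k + 2) \<longrightarrow>
      (\<exists>B \<subseteq> {b \<in> Coal t \<omega>. atomic b}. finite B \<and> m \<le> card B)"
    proof (rule AE_many_atomic[OF mu2])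
      have "1 / real (Suc k) \<le> 1" by simp
      then show "1 / real (Suc k) < real (k + 2)" by linarith
    qed simp
  qed
  then show ?thesis
  proof eventually_elim
    case (elim \<omega>)
    show ?case
    proof (intro allI impI notI)
      fix t :: real assume t: "0 < t" and fin: "finite {b \<in> Coal t \<omega>. atomic b}"
      obtain k1 where k1: "1 / real (Suc k1) < t" using t nat_approx_posE by blast
      obtain k2 where k2: "t < real k2" using reals_Archimedean2 by blast
      define k where "k = max k1 k2"
      have "1 / real (Suc k) \<le> 1 / real (Suc k1)" by (intro divide_left_mono) (auto simp: k_def)
      then have "1 / real (Suc k) \<le> t" "t \<le> real (k + 2)" using k1 k2 by (auto simp: k_def)
      then obtain B where B: "B \<subseteq> {b \<in> Coal t \<omega>. atomic b}" "Suc (card {b \<in> Coal t \<omega>. atomic b}) \<le> card B"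
        using elim by blast
      then show False using card_mono[OF fin B(1)] by simp
    qed
  qed
qed

end

theorem theorem3:
  fixes \<Lambda> :: "real measure" and M :: "'w measure" and Coal :: "real \<Rightarrow> 'w \<Rightarrow> nat set set"
  assumes "finite_measure \<Lambda>"
    and "sets \<Lambda> = sets borel"
    and "emeasure \<Lambda> (- {0..1}) = 0"
    and "emeasure \<Lambda> {1} = 0"
    and "lambda_coalescent \<Lambda> M Coal"
    and "mu_neg \<Lambda> 1 < \<infinity>"
  shows "(mu_neg \<Lambda> 2 = \<infinity> \<longrightarrow> (AE \<omega> in M. \<forall>t>0. infinite {b \<in> Coal t \<omega>. atomic b}))
       \<and> (mu_neg \<Lambda> 2 < \<infinity> \<longrightarrow> (AE \<omega> in M. \<forall>t>0. finite {b \<in> Coal t \<omega>. atomic b}))"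
proof -
  interpret dust_coalescent \<Lambda> M Coal
    by (intro dust_coalescent.intro coalescent.intro dust_coalescent_axioms.intro assms)
  show ?thesis using AE_infinite_atomic AE_finite_atomic by blast
qed

end
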